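(* Let $n\ge 1$ and let $\Omega\subset\mathbb{R}^n$ be a bounded domain with $C^2$ boundary. For all $\tau\ge 0$, let $x_\tau$ be a point in $\Omega$ where $\varphi_\tau$ reaches its maximum in $\overline{\Omega}$. Then $$d(x_\tau)\to\max_{\overline{\Omega}}d\quad\text{as }\tau\to+\infty.$$
   Context: A domain is an open connected set. For $x\in\overline{\Omega}$, $d(x)=d(x,\partial\Omega)$ denotes the Euclidean distance from $x$ to $\partial\Omega$. For $v\in L^\infty(\Omega,\mathbb{R}^n)$ (with $\|v\|_\infty:=\||v|\|_{L^\infty(\Omega)}$, $|\cdot|$ Euclidean norm), $\lambda_v\in\mathbb{R}$ denotes the principal eigenvalue of $-\Delta+v\cdot\nabla$ in $\Omega$ with Dirichlet boundary condition, i.e. the real number for which there is $\varphi\in W^{2,p}(\Omega)$ for all $p\in[1,\infty)$ with $-\Delta\varphi+v\cdot\nabla\varphi=\lambda_v\varphi$ in $\Omega$, $\varphi>0$ in $\Omega$, $\varphi=0$ on $\partial\Omega$; such $\varphi$ is unique up to positive scalar multiples. For $\tau\ge0$ set $\lambda(\tau):=\inf\{\lambda_v:\ v\in L^\infty(\Omega,\mathbb{R}^n),\ \|v\|_\infty\le\tau\}$. It is known that this infimum is attained by a unique $v_\tau$, and $\varphi_\tau$ denotes the corresponding principal eigenfunction (with $v=v_\tau$), normalized by $\max_{\overline\Omega}\varphi_\tau=1$. It is known that $v_\tau=-\tau\,\nabla\varphi_\tau/|\nabla\varphi_\tau|$ a.e. in $\Omega$, that $\varphi_\tau\in C^{1,\alpha}(\overline\Omega)\cap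 C^{2,\alpha}_{loc}(\Omega)$ for all $\alpha\in(0,1)$, and that $\varphi_\tau$ is the unique function with $\max_{\overline\Omega}\varphi_\tau=1$ satisfying $-\Delta\varphi_\tau-\tau|\nabla\varphi_\tau|=\lambda(\tau)\varphi_\tau$ in $\Omega$, $\varphi_\tau>0$ in $\Omega$, $\varphi_\tau=0$ on $\partial\Omega$; moreover $\lambda(\tau)>0$. *)

theory Defs
  imports "HOL-Analysis.Analysis" "HOL-Probability.Essential_Supremum"
begin

text \<open>Meant for open \<open>S\<close>: \<open>f\<close> has continuous partial derivatives up to order \<open>k\<close> on \<open>S\<close>.\<close>

primrec Ck_on :: "nat \<Rightarrow> 'a::euclidean_space set \<Rightarrow> ('a \<Rightarrow> real) \<Rightarrow> bool" where
  "Ck_on 0 S f \<longleftrightarrow> continuous_on S f"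
| "Ck_on (Suc k) S f \<longleftrightarrow>
     (\<forall>x\<in>S. f differentiable (at x)) \<and>
     (\<forall>i\<in>Basis. Ck_on k S (\<lambda>x. frechet_derivative f (at x) i))"

text \<open>Near every boundary point \<open>\<Omega>\<close> is the strict epigraph, in some unit direction \<open>e\<close>, of a
  \<open>C\<^sup>2\<close> function of the component \<open>y - (y \<bullet> e) e\<close> orthogonal to \<open>e\<close>. The function \<open>\<gamma>\<close> is defined
  on the whole space to avoid a type of dimension \<open>n - 1\<close>; only its values on the hyperplane
  orthogonal to \<open>e\<close> matter, and any \<open>C\<^sup>2\<close> function there extends to the whole space by composition
  with the orthogonal projection.\<close>

definition C2_boundary :: "'a::euclidean_space set \<Rightarrow> bool" where
  "C2_boundary \<Omega> \<longleftrightarrow>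
     (\<forall>x0\<in>frontier \<Omega>. \<exists>r>0. \<exists>e \<gamma>. norm e = 1 \<and> Ck_on 2 UNIV \<gamma> \<and>
        \<Omega> \<inter> ball x0 r = {y \<in> ball x0 r. \<gamma> (y - (y \<bullet> e) *\<^sub>R e) < y \<bullet> e})"

definition Linf_norm :: "'a::euclidean_space set \<Rightarrow> ('a \<Rightarrow> 'b::euclidean_space) \<Rightarrow> ereal" where
  "Linf_norm \<Omega> v = esssup (lebesgue_on \<Omega>) (\<lambda>x. ereal (norm (v x)))"

definition Linf :: "'a::euclidean_space set \<Rightarrow> ('a \<Rightarrow> 'b::euclidean_space) set" where
  "Linf \<Omega> = {v \<in> borel_measurable (lebesgue_on \<Omega>). Linf_norm \<Omega> v < \<infinity>}"

definition Lp :: "'a::euclidean_space set \<Rightarrow> real \<Rightarrow> ('a \<Rightarrow> real) set" where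
  "Lp \<Omega> p = {f \<in> borel_measurable (lebesgue_on \<Omega>).
               integrable (lebesgue_on \<Omega>) (\<lambda>x. \<bar>f x\<bar> powr p)}"

definition test_function :: "'a::euclidean_space set \<Rightarrow> ('a \<Rightarrow> real) \<Rightarrow> bool" where
  "test_function \<Omega> \<eta> \<longleftrightarrow>
     (\<forall>k. Ck_on k UNIV \<eta>) \<and>
     compact (closure {x. \<eta> x \<noteq> 0}) \<and> closure {x. \<eta> x \<noteq> 0} \<subseteq> \<Omega>"

definition locally_integrable :: "'a::euclidean_space set \<Rightarrow> ('a \<Rightarrow> real) \<Rightarrow> bool" where
  "locally_integrable \<Omega> f \<longleftrightarrow> (\<forall>K. compact K \<and> K \<subseteq> \<Omega> \<longrightarrow> integrable (lebesgue_on K) f)"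

definition has_weak_deriv ::
  "'a::euclidean_space set \<Rightarrow> 'a \<Rightarrow> ('a \<Rightarrow> real) \<Rightarrow> ('a \<Rightarrow> real) \<Rightarrow> bool" where
  "has_weak_deriv \<Omega> i f g \<longleftrightarrow>
     locally_integrable \<Omega> f \<and> locally_integrable \<Omega> g \<and>
     (\<forall>\<eta>. test_function \<Omega> \<eta> \<longrightarrow>
        integral\<^sup>L (lebesgue_on \<Omega>) (\<lambda>x. f x * frechet_derivative \<eta> (at x) i)
        = - integral\<^sup>L (lebesgue_on \<Omega>) (\<lambda>x. g x * \<eta> x))"

text \<open>Weak derivatives are unique only up to null sets, hence a choice of representative; every use
  below is insensitive to it.\<close>

definition weak_deriv ::
  "'a::euclidean_space set \<Rightarrow> 'a \<Rightarrow> ('a \<Rightarrow> real) \<Rightarrow> 'a \<Rightarrow> real" where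
  "weak_deriv \<Omega> i f = (SOME g. has_weak_deriv \<Omega> i f g)"

definition W2p :: "'a::euclidean_space set \<Rightarrow> real \<Rightarrow> ('a \<Rightarrow> real) set" where
  "W2p \<Omega> p = {f \<in> Lp \<Omega> p. \<forall>i\<in>Basis.
      (\<exists>g. has_weak_deriv \<Omega> i f g) \<and> weak_deriv \<Omega> i f \<in> Lp \<Omega> p \<and>
      (\<forall>j\<in>Basis. (\<exists>h. has_weak_deriv \<Omega> j (weak_deriv \<Omega> i f) h) \<and>
                 weak_deriv \<Omega> j (weak_deriv \<Omega> i f) \<in> Lp \<Omega> p)}"

definition weak_grad :: "'a::euclidean_space set \<Rightarrow> ('a \<Rightarrow> real) \<Rightarrow> 'a \<Rightarrow> 'a" where
  "weak_grad \<Omega> f x = (\<Sum>i\<in>Basis. weak_deriv \<Omega> i f x *\<^sub>R i)"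

definition weak_laplacian :: "'a::euclidean_space set \<Rightarrow> ('a \<Rightarrow> real) \<Rightarrow> 'a \<Rightarrow> real" where
  "weak_laplacian \<Omega> f x = (\<Sum>i\<in>Basis. weak_deriv \<Omega> i (weak_deriv \<Omega> i f) x)"

text \<open>An element of all \<open>W\<^sup>2\<^sup>,\<^sup>p(\<Omega>)\<close> has a unique representative that is continuous on the closure
  of \<open>\<Omega>\<close> (Sobolev embedding); \<open>\<phi>\<close> is that representative, so that the sign and boundary
  conditions can be read pointwise. The equation holds almost everywhere.\<close>

definition principal_eigenfunction ::
  "'a::euclidean_space set \<Rightarrow> ('a \<Rightarrow> 'a) \<Rightarrow> real \<Rightarrow> ('a \<Rightarrow> real) \<Rightarrow> bool" where
  "principal_eigenfunction \<Omega> v l \<phi> \<longleftrightarrow>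
     (\<forall>p\<ge>1. \<phi> \<in> W2p \<Omega> p) \<and> continuous_on (closure \<Omega>) \<phi> \<and>
     (AE x in lebesgue_on \<Omega>. - weak_laplacian \<Omega> \<phi> x + v x \<bullet> weak_grad \<Omega> \<phi> x = l * \<phi> x) \<and>
     (\<forall>x\<in>\<Omega>. \<phi> x > 0) \<and> (\<forall>x\<in>frontier \<Omega>. \<phi> x = 0)"

definition principal_eigenvalue :: "'a::euclidean_space set \<Rightarrow> ('a \<Rightarrow> 'a) \<Rightarrow> real \<Rightarrow> bool" where
  "principal_eigenvalue \<Omega> v l \<longleftrightarrow> (\<exists>\<phi>. principal_eigenfunction \<Omega> v l \<phi>)"

text \<open>\<open>lam\<close> is the map \<open>v \<mapsto> \<lambda>\<^sub>v\<close>.\<close>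

definition min_eigenvalue ::
  "'a::euclidean_space set \<Rightarrow> (('a \<Rightarrow> 'a) \<Rightarrow> real) \<Rightarrow> real \<Rightarrow> real" where
  "min_eigenvalue \<Omega> lam \<tau> = (INF w\<in>{w \<in> Linf \<Omega>. Linf_norm \<Omega> w \<le> ereal \<tau>}. lam w)"

end

theory Submission
  imports Defs
begin

text \<open>
  Write \<open>d\<close> for the distance to the boundary and \<open>R = max d\<close>, attained at \<open>c\<close>. Two exponential
  rates are compared.

  \<^item> The minimal eigenvalue is at most of order \<open>\<tau> exp (- \<tau> R')\<close> for every \<open>R' < R\<close>
    (\<open>eigenvalue_upper_bound\<close>). By minimality it suffices to bound the eigenvalue of one drift, the
    one that pushes towards \<open>c\<close> with strength \<open>\<tau>\<close>. It is the gradient of \<open>\<tau> rdist\<close>, with \<open>rdist\<close>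
    a smooth substitute for \<open>|x - c|\<close>, so the operator is symmetric for the weight
    \<open>exp (- \<tau> rdist)\<close>; testing the equation with the weight times an explicit smooth radial
    subsolution supported in \<open>cball c P\<close>, \<open>P < R\<close>, gives the bound.

  \<^item> If \<open>|x\<^sub>\<tau> - z| < r\<close> for the centre \<open>z\<close> of a ball outside \<open>\<Omega>\<close>, then the eigenvalue is
    at least \<open>k exp (- k r)\<close> with \<open>k = \<tau> + O(1)\<close>
    (\<open>max_point_far_from_exterior_ball\<close>): otherwise \<open>1 - exp (- k |x - z|)\<close> is a strict
    supersolution in \<open>\<Omega> \<inter> ball z r\<close>, and comparison gives \<open>\<phi>\<^sub>\<tau>(x\<^sub>\<tau>) < 1\<close>. Only \<open>|v\<^sub>\<tau>| \<le> \<tau>\<close>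
    is used here, not the form of the optimal drift.

  If \<open>d(x\<^sub>\<tau>) \<le> R - e\<close>, an exterior ball close to the nearest boundary point
  (\<open>uniform_exterior_balls\<close>) gives \<open>r = R - e/2\<close> in the second item, which contradicts the first item
  with \<open>R' = R - e/4\<close> once \<open>\<tau>\<close> is large.

  The comparison has to be made for a function whose second derivatives are only weak
  (\<open>maximum_principle\<close>). Suppose that \<open>w\<close> satisfies \<open>\<Delta>w \<ge> \<eta> - \<tau> |\<nabla>w|\<close> with \<open>\<eta> > 0\<close> and has an
  interior maximum \<open>M\<close>, strict in the sense of compact superlevel sets. Testing with \<open>H(w)\<close>, where
  \<open>H\<close> vanishes below a level \<open>s\<^sub>1\<close> slightly smaller than \<open>M\<close>, gives
  \<open>\<integral> H'(w) |\<nabla>w|\<^sup>2 + \<eta> \<integral> H(w) \<le> \<tau> \<integral> |\<nabla>w| H(w)\<close>; if \<open>H(t) = exp (- 1 / (t - s\<^sub>1))\<close>,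
  then \<open>H\<^sup>2 / H' = (t - s\<^sub>1)\<^sup>2 H\<close> is a small multiple of \<open>H\<close> and Young's inequality makes the right-hand
  side absorbable. The computation is done for mollifications; the resulting errors are controlled
  by the continuity of translations in \<open>L\<^sup>1\<close> (\<open>tendsto_translation_L1\<close>), so that neither Sobolev
  embeddings nor regularity of the gradient are needed. The same principle with \<open>w = \<phi>\<close> shows that
  principal eigenvalues are nonnegative (\<open>principal_eigenvalue_nonneg\<close>), hence that the infimum
  defining the minimal eigenvalue is a genuine lower bound.
\<close>

section \<open>Smooth functions\<close>

text \<open>\<open>C\<^sup>\<infinity>\<close> functions on the whole space, in the sense in which test functions are smooth.\<close>

definition smooth :: "('a::euclidean_space \<Rightarrow> real) \<Rightarrow> bool" where
  "smooth f \<longleftrightarrow> (\<forall>k. Ck_on k UNIV f)"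

text \<open>\<open>d\<close> is the derivative of \<open>f\<close> at \<open>x\<close> in the direction \<open>i\<close>. The convolutions and the fields
  to which the divergence theorem is applied are only ever differentiated along lines, which keeps
  the calculus one-dimensional.\<close>

definition has_dir_deriv :: "('a::real_normed_vector \<Rightarrow> real) \<Rightarrow> 'a \<Rightarrow> real \<Rightarrow> 'a \<Rightarrow> bool" where
  "has_dir_deriv f i d x \<longleftrightarrow> ((\<lambda>t. f (x + t *\<^sub>R i)) has_real_derivative d) (at 0)"

abbreviation pderiv_dir :: "'a::real_normed_vector \<Rightarrow> ('a \<Rightarrow> real) \<Rightarrow> 'a \<Rightarrow> real" where
  "pderiv_dir i f x \<equiv> frechet_derivative f (at x) i"

lemma has_derivative_imp_dir_deriv:
  assumes "(f has_derivative f') (at x)"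
  shows "has_dir_deriv f i (f' i) x"
proof -
  have "((\<lambda>t::real. x + t *\<^sub>R i) has_derivative (\<lambda>t. t *\<^sub>R i)) (at 0)"
    by (auto intro!: derivative_eq_intros)
  moreover have "(f has_derivative f') (at (x + 0 *\<^sub>R i))" using assms by simp
  ultimately have "((\<lambda>t. f (x + t *\<^sub>R i)) has_derivative (\<lambda>t. f' (t *\<^sub>R i))) (at 0)"
    using has_derivative_compose by blast
  moreover have "(\<lambda>t. f' (t *\<^sub>R i)) = (*) (f' i)"
    using linear_scale[OF has_derivative_linear[OF assms]] by (auto simp: mult.commute)
  ultimately show ?thesis
    unfolding has_dir_deriv_def has_field_derivative_def by simp
qed

lemma differentiable_imp_dir_deriv:
  "f differentiable (at x) \<Longrightarrow> has_dir_deriv f i (pderiv_dir i f x) x"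
  using has_derivative_imp_dir_deriv frechet_derivative_works by blast

lemma has_dir_deriv_unique:
  "has_dir_deriv f i d x \<Longrightarrow> has_dir_deriv f i d' x \<Longrightarrow> d = d'"
  unfolding has_dir_deriv_def by (rule DERIV_unique)

lemma pderiv_dir_eqI:
  assumes "(f has_derivative f') (at x)"
  shows "pderiv_dir i f x = f' i"
  using frechet_derivative_at[OF assms] by simp

lemma pderiv_dir_mult:
  assumes "f differentiable (at x)" "g differentiable (at x)"
  shows "pderiv_dir i (\<lambda>x. f x * g x) x = f x * pderiv_dir i g x + pderiv_dir i f x * g x"
proof -
  have "((\<lambda>x. f x * g x) has_derivative
     (\<lambda>h. f x * frechet_derivative g (at x) h + frechet_derivative f (at x) h * g x)) (at x)"
    using assms by (auto intro!: has_derivative_mult simp flip: frechet_derivative_works)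
  then show ?thesis by (rule pderiv_dir_eqI)
qed

lemma pderiv_dir_add:
  assumes "f differentiable (at x)" "g differentiable (at x)"
  shows "pderiv_dir i (\<lambda>x. f x + g x) x = pderiv_dir i f x + pderiv_dir i g x"
proof -
  have "((\<lambda>x. f x + g x) has_derivative
     (\<lambda>h. frechet_derivative f (at x) h + frechet_derivative g (at x) h)) (at x)"
    using assms by (auto intro!: has_derivative_add simp flip: frechet_derivative_works)
  then show ?thesis by (rule pderiv_dir_eqI)
qed

lemma has_derivative_compose_real:
  fixes u :: "'a::euclidean_space \<Rightarrow> real"
  assumes "u differentiable (at x)" "(F has_real_derivative d) (at (u x))"
  shows "((\<lambda>x. F (u x)) has_derivative (\<lambda>h. d * frechet_derivative u (at x) h)) (at x)"
proof -
  have "(u has_derivative frechet_derivative u (at x)) (at x)"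
    using assms(1) frechet_derivative_works by blast
  then show ?thesis
    using has_derivative_compose[of u _ x UNIV F "(*) d"] assms(2)
    unfolding has_field_derivative_def by simp
qed

lemma Ck_on_0_of_differentiable: "(\<forall>x. f differentiable (at x)) \<Longrightarrow> continuous_on UNIV f"
  by (simp add: continuous_at_imp_continuous_on differentiable_imp_continuous_within)

lemma Ck_on_SucD: "Ck_on (Suc k) UNIV f \<Longrightarrow> Ck_on k UNIV f"
proof (induction k arbitrary: f)
  case 0 then show ?case using Ck_on_0_of_differentiable by auto
next
  case (Suc k)
  from Suc.prems have "\<forall>x. f differentiable (at x)"
    "\<forall>i\<in>Basis. Ck_on (Suc k) UNIV (\<lambda>x. pderiv_dir i f x)"
    unfolding Ck_on.simps(2)[of "Suc k"] by blast+
  moreover from this(2) have "\<forall>i\<in>Basis. Ck_on k UNIV (\<lambda>x. pderiv_dir i f x)"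
    using Suc.IH by blast
  ultimately show ?case by simp
qed

lemma Ck_on_add: "Ck_on k UNIV f \<Longrightarrow> Ck_on k UNIV g \<Longrightarrow> Ck_on k UNIV (\<lambda>x. f x + g x)"
proof (induction k arbitrary: f g)
  case 0 then show ?case by (auto intro: continuous_intros)
next
  case (Suc k)
  then have "(\<lambda>x. pderiv_dir i (\<lambda>x. f x + g x) x) = (\<lambda>x. pderiv_dir i f x + pderiv_dir i g x)" for i
    by (auto simp: pderiv_dir_add)
  with Suc show ?case by (auto intro: differentiable_add)
qed

lemma Ck_on_mult: "Ck_on k UNIV f \<Longrightarrow> Ck_on k UNIV g \<Longrightarrow> Ck_on k UNIV (\<lambda>x. f x * g x)"
proof (induction k arbitrary: f g)
  case 0 then show ?case by (auto intro: continuous_intros)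
next
  case (Suc k)
  have eq: "(\<lambda>x. pderiv_dir i (\<lambda>x. f x * g x) x) = (\<lambda>x. f x * pderiv_dir i g x + pderiv_dir i f x * g x)" for i
    using Suc.prems by (auto simp: pderiv_dir_mult)
  have "Ck_on k UNIV f" "Ck_on k UNIV g" using Suc.prems Ck_on_SucD by blast+
  with Suc show ?case by (auto intro!: differentiable_mult Ck_on_add Suc.IH simp: eq)
qed

lemma Ck_on_const: "Ck_on k UNIV (\<lambda>x. c)"
  by (induction k arbitrary: c) (auto simp: frechet_derivative_const)

text \<open>Composition with a function from a family of real functions that is closed under
  differentiation. Such a family is easier to exhibit than all derivatives of one function.\<close>

lemma Ck_on_compose_family:
  fixes u :: "'a::euclidean_space \<Rightarrow> real"
  assumes D: "\<And>F. F \<in> D \<Longrightarrow> \<exists>F'\<in>D. \<forall>t\<in>T. (F has_real_derivative F' t) (at t)"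
    and u: "\<And>x. u x \<in> T"
  shows "Ck_on k UNIV u \<Longrightarrow> F \<in> D \<Longrightarrow> Ck_on k UNIV (\<lambda>x. F (u x))"
proof (induction k arbitrary: F)
  case 0
  obtain F' where "\<forall>t\<in>T. (F has_real_derivative F' t) (at t)" using D 0 by blast
  then have "isCont F (u x)" for x using u DERIV_isCont by blast
  moreover have "isCont u x" for x
    using 0 by (simp add: continuous_on_eq_continuous_at)
  ultimately have "isCont (\<lambda>x. F (u x)) x" for x by (simp add: isCont_o2)
  then show ?case by (simp add: continuous_at_imp_continuous_on)
next
  case (Suc k)
  obtain F' where F': "F' \<in> D" "\<And>t. t \<in> T \<Longrightarrow> (F has_real_derivative F' t) (at t)" using D Suc by blast
  have dF: "((\<lambda>x. F (u x)) has_derivative (\<lambda>h. F' (u x) * frechet_derivative u (at x) h)) (at x)" for x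
    using Suc.prems F' u by (intro has_derivative_compose_real) auto
  then have eq: "(\<lambda>x. pderiv_dir i (\<lambda>x. F (u x)) x) = (\<lambda>x. F' (u x) * pderiv_dir i u x)" for i
    using pderiv_dir_eqI[OF dF] by blast
  have "Ck_on k UNIV (\<lambda>x. F' (u x))" using Suc Ck_on_SucD F' by blast
  then show ?case using dF Suc.prems
    by (auto simp: eq differentiable_def intro!: Ck_on_mult)
qed

lemma smooth_const: "smooth (\<lambda>x. c)"
  by (simp add: smooth_def Ck_on_const)

lemma smooth_add: "smooth f \<Longrightarrow> smooth g \<Longrightarrow> smooth (\<lambda>x. f x + g x)"
  by (simp add: smooth_def Ck_on_add)

lemma smooth_mult: "smooth f \<Longrightarrow> smooth g \<Longrightarrow> smooth (\<lambda>x. f x * g x)"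
  by (simp add: smooth_def Ck_on_mult)

lemma smooth_diff: "smooth f \<Longrightarrow> smooth g \<Longrightarrow> smooth (\<lambda>x. f x - g x)"
  using smooth_add[of f "\<lambda>x. (-1) * g x"] smooth_mult[OF smooth_const[of "-1"], of g] by simp

lemma smooth_sum: "(\<And>i. i \<in> I \<Longrightarrow> smooth (f i)) \<Longrightarrow> smooth (\<lambda>x. \<Sum>i\<in>I. f i x)"
  by (induction I rule: infinite_finite_induct) (auto intro: smooth_add smooth_const)

lemma smooth_differentiable: "smooth f \<Longrightarrow> f differentiable (at x)"
  unfolding smooth_def by (metis Ck_on.simps(2) UNIV_I)

lemma smooth_continuous: "smooth f \<Longrightarrow> continuous_on S f"
  unfolding smooth_def by (metis Ck_on.simps(1) continuous_on_subset subset_UNIV)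

lemma smooth_pderiv: "smooth f \<Longrightarrow> i \<in> Basis \<Longrightarrow> smooth (\<lambda>x. pderiv_dir i f x)"
  unfolding smooth_def by (metis Ck_on.simps(2))

lemma smooth_inner: "smooth (\<lambda>x. (x - c) \<bullet> a)"
proof -
  have d: "((\<lambda>x. (x - c) \<bullet> a) has_derivative (\<lambda>h. h \<bullet> a)) (at x)" for x
    by (auto intro!: derivative_eq_intros)
  have "Ck_on k UNIV (\<lambda>x. (x - c) \<bullet> a)" for k
  proof (cases k)
    case (Suc m)
    then show ?thesis using d by (auto simp: pderiv_dir_eqI[OF d] Ck_on_const differentiable_def)
  qed (auto intro!: continuous_intros)
  then show ?thesis by (simp add: smooth_def)
qed

lemma smooth_compose_family:
  assumes "\<And>F. F \<in> D \<Longrightarrow> \<exists>F'\<in>D. \<forall>t\<in>T. (F has_real_derivative F' t) (at t)"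
    and "\<And>x. u x \<in> T" "smooth u" "F \<in> D"
  shows "smooth (\<lambda>x. F (u x))"
  using Ck_on_compose_family[where D=D and T=T and u=u, OF assms(1,2)] assms(3,4)
  unfolding smooth_def by blast

lemma smooth_norm2: "smooth (\<lambda>x. (norm (x - c))\<^sup>2)"
proof -
  have "(\<lambda>x. (norm (x - c))\<^sup>2) = (\<lambda>x. \<Sum>i\<in>Basis. ((x - c) \<bullet> i) * ((x - c) \<bullet> i))"
    by (subst power2_norm_eq_inner, subst euclidean_inner) simp
  then show ?thesis by (auto intro!: smooth_sum smooth_mult smooth_inner)
qed

lemma smooth_exp:
  assumes "smooth u" shows "smooth (\<lambda>x. exp (u x))"
  using smooth_compose_family[of "{exp}" UNIV u exp] assms DERIV_exp by blast

lemma smooth_powr: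
  assumes "smooth u" "\<And>x. u x > 0" shows "smooth (\<lambda>x. u x powr a)"
proof -
  let ?D = "{F. \<exists>a b. F = (\<lambda>t::real. a * t powr b)}"
  have "smooth (\<lambda>x. (\<lambda>t. 1 * t powr a) (u x))"
  proof (rule smooth_compose_family[of ?D "{0<..}" u "\<lambda>t. 1 * t powr a"])
    show "(\<lambda>t. 1 * t powr a) \<in> ?D" by blast
    fix F :: "real \<Rightarrow> real" assume "F \<in> ?D"
    then obtain a b where F: "F = (\<lambda>t. a * t powr b)" by blast
    have "(F has_real_derivative (a * b) * t powr (b - 1)) (at t)" if "t > 0" for t
      unfolding F using that by (auto intro!: derivative_eq_intros has_real_derivative_powr)
    then show "\<exists>F'\<in>?D. \<forall>t\<in>{0<..}. (F has_real_derivative F' t) (at t)" by force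
  qed (use assms in auto)
  then show ?thesis by simp
qed

text \<open>The profile of bump functions: \<open>exp (- 1 / t)\<close>, extended by zero.\<close>

definition flat :: "real \<Rightarrow> real" where
  "flat t = (if t \<le> 0 then 0 else exp (- (1 / t)))"

text \<open>The family \<open>q (1 / t) exp (- 1 / t)\<close>, \<open>q\<close> a polynomial, contains \<open>flat\<close> and is closed under
  differentiation.\<close>

definition flat_poly :: "real poly \<Rightarrow> real \<Rightarrow> real" where
  "flat_poly q t = (if t \<le> 0 then 0 else poly q (1 / t) * exp (- (1 / t)))"

lemma flat_eq_flat_poly: "flat = flat_poly 1"
  by (auto simp: flat_def flat_poly_def fun_eq_iff)

lemma tendsto_poly_mult_exp_minus: "((\<lambda>y::real. poly q y * exp (- y)) \<longlongrightarrow> 0) at_top"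
proof -
  have "((\<lambda>y. \<Sum>i\<le>degree q. coeff q i * (y ^ i / exp y)) \<longlongrightarrow> (\<Sum>i\<le>degree q. coeff q i * 0)) at_top"
    by (intro tendsto_sum tendsto_mult tendsto_const tendsto_power_div_exp_0)
  then show ?thesis
    by (simp add: poly_altdef sum_distrib_right exp_minus divide_inverse mult.assoc)
qed

lemma flat_poly_has_derivative:
  "(flat_poly q has_real_derivative flat_poly ((q - pderiv q) * [:0, 0, 1:]) t) (at t)"
proof -
  consider "t < 0" | "t > 0" | "t = 0" by linarith
  then show ?thesis
  proof cases
    case 1
    have "((\<lambda>_. 0) has_real_derivative 0) (at t)" by simp
    then have "(flat_poly q has_real_derivative 0) (at t)"
    proof (rule has_field_derivative_transform_within_open[where S="{..<0}"])
    qed (use 1 in \<open>auto simp: flat_poly_def\<close>)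
    then show ?thesis using 1 by (simp add: flat_poly_def)
  next
    case 2
    have "((\<lambda>t. poly q (1 / t) * exp (- (1 / t))) has_real_derivative
        poly ((q - pderiv q) * [:0, 0, 1:]) (1 / t) * exp (- (1 / t))) (at t)"
      using 2 by (auto intro!: derivative_eq_intros simp: field_simps power2_eq_square)
    then have "(flat_poly q has_real_derivative
        poly ((q - pderiv q) * [:0, 0, 1:]) (1 / t) * exp (- (1 / t))) (at t)"
    proof (rule has_field_derivative_transform_within_open[where S="{0<..}"])
    qed (use 2 in \<open>auto simp: flat_poly_def\<close>)
    then show ?thesis using 2 by (simp add: flat_poly_def)
  next
    case 3
    have "((\<lambda>h. flat_poly q h / h) \<longlongrightarrow> 0) (at_right 0)"
    proof -
      have "((\<lambda>h. poly ([:0, 1:] * q) (inverse h) * exp (- inverse h)) \<longlongrightarrow> 0) (at_right (0::real))"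
        using filterlim_compose[OF tendsto_poly_mult_exp_minus[of "[:0, 1:] * q"] filterlim_inverse_at_top_right]
        by simp
      then show ?thesis
        by (rule Lim_transform_eventually)
          (auto simp: eventually_at_right_field flat_poly_def field_simps intro!: exI[of _ 1])
    qed
    moreover have "((\<lambda>h. flat_poly q h / h) \<longlongrightarrow> 0) (at_left 0)"
      by (rule Lim_transform_eventually[OF tendsto_const])
         (auto simp: eventually_at_left_field flat_poly_def intro!: exI[of _ "-1"])
    ultimately have "((\<lambda>h. flat_poly q h / h) \<longlongrightarrow> 0) (at 0)"
      by (simp add: filterlim_at_split)
    then show ?thesis using 3 by (simp add: DERIV_def flat_poly_def)
  qed
qed

lemma smooth_flat:
  assumes "smooth u" shows "smooth (\<lambda>x. flat (u x))"
  unfolding flat_eq_flat_poly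
  using smooth_compose_family[of "range flat_poly" UNIV u "flat_poly 1"] assms
    flat_poly_has_derivative by blast

text \<open>The derivative of \<open>flat\<close>; for \<open>t \<le> 0\<close> both sides vanish because \<open>flat t = 0\<close>.\<close>

lemma flat_has_derivative: "(flat has_real_derivative flat t / t\<^sup>2) (at t)"
  using flat_poly_has_derivative[of 1 t]
  by (auto simp: flat_eq_flat_poly flat_poly_def pderiv_1 power2_eq_square field_simps split: if_splits)

lemma flat_bounds: "0 \<le> flat t" "flat t \<le> 1" "t > 0 \<Longrightarrow> flat t > 0" "t \<le> 0 \<Longrightarrow> flat t = 0"
  by (auto simp: flat_def)

lemma flat_mono: "s \<le> t \<Longrightarrow> flat s \<le> flat t"
  by (auto simp: flat_def field_simps)

lemma continuous_flat: "continuous_on S flat"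
  using flat_has_derivative DERIV_isCont continuous_at_imp_continuous_on by blast

section \<open>Test functions\<close>

lemma test_function_smooth: "test_function \<Omega> \<eta> \<Longrightarrow> smooth \<eta>"
  unfolding test_function_def smooth_def by blast

lemma test_function_support:
  assumes "test_function \<Omega> \<eta>"
  shows "compact (closure {x. \<eta> x \<noteq> 0})" "closure {x. \<eta> x \<noteq> 0} \<subseteq> \<Omega>"
  using assms unfolding test_function_def by blast+

lemma test_function_zero: "test_function \<Omega> \<eta> \<Longrightarrow> x \<notin> \<Omega> \<Longrightarrow> \<eta> x = 0"
  using test_function_support(2)[of \<Omega> \<eta>] closure_subset[of "{x. \<eta> x \<noteq> 0}"] by blast

lemma test_functionI:
  assumes "smooth \<eta>" "compact K" "K \<subseteq> \<Omega>" "\<And>x. x \<notin> K \<Longrightarrow> \<eta> x = 0"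
  shows "test_function \<Omega> \<eta>"
proof -
  have sub: "{x. \<eta> x \<noteq> 0} \<subseteq> K" using assms(4) by blast
  then have "closure {x. \<eta> x \<noteq> 0} \<subseteq> K"
    by (rule closure_minimal) (rule compact_imp_closed[OF assms(2)])
  moreover have "compact (closure {x. \<eta> x \<noteq> 0})"
    using bounded_subset[OF compact_imp_bounded[OF assms(2)] sub] by simp
  ultimately show ?thesis using assms(1,3) unfolding test_function_def smooth_def by blast
qed

lemma test_function_mult:
  assumes "test_function \<Omega> \<eta>" "smooth f"
  shows "test_function \<Omega> (\<lambda>x. f x * \<eta> x)"
proof (rule test_functionI[where K="closure {x. \<eta> x \<noteq> 0}"])
  fix x assume "x \<notin> closure {x. \<eta> x \<noteq> 0}"
  then show "f x * \<eta> x = 0" using closure_subset[of "{x. \<eta> x \<noteq> 0}"] by auto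
qed (use assms test_function_support test_function_smooth smooth_mult in blast)+

lemma pderiv_dir_zero_open:
  assumes "open S" "x \<in> S" "\<And>y. y \<in> S \<Longrightarrow> f y = (0::real)"
  shows "pderiv_dir i f x = 0"
proof -
  have "((\<lambda>_. 0) has_derivative (\<lambda>_. 0)) (at x)" by simp
  then have "(f has_derivative (\<lambda>_. 0)) (at x)"
    by (rule has_derivative_transform_within_open[OF _ assms(1,2)]) (use assms(3) in auto)
  then show ?thesis by (rule pderiv_dir_eqI)
qed

lemma test_function_pderiv:
  assumes "test_function \<Omega> \<eta>" "i \<in> Basis"
  shows "test_function \<Omega> (\<lambda>x. pderiv_dir i \<eta> x)"
proof (rule test_functionI[where K="closure {x. \<eta> x \<noteq> 0}"])
  fix x assume "x \<notin> closure {x. \<eta> x \<noteq> 0}"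
  then show "pderiv_dir i \<eta> x = 0"
    by (intro pderiv_dir_zero_open[where S="- closure {x. \<eta> x \<noteq> 0}"])
       (use closure_subset[of "{x. \<eta> x \<noteq> 0}"] in auto)
qed (use assms test_function_support test_function_smooth smooth_pderiv in blast)+

lemma test_function_bounded:
  assumes "test_function \<Omega> \<eta>"
  obtains B where "\<And>x. \<bar>\<eta> x\<bar> \<le> B"
proof -
  let ?K = "closure {x. \<eta> x \<noteq> 0}"
  have "compact (\<eta> ` ?K)"
    using assms test_function_support test_function_smooth smooth_continuous compact_continuous_image
    by blast
  then obtain B where B: "\<And>x. x \<in> ?K \<Longrightarrow> \<bar>\<eta> x\<bar> \<le> B"
    by (metis bounded_iff compact_imp_bounded imageI real_norm_def)
  have "\<bar>\<eta> x\<bar> \<le> max B 0" for x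
    using B[of x] closure_subset[of "{x. \<eta> x \<noteq> 0}"] by (cases "\<eta> x = 0") force+
  then show thesis using that by blast
qed

lemma test_function_borel: "test_function \<Omega> \<eta> \<Longrightarrow> \<eta> \<in> borel_measurable borel"
  by (simp add: borel_measurable_continuous_onI smooth_continuous test_function_smooth)

section \<open>Directional derivatives and integrals\<close>

lemma has_dir_deriv_along_line:
  assumes "has_dir_deriv f i d (x + s *\<^sub>R i)"
  shows "((\<lambda>t. f (x + t *\<^sub>R i)) has_real_derivative d) (at s)"
proof -
  have "((\<lambda>t. (\<lambda>r. f (x + r *\<^sub>R i)) (t + s)) has_real_derivative d) (at 0)"
    using assms unfolding has_dir_deriv_def by (simp add: algebra_simps)
  then show ?thesis using DERIV_shift[of "\<lambda>r. f (x + r *\<^sub>R i)" d 0 s] by simp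
qed

lemma dir_deriv_bound_imp_lipschitz:
  assumes "\<And>x. has_dir_deriv f i (f' x) x" "\<And>x. \<bar>f' x\<bar> \<le> B"
  shows "\<bar>f (x + t *\<^sub>R i) - f x\<bar> \<le> B * \<bar>t\<bar>"
proof -
  have "norm ((\<lambda>t. f (x + t *\<^sub>R i)) t - (\<lambda>t. f (x + t *\<^sub>R i)) 0) \<le> B * norm (t - 0)"
  proof (rule field_differentiable_bound[where S=UNIV])
    show "((\<lambda>t. f (x + t *\<^sub>R i)) has_real_derivative f' (x + s *\<^sub>R i)) (at s within UNIV)" for s
      using has_dir_deriv_along_line assms(1) by blast
  qed (use assms in auto)
  then show ?thesis by simp
qed

lemma has_dir_deriv_quotient_sequence:
  assumes "has_dir_deriv f i d x" "\<And>n. X n \<noteq> 0" "X \<longlonglongrightarrow> (0::real)"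
  shows "(\<lambda>n. (f (x + X n *\<^sub>R i) - f x) / X n) \<longlonglongrightarrow> d"
proof -
  have "((\<lambda>h. (f (x + h *\<^sub>R i) - f x) / h) \<longlongrightarrow> d) (at 0)"
    using assms(1) unfolding has_dir_deriv_def DERIV_def by simp
  then show ?thesis
    using assms(2,3) unfolding tendsto_at_iff_sequentially comp_def by blast
qed

text \<open>Differentiation under the integral sign for a convolution.\<close>

lemma convolution_has_dir_deriv:
  fixes f \<kappa> :: "'a::euclidean_space \<Rightarrow> real"
  assumes f: "integrable lborel f"
    and [measurable]: "\<kappa> \<in> borel_measurable borel" "\<kappa>' \<in> borel_measurable borel"
    and bd: "\<And>x. \<bar>\<kappa> x\<bar> \<le> C" "\<And>x. \<bar>\<kappa>' x\<bar> \<le> B"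
    and d: "\<And>x. has_dir_deriv \<kappa> i (\<kappa>' x) x"
  shows "has_dir_deriv (\<lambda>x. \<integral>y. f y * \<kappa> (x - y) \<partial>lborel) i (\<integral>y. f y * \<kappa>' (x - y) \<partial>lborel) x"
proof -
  have [measurable]: "f \<in> borel_measurable borel" using f by simp
  have int: "integrable lborel (\<lambda>y. f y * \<kappa> (z - y))" for z
    by (rule Bochner_Integration.integrable_bound[where f="\<lambda>y. C * f y"])
       (use f in \<open>auto simp: abs_mult mult.commute[of C] intro!: mult_left_mono order.trans[OF bd(1) abs_ge_self]\<close>)
  have "(\<lambda>n. ((\<integral>y. f y * \<kappa> (x + X n *\<^sub>R i - y) \<partial>lborel) - (\<integral>y. f y * \<kappa> (x - y) \<partial>lborel)) / X n)
          \<longlonglongrightarrow> (\<integral>y. f y * \<kappa>' (x - y) \<partial>lborel)"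
    if X: "\<And>n. X n \<noteq> 0" "X \<longlonglongrightarrow> 0" for X
  proof -
    let ?q = "\<lambda>n y. (\<kappa> (x - y + X n *\<^sub>R i) - \<kappa> (x - y)) / X n"
    have "(\<lambda>n. \<integral>y. f y * ?q n y \<partial>lborel) \<longlonglongrightarrow> (\<integral>y. f y * \<kappa>' (x - y) \<partial>lborel)"
    proof (rule integral_dominated_convergence[where w="\<lambda>y. B * \<bar>f y\<bar>"])
      show "AE y in lborel. (\<lambda>n. f y * ?q n y) \<longlonglongrightarrow> f y * \<kappa>' (x - y)"
        using has_dir_deriv_quotient_sequence[OF d X] by (intro AE_I2 tendsto_mult tendsto_const)
      have "\<bar>?q n y\<bar> \<le> B" for n y
        using dir_deriv_bound_imp_lipschitz[of \<kappa> i \<kappa>' B "x - y" "X n", OF d bd(2)] X(1)[of n]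
        by (simp add: divide_le_eq)
      then have "\<bar>f y\<bar> * \<bar>?q n y\<bar> \<le> \<bar>f y\<bar> * B" for n y by (intro mult_left_mono) auto
      then show "AE y in lborel. norm (f y * ?q n y) \<le> B * \<bar>f y\<bar>" for n
        unfolding real_norm_def abs_mult by (simp add: mult.commute)
    qed (use f in auto)
    moreover have "(\<integral>y. f y * ?q n y \<partial>lborel)
        = ((\<integral>y. f y * \<kappa> (x + X n *\<^sub>R i - y) \<partial>lborel) - (\<integral>y. f y * \<kappa> (x - y) \<partial>lborel)) / X n" for n
    proof -
      have "(\<integral>y. f y * ?q n y \<partial>lborel)
          = (\<integral>y. (f y * \<kappa> (x + X n *\<^sub>R i - y) - f y * \<kappa> (x - y)) / X n \<partial>lborel)"
        by (rule Bochner_Integration.integral_cong) (auto simp: field_simps)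
      also have "\<dots> = (\<integral>y. (f y * \<kappa> (x + X n *\<^sub>R i - y) - f y * \<kappa> (x - y)) \<partial>lborel) / X n"
        by simp
      finally show ?thesis using int by (simp del: integral_divide_zero)
    qed
    ultimately show ?thesis by (simp only:)
  qed
  then show ?thesis
    unfolding has_dir_deriv_def DERIV_def tendsto_at_iff_sequentially comp_def by auto
qed

lemma integrable_indicator_cball:
  "integrable lborel (indicator (cball a R) :: 'a::euclidean_space \<Rightarrow> real)"
  using emeasure_lborel_cball_finite[of a R]
  by (intro integrable_real_indicator) (auto simp: infinity_ennreal_def)

lemma integrable_bounded_support:
  fixes f :: "'a::euclidean_space \<Rightarrow> real"
  assumes "f \<in> borel_measurable borel" "\<And>x. \<bar>f x\<bar> \<le> B" "\<And>x. x \<notin> cball a R \<Longrightarrow> f x = 0"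
  shows "integrable lborel f"
proof (rule Bochner_Integration.integrable_bound[where f="\<lambda>x. B * indicator (cball a R) x"])
  show "integrable lborel (\<lambda>x. B * indicator (cball a R) x)"
    using integrable_indicator_cball by (rule integrable_mult_right)
  show "AE x in lborel. norm (f x) \<le> norm (B * indicator (cball a R) x)"
  proof (rule AE_I2)
    fix x show "norm (f x) \<le> norm (B * indicator (cball a R) x)"
      using assms(2,3)[of x] abs_ge_self[of B] by (cases "x \<in> cball a R") (auto simp del: mem_cball)
  qed
qed (use assms in simp)

lemma integrable_lborel_shift:
  fixes f :: "'a::euclidean_space \<Rightarrow> 'b::{banach, second_countable_topology}"
  assumes "integrable lborel f"
  shows "integrable lborel (\<lambda>x. f (x + a))"
proof -
  have "integrable (distr lborel borel ((+) a)) f" using assms by (simp add: lborel_distr_plus)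
  from integrable_distr[OF _ this] show ?thesis by (simp add: add.commute)
qed

lemma integral_lborel_shift:
  fixes f :: "'a::euclidean_space \<Rightarrow> 'b::{banach, second_countable_topology}"
  assumes [measurable]: "f \<in> borel_measurable borel"
  shows "(\<integral>x. f (x + a) \<partial>lborel) = (\<integral>x. f x \<partial>lborel)"
proof -
  have "integral\<^sup>L (distr lborel borel ((+) a)) f = (\<integral>x. f (a + x) \<partial>lborel)"
    by (rule integral_distr) auto
  then show ?thesis by (simp add: lborel_distr_plus add.commute)
qed

lemma nn_integral_lborel_shift:
  fixes f :: "'a::euclidean_space \<Rightarrow> ennreal"
  assumes [measurable]: "f \<in> borel_measurable borel"
  shows "(\<integral>\<^sup>+x. f (x + a) \<partial>lborel) = (\<integral>\<^sup>+x. f x \<partial>lborel)"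
proof -
  have "integral\<^sup>N (distr lborel borel ((+) a)) f = (\<integral>\<^sup>+x. f (a + x) \<partial>lborel)"
    by (rule nn_integral_distr) auto
  then show ?thesis by (simp add: lborel_distr_plus add.commute)
qed

text \<open>The divergence theorem for functions of bounded support: \<open>\<integral> F (x + t i) - F x = 0\<close> for all
  \<open>t\<close>, by translation invariance, and the difference quotients converge dominatedly.\<close>

lemma integral_dir_deriv_eq_0:
  fixes F :: "'a::euclidean_space \<Rightarrow> real"
  assumes [measurable]: "F \<in> borel_measurable borel" "F' \<in> borel_measurable borel"
    and d: "\<And>x. has_dir_deriv F i (F' x) x"
    and bd: "\<And>x. \<bar>F x\<bar> \<le> C" "\<And>x. \<bar>F' x\<bar> \<le> B"
    and supp: "\<And>x. x \<notin> cball a R \<Longrightarrow> F x = 0" and i: "norm i \<le> 1"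
  shows "(\<integral>x. F' x \<partial>lborel) = 0"
proof -
  define X where "X n = 1 / real (Suc n)" for n
  have X: "\<And>n. X n \<noteq> 0" "X \<longlonglongrightarrow> 0" "\<And>n. 0 < X n" "\<And>n. X n \<le> 1"
    using LIMSEQ_inverse_real_of_nat unfolding X_def inverse_eq_divide by auto
  have F: "integrable lborel F" by (rule integrable_bounded_support[OF _ bd(1) supp]) simp
  let ?q = "\<lambda>n x. (F (x + X n *\<^sub>R i) - F x) / X n"
  have "(\<lambda>n. \<integral>x. ?q n x \<partial>lborel) \<longlonglongrightarrow> (\<integral>x. F' x \<partial>lborel)"
  proof (rule integral_dominated_convergence[where w="\<lambda>x. B * indicator (cball a (R + 1)) x"])
    show "AE x in lborel. (\<lambda>n. ?q n x) \<longlonglongrightarrow> F' x"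
      using has_dir_deriv_quotient_sequence[OF d X(1,2)] by simp
    show "integrable lborel (\<lambda>x. B * indicator (cball a (R + 1)) x)"
      using integrable_indicator_cball by (rule integrable_mult_right)
    have "\<bar>?q n x\<bar> \<le> B * indicator (cball a (R + 1)) x" for n x
    proof (cases "x \<in> cball a (R + 1)")
      case True
      then show ?thesis
        using dir_deriv_bound_imp_lipschitz[of F i F' B x "X n", OF d bd(2)] X(1,3)[of n]
        by (simp add: divide_le_eq)
    next
      case False
      have "dist a x \<le> dist a (x + X n *\<^sub>R i) + norm (X n *\<^sub>R i)"
        using dist_triangle[of a x "x + X n *\<^sub>R i"] by (simp add: dist_norm)
      moreover have "norm (X n *\<^sub>R i) \<le> 1" using X(3,4)[of n] i by (simp add: mult_le_one)
      ultimately have "x \<notin> cball a R" "x + X n *\<^sub>R i \<notin> cball a R" using False by auto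
      then show ?thesis using supp False by simp
    qed
    then show "AE x in lborel. norm (?q n x) \<le> B * indicator (cball a (R + 1)) x" for n by simp
  qed auto
  moreover have "(\<integral>x. ?q n x \<partial>lborel) = 0" for n
    using F integrable_lborel_shift[OF F] by (simp add: integral_lborel_shift)
  ultimately have "(\<lambda>n::nat. 0) \<longlonglongrightarrow> (\<integral>x. F' x \<partial>lborel)" by (simp only:)
  from LIMSEQ_unique[OF this tendsto_const] show ?thesis .
qed

section \<open>Continuity of translations in \<open>L\<^sup>1\<close>\<close>

text \<open>For open \<open>T\<close>, the indicator of \<open>T\<close> is lower semicontinuous, so the part of \<open>T\<close> that a small
  translation loses tends to zero by dominated convergence.\<close>

lemma tendsto_translation_indicator_open:
  fixes T :: "'a::euclidean_space set"
  assumes T: "open T" "emeasure lborel T < \<infinity>"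
  shows "((\<lambda>h. \<integral>x. \<bar>indicator T (x + h) - indicator T x\<bar> \<partial>lborel) \<longlongrightarrow> (0::real)) (at 0)"
proof -
  have [measurable]: "T \<in> sets borel" using T by simp
  have iT: "integrable lborel (indicator T :: 'a \<Rightarrow> real)" using T by simp
  have *: "(\<lambda>n. \<integral>x. indicator T x * (1 - indicator T (x + X n)) \<partial>lborel) \<longlonglongrightarrow> (0::real)"
    if X: "X \<longlonglongrightarrow> (0::'a)" for X
  proof -
    have "(\<lambda>n. \<integral>x. indicator T x * (1 - indicator T (x + X n)) \<partial>lborel) \<longlonglongrightarrow> (\<integral>x. (0::real) \<partial>(lborel::'a measure))"
    proof (rule integral_dominated_convergence[where w="indicator T"])
      have "(\<lambda>n. indicator T x * (1 - indicator T (x + X n)) :: real) \<longlonglongrightarrow> 0" for x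
      proof (cases "x \<in> T")
        case True
        have "(\<lambda>n. x + X n) \<longlonglongrightarrow> x + 0" by (intro tendsto_intros X)
        then have "\<forall>\<^sub>F n in sequentially. x + X n \<in> T"
          using T(1) True by (intro topological_tendstoD) auto
        then show ?thesis by (intro tendsto_eventually) (elim eventually_mono, simp)
      qed simp
      then show "AE x in lborel. (\<lambda>n. indicator T x * (1 - indicator T (x + X n)) :: real) \<longlonglongrightarrow> 0"
        by simp
    qed (use iT in \<open>auto simp: indicator_def\<close>)
    then show ?thesis by simp
  qed
  \<comment> \<open>\<open>T\<close> and its translate have the same measure, so their symmetric difference has twice the
      measure of \<open>T\<close> minus the translate.\<close>
  have eq: "(\<integral>x. \<bar>indicator T (x + h) - indicator T x\<bar> \<partial>lborel)
      = 2 * (\<integral>x. indicator T x * (1 - indicator T (x + h)) \<partial>lborel :: real)" for h :: 'a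
  proof -
    have "\<bar>indicator T (x + h) - indicator T x\<bar>
        = 2 * (indicator T x * (1 - indicator T (x + h))) + (indicator T (x + h) - indicator T x :: real)" for x
      by (auto simp: indicator_def)
    moreover have "integrable lborel (\<lambda>x. indicator T x * (1 - indicator T (x + h)) :: real)"
      by (rule Bochner_Integration.integrable_bound[OF iT]) (auto simp: indicator_def)
    moreover note integrable_lborel_shift[OF iT, of h]
    ultimately show ?thesis
      using iT integral_lborel_shift[of "indicator T :: 'a \<Rightarrow> real" h] by simp
  qed
  show ?thesis
    unfolding tendsto_at_iff_sequentially comp_def eq using * by (auto intro!: tendsto_mult_right_zero)
qed

lemma tendsto_translation_indicator:
  fixes A :: "'a::euclidean_space set"
  assumes A: "A \<in> sets lborel" "emeasure lborel A < \<infinity>"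
  shows "((\<lambda>h. \<integral>x. \<bar>indicator A (x + h) - indicator A x\<bar> \<partial>lborel) \<longlongrightarrow> (0::real)) (at 0)"
proof (rule tendstoI)
  fix e :: real assume "e > 0"
  have A': "A \<in> sets lebesgue" using A by auto
  \<comment> \<open>Replace \<open>A\<close> by an open superset \<open>T\<close> of nearly the same measure.\<close>
  obtain T where T: "open T" "A \<subseteq> T" "emeasure lebesgue (T - A) < ennreal (e/4)"
    using sets_lebesgue_outer_open[OF A', of "e/4"] \<open>e > 0\<close> by (metis zero_less_divide_iff zero_less_numeral)
  have [measurable]: "T \<in> sets borel" "A \<in> sets borel" using T A by auto
  have TA: "emeasure lborel (T - A) < ennreal (e/4)" using T(3) by (simp add: emeasure_completion)
  then have TAfin: "emeasure lborel (T - A) < \<infinity>" using less_trans by fastforce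
  have "emeasure lborel T = emeasure lborel A + emeasure lborel (T - A)"
    using T(2) by (subst plus_emeasure) (auto simp: Un_absorb1)
  then have Tfin: "emeasure lborel T < \<infinity>" using A(2) TAfin by (simp add: less_top)
  have mTA: "measure lborel (T - A) < e/4"
    using TA \<open>e > 0\<close> by (metis emeasure_eq_ennreal_measure TAfin ennreal_less_iff infinity_ennreal_def
        less_irrefl measure_nonneg)
  have i: "integrable lborel (indicator T :: 'a \<Rightarrow> real)" "integrable lborel (indicator A :: 'a \<Rightarrow> real)"
    "integrable lborel (indicator (T - A) :: 'a \<Rightarrow> real)"
    using Tfin A TAfin by auto
  note i' = i[THEN integrable_lborel_shift]
  have le: "(\<integral>x. \<bar>indicator A (x + h) - indicator A x\<bar> \<partial>lborel)
      \<le> (\<integral>x. \<bar>indicator T (x + h) - indicator T x\<bar> \<partial>lborel) + e / 2" for h :: 'a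
  proof -
    have "(\<integral>x. \<bar>indicator A (x + h) - indicator A x :: real\<bar> \<partial>lborel) \<le>
      (\<integral>x. \<bar>indicator T (x + h) - indicator T x\<bar> + (indicator (T - A) (x + h) + indicator (T - A) x) \<partial>lborel)"
    proof (rule integral_mono)
      show "\<bar>indicator A (x + h) - indicator A x :: real\<bar> \<le>
        \<bar>indicator T (x + h) - indicator T x\<bar> + (indicator (T - A) (x + h) + indicator (T - A) x)" for x
        using T(2) by (auto simp: indicator_def)
    qed (intro Bochner_Integration.integrable_add integrable_abs Bochner_Integration.integrable_diff i i')+
    also have "\<dots> = (\<integral>x. \<bar>indicator T (x + h) - indicator T x :: real\<bar> \<partial>lborel)
        + (measure lborel (T - A) + measure lborel (T - A))"
      using i i'[of h] integral_lborel_shift[of "indicator (T - A) :: 'a \<Rightarrow> real" h] by simp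
    finally show ?thesis using mTA by linarith
  qed
  have "\<forall>\<^sub>F h in at 0. dist (\<integral>x. \<bar>indicator T (x + h) - indicator T x :: real\<bar> \<partial>lborel) 0 < e / 2"
    using tendsto_translation_indicator_open[OF T(1) Tfin] \<open>e > 0\<close> by (intro tendstoD) auto
  then show "\<forall>\<^sub>F h in at 0. dist (\<integral>x. \<bar>indicator A (x + h) - indicator A x :: real\<bar> \<partial>lborel) 0 < e"
  proof eventually_elim
    case (elim h)
    have "0 \<le> (\<integral>x. \<bar>indicator A (x + h) - indicator A x :: real\<bar> \<partial>lborel)" by simp
    then show ?case using elim le[of h] by (simp add: dist_real_def)
  qed
qed

lemma tendsto_translation_L1:
  fixes G :: "'a::euclidean_space \<Rightarrow> 'b::{banach, second_countable_topology}"
  assumes "integrable lborel G"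
  shows "((\<lambda>h. \<integral>x. norm (G (x + h) - G x) \<partial>lborel) \<longlongrightarrow> 0) (at 0)"
  using assms
proof (induction rule: integrable_induct)
  case (base A c)
  have eq: "(\<integral>x. norm (indicator A (x + h) *\<^sub>R c - indicator A x *\<^sub>R c) \<partial>lborel)
      = (\<integral>x. \<bar>indicator A (x + h) - indicator A x\<bar> \<partial>lborel) * norm c" for h :: 'a
  proof -
    have "norm (indicator A (x + h) *\<^sub>R c - indicator A x *\<^sub>R c)
        = \<bar>indicator A (x + h) - indicator A x\<bar> * norm c" for x
      by (subst scaleR_diff_left[symmetric], rule norm_scaleR)
    then show ?thesis by simp
  qed
  show ?case
    unfolding eq by (rule tendsto_mult_left_zero[OF tendsto_translation_indicator[OF base]])
next
  case (add f g)
  note [simp] = add.hyps[THEN integrable_lborel_shift] add.hyps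
  have le: "(\<integral>x. norm (f (x + h) + g (x + h) - (f x + g x)) \<partial>lborel)
     \<le> (\<integral>x. norm (f (x + h) - f x) \<partial>lborel) + (\<integral>x. norm (g (x + h) - g x) \<partial>lborel)" for h
  proof -
    have "(\<integral>x. norm (f (x + h) + g (x + h) - (f x + g x)) \<partial>lborel)
       \<le> (\<integral>x. norm (f (x + h) - f x) + norm (g (x + h) - g x) \<partial>lborel)"
      by (rule integral_mono)
        (auto simp: norm_diff_triangle_ineq
          intro!: integrable_norm Bochner_Integration.integrable_diff Bochner_Integration.integrable_add)
    then show ?thesis by simp
  qed
  show ?case
  proof (rule Lim_null_comparison[OF _ tendsto_add_zero[OF add.IH]])
    have "0 \<le> (\<integral>x. norm (f (x + h) + g (x + h) - (f x + g x)) \<partial>lborel)" for h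
      by (rule Bochner_Integration.integral_nonneg) (rule norm_ge_zero)
    from order.trans[OF eq_refl[OF abs_of_nonneg[OF this]] le]
    show "\<forall>\<^sub>F h in at 0. norm (\<integral>x. norm (f (x + h) + g (x + h) - (f x + g x)) \<partial>lborel)
        \<le> (\<integral>x. norm (f (x + h) - f x) \<partial>lborel) + (\<integral>x. norm (g (x + h) - g x) \<partial>lborel)"
      unfolding real_norm_def by (intro always_eventually allI)
  qed
next
  case (lim f s)
  note [simp] = lim.hyps(1,4) lim.hyps(1,4)[THEN integrable_lborel_shift]
  have "(\<lambda>n. \<integral>x. norm (s n x - f x) \<partial>lborel) \<longlonglongrightarrow> (\<integral>x. 0 \<partial>(lborel :: 'a measure))"
  proof (rule integral_dominated_convergence[where w="\<lambda>x. 3 * norm (f x)"])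
    show "AE x in lborel. (\<lambda>n. norm (s n x - f x)) \<longlonglongrightarrow> 0"
      using lim.hyps(2) by (auto intro!: tendsto_norm_zero LIM_zero)
    have "norm (norm (s n x - f x)) \<le> 3 * norm (f x)" for n x
      using norm_triangle_ineq4[of "s n x" "f x"] lim.hyps(3)[of x n] by simp
    then show "AE x in lborel. norm (norm (s n x - f x)) \<le> 3 * norm (f x)" for n by simp
    show "(\<lambda>x. norm (s n x - f x)) \<in> borel_measurable lborel" for n
      by (rule borel_measurable_integrable) simp
    show "integrable lborel (\<lambda>x. 3 * norm (f x))"
      by (rule integrable_mult_right) simp
  qed simp
  then have L: "(\<lambda>n. \<integral>x. norm (s n x - f x) \<partial>lborel) \<longlonglongrightarrow> 0" by simp
  show ?case
  proof (rule tendstoI)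
    fix e :: real assume "e > 0"
    have "\<forall>\<^sub>F n in sequentially. dist (\<integral>x. norm (s n x - f x) \<partial>lborel) 0 < e / 4"
      using L \<open>e > 0\<close> by (intro tendstoD) auto
    then obtain n where n: "(\<integral>x. norm (s n x - f x) \<partial>lborel) < e / 4"
      by (auto simp: eventually_sequentially dist_real_def)
    have le: "(\<integral>x. norm (f (x + h) - f x) \<partial>lborel)
       \<le> (\<integral>x. norm (s n (x + h) - s n x) \<partial>lborel) + e / 2" for h
    proof -
      have "(\<integral>x. norm (f (x + h) - f x) \<partial>lborel) \<le>
         (\<integral>x. norm (s n (x + h) - s n x) + (norm (s n (x + h) - f (x + h)) + norm (s n x - f x)) \<partial>lborel)"
      proof (rule integral_mono)
        fix x
        have "norm (f (x + h) - f x) = norm ((s n (x + h) - s n x) - ((s n (x + h) - f (x + h)) - (s n x - f x)))"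
          by (rule arg_cong[where f=norm]) simp
        then show "norm (f (x + h) - f x) \<le>
          norm (s n (x + h) - s n x) + (norm (s n (x + h) - f (x + h)) + norm (s n x - f x))"
          using norm_triangle_ineq4[of "s n (x + h) - s n x" "(s n (x + h) - f (x + h)) - (s n x - f x)"]
            norm_triangle_ineq4[of "s n (x + h) - f (x + h)" "s n x - f x"] by linarith
      qed (intro Bochner_Integration.integrable_add integrable_norm Bochner_Integration.integrable_diff; simp)+
      also have "\<dots> = (\<integral>x. norm (s n (x + h) - s n x) \<partial>lborel)
         + ((\<integral>x. norm (s n (x + h) - f (x + h)) \<partial>lborel) + (\<integral>x. norm (s n x - f x) \<partial>lborel))"
        by simp
      also have "(\<integral>x. norm (s n (x + h) - f (x + h)) \<partial>lborel) = (\<integral>x. norm (s n x - f x) \<partial>lborel)"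
        using borel_measurable_integrable[OF lim.hyps(1)[of n]] borel_measurable_integrable[OF lim.hyps(4)]
        by (intro integral_lborel_shift[of "\<lambda>x. norm (s n x - f x)"]) auto
      finally show ?thesis using n by linarith
    qed
    have "\<forall>\<^sub>F h in at 0. dist (\<integral>x. norm (s n (x + h) - s n x) \<partial>lborel) 0 < e / 2"
      using lim.IH \<open>e > 0\<close> by (intro tendstoD) auto
    then show "\<forall>\<^sub>F h in at 0. dist (\<integral>x. norm (f (x + h) - f x) \<partial>lborel) 0 < e"
    proof eventually_elim
      case (elim h)
      have "0 \<le> (\<integral>x. norm (f (x + h) - f x) \<partial>lborel)" by simp
      then show ?case using elim le[of h] by (simp add: dist_real_def)
    qed
  qed
qed

section \<open>Weak gradient and weak Laplacian on the whole space\<close>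

text \<open>The extension of \<open>f\<close> from \<open>\<Omega>\<close> by zero.\<close>

definition zero_ext :: "'a set \<Rightarrow> ('a \<Rightarrow> real) \<Rightarrow> 'a \<Rightarrow> real" where
  "zero_ext \<Omega> f x = (if x \<in> \<Omega> then f x else 0)"

text \<open>\<open>G\<close> and \<open>L\<close> are integrable Borel functions on the whole space that represent, inside
  \<open>\<Omega>\<close>, the distributional gradient and the distributional Laplacian of \<open>u\<close>. Unlike the weak
  derivatives of the definition they do not refer to the completed measure.\<close>

definition weak_grad_lap ::
  "'a::euclidean_space set \<Rightarrow> ('a \<Rightarrow> real) \<Rightarrow> ('a \<Rightarrow> 'a) \<Rightarrow> ('a \<Rightarrow> real) \<Rightarrow> bool" where
  "weak_grad_lap \<Omega> u G L \<longleftrightarrow> integrable lborel G \<and> integrable lborel L \<and>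
     (\<forall>\<eta>. test_function \<Omega> \<eta> \<longrightarrow>
        (\<forall>i\<in>Basis. (\<integral>x. u x * pderiv_dir i \<eta> x \<partial>lborel) = - (\<integral>x. (G x \<bullet> i) * \<eta> x \<partial>lborel)) \<and>
        (\<integral>x. u x * (\<Sum>i\<in>Basis. pderiv_dir i (pderiv_dir i \<eta>) x) \<partial>lborel)
          = (\<integral>x. L x * \<eta> x \<partial>lborel))"

lemma continuous_zero_ext:
  assumes "open \<Omega>" "continuous_on (closure \<Omega>) f" "\<And>x. x \<in> frontier \<Omega> \<Longrightarrow> f x = 0"
  shows "continuous_on UNIV (zero_ext \<Omega> f)"
proof -
  have "continuous_on (closure \<Omega> \<union> - \<Omega>) (\<lambda>x. if x \<in> \<Omega> then f x else 0)"
    by (rule continuous_on_cases)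
       (use assms in \<open>auto simp: frontier_def interior_open\<close>)
  moreover have "closure \<Omega> \<union> - \<Omega> = UNIV" using closure_subset by auto
  ultimately show ?thesis by (simp add: zero_ext_def[abs_def])
qed

text \<open>A function on \<open>\<Omega>\<close> that is only Lebesgue measurable agrees almost everywhere with a Borel
  function on the whole space, with the same integrals against functions vanishing off \<open>\<Omega>\<close>.\<close>

lemma lebesgue_on_to_lborel:
  fixes g :: "'a::euclidean_space \<Rightarrow> real"
  assumes \<Omega>: "\<Omega> \<in> sets lebesgue" and g: "integrable (lebesgue_on \<Omega>) g"
  obtains g' where "integrable lborel g'" "AE x in lborel. x \<in> \<Omega> \<longrightarrow> g' x = g x"
    "\<And>\<eta>. \<eta> \<in> borel_measurable borel \<Longrightarrow> (\<And>x. x \<notin> \<Omega> \<Longrightarrow> \<eta> x = 0) \<Longrightarrow>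
       (\<integral>x. g x * \<eta> x \<partial>lebesgue_on \<Omega>) = (\<integral>x. g' x * \<eta> x \<partial>lborel)"
proof -
  let ?h = "\<lambda>x. indicator \<Omega> x *\<^sub>R g x"
  have \<Omega>': "\<Omega> \<inter> space lebesgue \<in> sets lebesgue" using \<Omega> by simp
  have h: "integrable lebesgue ?h"
    using g integrable_restrict_space[OF \<Omega>', of g] by simp
  then obtain g' where g': "g' \<in> borel_measurable lborel" "AE x in lborel. ?h x = g' x"
    using completion_ex_borel_measurable_real[OF borel_measurable_integrable[OF h]] by blast
  have ae: "AE x in lebesgue. ?h x = g' x"
    using g'(2) by (simp add: AE_completion_iff)
  have g'm: "g' \<in> borel_measurable lebesgue" using g'(1) measurable_completion by blast
  have "integrable lebesgue g'"
    using integrable_cong_AE[OF borel_measurable_integrable[OF h] g'm ae] h by blast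
  then have "integrable lborel g'" using integrable_completion[OF g'(1)] by blast
  moreover have "AE x in lborel. x \<in> \<Omega> \<longrightarrow> g' x = g x"
    using g'(2) by eventually_elim auto
  moreover have "(\<integral>x. g x * \<eta> x \<partial>lebesgue_on \<Omega>) = (\<integral>x. g' x * \<eta> x \<partial>lborel)"
    if \<eta>: "\<eta> \<in> borel_measurable borel" "\<And>x. x \<notin> \<Omega> \<Longrightarrow> \<eta> x = 0" for \<eta>
  proof -
    have \<eta>m: "\<eta> \<in> borel_measurable lborel" using \<eta>(1) by simp
    then have \<eta>m': "\<eta> \<in> borel_measurable lebesgue" using measurable_completion by blast
    have "(\<integral>x. g x * \<eta> x \<partial>lebesgue_on \<Omega>) = (\<integral>x. indicator \<Omega> x *\<^sub>R (g x * \<eta> x) \<partial>lebesgue)"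
      by (rule integral_restrict_space[OF \<Omega>'])
    also have "\<dots> = (\<integral>x. ?h x * \<eta> x \<partial>lebesgue)" by (simp add: mult.assoc)
    also have "\<dots> = (\<integral>x. g' x * \<eta> x \<partial>lebesgue)"
    proof (rule integral_cong_AE)
      show "(\<lambda>x. ?h x * \<eta> x) \<in> borel_measurable lebesgue"
        by (rule borel_measurable_times[OF borel_measurable_integrable[OF h] \<eta>m'])
      show "(\<lambda>x. g' x * \<eta> x) \<in> borel_measurable lebesgue"
        by (rule borel_measurable_times[OF g'm \<eta>m'])
      show "AE x in lebesgue. ?h x * \<eta> x = g' x * \<eta> x"
        using ae by eventually_elim simp
    qed
    also have "\<dots> = (\<integral>x. g' x * \<eta> x \<partial>lborel)"
      by (rule integral_completion) (rule borel_measurable_times[OF g'(1) \<eta>m])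
    finally show ?thesis .
  qed
  ultimately show thesis using that by blast
qed

lemma Lp_1_integrable:
  assumes "f \<in> Lp \<Omega> 1" shows "integrable (lebesgue_on \<Omega>) f"
  by (rule integrable_abs_cancel) (use assms in \<open>simp_all add: Lp_def\<close>)

lemma weak_derivI:
  assumes "\<exists>g. has_weak_deriv \<Omega> i f g"
  shows "has_weak_deriv \<Omega> i f (weak_deriv \<Omega> i f)"
  unfolding weak_deriv_def using someI_ex[OF assms] .

lemma lebesgue_on_zero_ext:
  fixes f :: "'a::euclidean_space \<Rightarrow> real"
  assumes "open \<Omega>" "continuous_on UNIV (zero_ext \<Omega> f)" "\<eta> \<in> borel_measurable borel"
  shows "(\<integral>x. f x * \<eta> x \<partial>lebesgue_on \<Omega>) = (\<integral>x. zero_ext \<Omega> f x * \<eta> x \<partial>lborel)"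
proof -
  have \<Omega>: "\<Omega> \<inter> space lebesgue \<in> sets lebesgue"
    using assms(1) by (simp add: lmeasurable_open borel_open)
  have "(\<integral>x. f x * \<eta> x \<partial>lebesgue_on \<Omega>) = (\<integral>x. indicator \<Omega> x *\<^sub>R (f x * \<eta> x) \<partial>lebesgue)"
    by (rule integral_restrict_space[OF \<Omega>])
  also have "\<dots> = (\<integral>x. zero_ext \<Omega> f x * \<eta> x \<partial>lebesgue)"
    by (rule Bochner_Integration.integral_cong) (auto simp: zero_ext_def)
  also have "\<dots> = (\<integral>x. zero_ext \<Omega> f x * \<eta> x \<partial>lborel)"
    using borel_measurable_continuous_onI[OF assms(2)] assms(3)
    by (intro integral_completion) simp
  finally show ?thesis .
qed

lemma test_function_integrable_mult:
  fixes u :: "'a::euclidean_space \<Rightarrow> real"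
  assumes "test_function \<Omega> \<eta>" "continuous_on UNIV u"
  shows "integrable lborel (\<lambda>x. u x * \<eta> x)"
proof -
  let ?K = "closure {x. \<eta> x \<noteq> 0}"
  have K: "compact ?K" using test_function_support(1)[OF assms(1)] .
  have "continuous_on ?K (\<lambda>x. u x * \<eta> x)"
    using assms(2) continuous_on_subset[OF assms(2)] smooth_continuous[OF test_function_smooth[OF assms(1)]]
    by (intro continuous_on_mult) auto
  from borel_integrable_compact[OF K this]
  show ?thesis
  proof (rule Bochner_Integration.integrable_cong[THEN iffD1, rotated 2])
    show "indicator ?K x *\<^sub>R (u x * \<eta> x) = u x * \<eta> x" for x
      using closure_subset[of "{x. \<eta> x \<noteq> 0}"] by (auto simp: indicator_def)
  qed simp
qed

lemma integrable_mult_test_function: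
  fixes f :: "'a::euclidean_space \<Rightarrow> real"
  assumes "test_function \<Omega> \<eta>" "integrable lborel f"
  shows "integrable lborel (\<lambda>x. f x * \<eta> x)"
proof -
  obtain B where B: "\<And>x. \<bar>\<eta> x\<bar> \<le> B" using test_function_bounded[OF assms(1)] by blast
  show ?thesis
  proof (rule Bochner_Integration.integrable_bound[where f="\<lambda>x. B * f x"])
    show "integrable lborel (\<lambda>x. B * f x)" using assms(2) by simp
    show "(\<lambda>x. f x * \<eta> x) \<in> borel_measurable lborel"
      using assms(2) test_function_borel[OF assms(1)] by (intro borel_measurable_times) auto
    have "\<bar>f x\<bar> * \<bar>\<eta> x\<bar> \<le> \<bar>f x\<bar> * \<bar>B\<bar>" for x
      by (intro mult_left_mono order.trans[OF B]) auto
    then show "AE x in lborel. norm (f x * \<eta> x) \<le> norm (B * f x)"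
      by (simp add: abs_mult mult.commute)
  qed
qed

text \<open>The eigenvalue equation in terms of Borel representatives.\<close>

lemma principal_eigenfunction_weak_grad_lap:
  fixes \<Omega> :: "'a::euclidean_space set"
  assumes "open \<Omega>" and pe: "principal_eigenfunction \<Omega> w l \<phi>"
  obtains G L where "weak_grad_lap \<Omega> (zero_ext \<Omega> \<phi>) G L"
    "AE x in lborel. x \<in> \<Omega> \<longrightarrow> L x = w x \<bullet> G x - l * \<phi> x"
proof -
  let ?g = "\<lambda>i. weak_deriv \<Omega> i \<phi>" and ?h = "\<lambda>i. weak_deriv \<Omega> i (weak_deriv \<Omega> i \<phi>)"
  have W: "\<phi> \<in> W2p \<Omega> 1" using pe unfolding principal_eigenfunction_def by blast
  have wd: "has_weak_deriv \<Omega> i \<phi> (?g i)" "has_weak_deriv \<Omega> i (?g i) (?h i)" if "i \<in> Basis" for i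
    using W that weak_derivI unfolding W2p_def by blast+
  have int: "integrable (lebesgue_on \<Omega>) (?g i)" "integrable (lebesgue_on \<Omega>) (?h i)" if "i \<in> Basis" for i
    using W that Lp_1_integrable unfolding W2p_def by blast+
  have \<Omega>m: "\<Omega> \<in> sets lebesgue" using \<open>open \<Omega>\<close> by (simp add: borel_open)
  have cont: "continuous_on UNIV (zero_ext \<Omega> \<phi>)"
    using continuous_zero_ext[OF \<open>open \<Omega>\<close>] pe unfolding principal_eigenfunction_def by blast
  define R where "R g g' \<longleftrightarrow> integrable lborel g' \<and> (AE x in lborel. x \<in> \<Omega> \<longrightarrow> g' x = g x) \<and>
      (\<forall>\<eta>. test_function \<Omega> \<eta> \<longrightarrow> (\<integral>x. g x * \<eta> x \<partial>lebesgue_on \<Omega>) = (\<integral>x. g' x * \<eta> x \<partial>lborel))"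
    for g g' :: "'a \<Rightarrow> real"
  have ex: "\<exists>g'. R g g'" if g: "integrable (lebesgue_on \<Omega>) g" for g
  proof -
    obtain g' where "integrable lborel g'" "AE x in lborel. x \<in> \<Omega> \<longrightarrow> g' x = g x"
      and eq: "\<And>\<eta>. \<eta> \<in> borel_measurable borel \<Longrightarrow> (\<And>x. x \<notin> \<Omega> \<Longrightarrow> \<eta> x = 0) \<Longrightarrow>
       (\<integral>x. g x * \<eta> x \<partial>lebesgue_on \<Omega>) = (\<integral>x. g' x * \<eta> x \<partial>lborel)"
      by (rule lebesgue_on_to_lborel[OF \<Omega>m g]) blast
    moreover have "(\<integral>x. g x * \<eta> x \<partial>lebesgue_on \<Omega>) = (\<integral>x. g' x * \<eta> x \<partial>lborel)"
      if "test_function \<Omega> \<eta>" for \<eta>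
      by (rule eq[OF test_function_borel[OF that] test_function_zero[OF that]])
    ultimately show ?thesis unfolding R_def by blast
  qed
  have "\<forall>i\<in>Basis. \<exists>g'. R (?g i) g'" "\<forall>i\<in>Basis. \<exists>h'. R (?h i) h'"
    using ex int by blast+
  then obtain g' h' where g': "\<And>i. i \<in> Basis \<Longrightarrow> R (?g i) (g' i)"
    and h': "\<And>i. i \<in> Basis \<Longrightarrow> R (?h i) (h' i)"
    by metis
  define G where "G x = (\<Sum>i\<in>Basis. g' i x *\<^sub>R i)" for x
  define L where "L x = (\<Sum>i\<in>Basis. h' i x)" for x
  have Gi: "G x \<bullet> i = g' i x" if "i \<in> Basis" for x i
    using that unfolding G_def by (rule inner_sum_left_Basis)
  have first: "(\<integral>x. zero_ext \<Omega> \<phi> x * pderiv_dir i \<eta> x \<partial>lborel) = - (\<integral>x. g' i x * \<eta> x \<partial>lborel)"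
    if "test_function \<Omega> \<eta>" "i \<in> Basis" for \<eta> i
    using wd(1)[OF that(2)] g'[OF that(2)] that
      lebesgue_on_zero_ext[OF \<open>open \<Omega>\<close> cont test_function_borel[OF test_function_pderiv[OF that]]]
    unfolding has_weak_deriv_def R_def by simp
  have second: "(\<integral>x. g' i x * pderiv_dir i \<eta> x \<partial>lborel) = - (\<integral>x. h' i x * \<eta> x \<partial>lborel)"
    if "test_function \<Omega> \<eta>" "i \<in> Basis" for \<eta> i
  proof -
    have "(\<integral>x. ?g i x * pderiv_dir i \<eta> x \<partial>lebesgue_on \<Omega>) = - (\<integral>x. ?h i x * \<eta> x \<partial>lebesgue_on \<Omega>)"
      using wd(2)[OF that(2)] that(1) unfolding has_weak_deriv_def by blast
    moreover have "(\<integral>x. ?g i x * pderiv_dir i \<eta> x \<partial>lebesgue_on \<Omega>) = (\<integral>x. g' i x * pderiv_dir i \<eta> x \<partial>lborel)"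
      using g'[OF that(2)] test_function_pderiv[OF that] unfolding R_def by blast
    moreover have "(\<integral>x. ?h i x * \<eta> x \<partial>lebesgue_on \<Omega>) = (\<integral>x. h' i x * \<eta> x \<partial>lborel)"
      using h'[OF that(2)] that(1) unfolding R_def by blast
    ultimately show ?thesis by linarith
  qed
  have "weak_grad_lap \<Omega> (zero_ext \<Omega> \<phi>) G L"
    unfolding weak_grad_lap_def
  proof (intro conjI allI impI ballI)
    show "integrable lborel G" unfolding G_def
      using g' by (intro Bochner_Integration.integrable_sum integrable_scaleR_left) (auto simp: R_def)
    show "integrable lborel L" unfolding L_def
      using h' by (intro Bochner_Integration.integrable_sum) (auto simp: R_def)
  next
    fix \<eta> :: "'a \<Rightarrow> real" and i :: 'a assume "test_function \<Omega> \<eta>" "i \<in> Basis"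
    then show "(\<integral>x. zero_ext \<Omega> \<phi> x * pderiv_dir i \<eta> x \<partial>lborel) = - (\<integral>x. (G x \<bullet> i) * \<eta> x \<partial>lborel)"
      by (simp add: first Gi)
  next
    fix \<eta> :: "'a \<Rightarrow> real" assume \<eta>: "test_function \<Omega> \<eta>"
    note d = test_function_pderiv[OF \<eta>]
    have "(\<integral>x. zero_ext \<Omega> \<phi> x * (\<Sum>i\<in>Basis. pderiv_dir i (pderiv_dir i \<eta>) x) \<partial>lborel)
        = (\<Sum>i\<in>Basis. \<integral>x. zero_ext \<Omega> \<phi> x * pderiv_dir i (pderiv_dir i \<eta>) x \<partial>lborel)"
      unfolding sum_distrib_left
      by (rule Bochner_Integration.integral_sum)
         (rule test_function_integrable_mult[OF test_function_pderiv[OF d] cont])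
    also have "\<dots> = (\<Sum>i\<in>Basis. \<integral>x. h' i x * \<eta> x \<partial>lborel)"
      by (rule sum.cong) (simp_all add: first[OF d] second[OF \<eta>])
    also have "\<dots> = (\<integral>x. L x * \<eta> x \<partial>lborel)"
      unfolding L_def sum_distrib_right
      by (rule Bochner_Integration.integral_sum[symmetric])
         (use h' integrable_mult_test_function[OF \<eta>] in \<open>auto simp: R_def\<close>)
    finally show "(\<integral>x. zero_ext \<Omega> \<phi> x * (\<Sum>i\<in>Basis. pderiv_dir i (pderiv_dir i \<eta>) x) \<partial>lborel)
        = (\<integral>x. L x * \<eta> x \<partial>lborel)" .
  qed
  moreover have "AE x in lborel. x \<in> \<Omega> \<longrightarrow> L x = w x \<bullet> G x - l * \<phi> x"
  proof -
    have "AE x in lebesgue_on \<Omega>. - weak_laplacian \<Omega> \<phi> x + w x \<bullet> weak_grad \<Omega> \<phi> x = l * \<phi> x"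
      using pe unfolding principal_eigenfunction_def by blast
    then have eq: "AE x in lborel. x \<in> \<Omega> \<longrightarrow>
        - weak_laplacian \<Omega> \<phi> x + w x \<bullet> weak_grad \<Omega> \<phi> x = l * \<phi> x"
      using \<Omega>m by (subst (asm) AE_restrict_space_iff) (auto simp: AE_completion_iff)
    have 1: "AE x in lborel. \<forall>i\<in>Basis. x \<in> \<Omega> \<longrightarrow> g' i x = ?g i x"
      using g' by (intro AE_finite_allI) (auto simp: R_def)
    have 2: "AE x in lborel. \<forall>i\<in>Basis. x \<in> \<Omega> \<longrightarrow> h' i x = ?h i x"
      using h' by (intro AE_finite_allI) (auto simp: R_def)
    show ?thesis
      using eq 1 2
    proof eventually_elim
      case (elim x)
      show ?case
      proof
        assume "x \<in> \<Omega>"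
        then have "G x = weak_grad \<Omega> \<phi> x" "L x = weak_laplacian \<Omega> \<phi> x"
          using elim by (auto simp: G_def L_def weak_grad_def weak_laplacian_def)
        then show "L x = w x \<bullet> G x - l * \<phi> x" using elim(1) \<open>x \<in> \<Omega>\<close> by simp
      qed
    qed
  qed
  ultimately show thesis using that by blast
qed

section \<open>Mollification\<close>

text \<open>The smooth probability density, supported in the ball of radius \<open>\<epsilon>\<close>, with which functions
  are convolved.\<close>

definition mollifier :: "real \<Rightarrow> 'a::euclidean_space \<Rightarrow> real" where
  "mollifier \<epsilon> x = flat (\<epsilon>\<^sup>2 - (norm x)\<^sup>2) / (\<integral>y. flat (\<epsilon>\<^sup>2 - (norm (y::'a))\<^sup>2) \<partial>lborel)"

lemma mollifier_normalization:
  fixes \<epsilon> :: real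
  assumes "\<epsilon> > 0"
  shows "integrable lborel (\<lambda>y::'a::euclidean_space. flat (\<epsilon>\<^sup>2 - (norm y)\<^sup>2))"
    and "(\<integral>y. flat (\<epsilon>\<^sup>2 - (norm (y::'a))\<^sup>2) \<partial>lborel) > 0"
proof -
  have m: "(\<lambda>y::'a. flat (\<epsilon>\<^sup>2 - (norm y)\<^sup>2)) \<in> borel_measurable borel"
    by (intro borel_measurable_continuous_onI continuous_on_compose2[OF continuous_flat[of UNIV]] continuous_intros) auto
  show int: "integrable lborel (\<lambda>y::'a. flat (\<epsilon>\<^sup>2 - (norm y)\<^sup>2))"
  proof (rule integrable_bounded_support[OF m, of 1 0 \<epsilon>])
    fix x :: 'a
    show "\<bar>flat (\<epsilon>\<^sup>2 - (norm x)\<^sup>2)\<bar> \<le> 1" using flat_bounds(1,2) by (simp add: abs_of_nonneg)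
    assume "x \<notin> cball 0 \<epsilon>"
    then have "\<epsilon>\<^sup>2 \<le> (norm x)\<^sup>2" using assms by (intro power_mono) auto
    then show "flat (\<epsilon>\<^sup>2 - (norm x)\<^sup>2) = 0" by (intro flat_bounds(4)) simp
  qed
  have pos: "flat (\<epsilon>\<^sup>2 - (\<epsilon> / 2)\<^sup>2) > 0"
    using assms by (intro flat_bounds(3)) (simp add: power_divide)
  have "0 < flat (\<epsilon>\<^sup>2 - (\<epsilon> / 2)\<^sup>2) * measure lborel (cball (0::'a) (\<epsilon> / 2))"
    using assms pos by (intro mult_pos_pos content_cball_pos) auto
  also have "\<dots> = (\<integral>y. flat (\<epsilon>\<^sup>2 - (\<epsilon> / 2)\<^sup>2) * indicator (cball (0::'a) (\<epsilon> / 2)) y \<partial>lborel)"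
    by simp
  also have "\<dots> \<le> (\<integral>y. flat (\<epsilon>\<^sup>2 - (norm (y::'a))\<^sup>2) \<partial>lborel)"
  proof (rule integral_mono)
    show "integrable lborel (\<lambda>y::'a. flat (\<epsilon>\<^sup>2 - (\<epsilon> / 2)\<^sup>2) * indicator (cball 0 (\<epsilon> / 2)) y)"
      using integrable_indicator_cball by (rule integrable_mult_right)
    fix y :: 'a
    show "flat (\<epsilon>\<^sup>2 - (\<epsilon> / 2)\<^sup>2) * indicator (cball 0 (\<epsilon> / 2)) y \<le> flat (\<epsilon>\<^sup>2 - (norm y)\<^sup>2)"
    proof (cases "y \<in> cball 0 (\<epsilon> / 2)")
      case True
      then have "(norm y)\<^sup>2 \<le> (\<epsilon> / 2)\<^sup>2" by (intro power_mono) auto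
      then show ?thesis using True by (simp add: flat_mono)
    qed (simp add: flat_bounds(1))
  qed (rule int)
  finally show "(\<integral>y. flat (\<epsilon>\<^sup>2 - (norm (y::'a))\<^sup>2) \<partial>lborel) > 0" .
qed

lemma test_function_mollifier:
  assumes "\<epsilon> > 0" shows "test_function UNIV (mollifier \<epsilon> :: 'a::euclidean_space \<Rightarrow> real)"
proof (rule test_functionI[of _ "cball 0 \<epsilon>"])
  have "smooth (\<lambda>x::'a. flat (\<epsilon>\<^sup>2 - (norm (x - 0))\<^sup>2))"
    by (intro smooth_flat smooth_diff smooth_const smooth_norm2)
  from smooth_mult[OF smooth_const this, of "1 / (\<integral>y. flat (\<epsilon>\<^sup>2 - (norm (y::'a))\<^sup>2) \<partial>lborel)"]
  show "smooth (mollifier \<epsilon> :: 'a \<Rightarrow> real)" by (simp add: mollifier_def[abs_def])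
  fix x :: 'a assume "x \<notin> cball 0 \<epsilon>"
  then have "\<epsilon>\<^sup>2 \<le> (norm x)\<^sup>2" using assms by (intro power_mono) auto
  then show "mollifier \<epsilon> x = 0" by (simp add: mollifier_def flat_bounds(4))
qed auto

lemma mollifier_zero:
  assumes "\<epsilon> > 0" "norm (x::'a::euclidean_space) > \<epsilon>"
  shows "mollifier \<epsilon> x = 0"
proof -
  have "\<epsilon>\<^sup>2 \<le> (norm x)\<^sup>2" using assms by (intro power_mono) auto
  then show ?thesis by (simp add: mollifier_def flat_bounds(4))
qed

lemma mollifier_nonneg: "\<epsilon> > 0 \<Longrightarrow> mollifier \<epsilon> (x::'a::euclidean_space) \<ge> 0"
  unfolding mollifier_def using mollifier_normalization(2)[where 'a='a, of \<epsilon>] flat_bounds(1) by simp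

lemma mollifier_minus: "mollifier \<epsilon> (- x) = mollifier \<epsilon> (x::'a::euclidean_space)"
  by (simp add: mollifier_def)

lemma integrable_mollifier: "\<epsilon> > 0 \<Longrightarrow> integrable lborel (mollifier \<epsilon> :: 'a::euclidean_space \<Rightarrow> real)"
  unfolding mollifier_def[abs_def] using mollifier_normalization(1) by (rule integrable_divide)

lemma integral_mollifier: "\<epsilon> > 0 \<Longrightarrow> (\<integral>x. mollifier \<epsilon> (x::'a::euclidean_space) \<partial>lborel) = 1"
  unfolding mollifier_def using mollifier_normalization(2)[where 'a='a, of \<epsilon>] by simp

lemma mollifier_shift:
  fixes x :: "'a::euclidean_space"
  assumes "\<epsilon> > 0"
  shows "integrable lborel (\<lambda>y. mollifier \<epsilon> (x - y))" "(\<integral>y. mollifier \<epsilon> (x - y) \<partial>lborel) = 1"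
proof -
  have eq: "mollifier \<epsilon> (x - y) = mollifier \<epsilon> (y + (- x))" for y
    using mollifier_minus[of \<epsilon> "x - y"] by (simp add: algebra_simps)
  show "integrable lborel (\<lambda>y. mollifier \<epsilon> (x - y))"
    unfolding eq by (rule integrable_lborel_shift[OF integrable_mollifier[OF assms]])
  show "(\<integral>y. mollifier \<epsilon> (x - y) \<partial>lborel) = 1"
    unfolding eq
    using integral_lborel_shift[OF test_function_borel[OF test_function_mollifier[OF assms]], of "- x"]
      integral_mollifier[OF assms, where 'a='a] by simp
qed

lemma has_derivative_reflect:
  assumes "\<kappa> differentiable (at (x - y))"
  shows "((\<lambda>y. \<kappa> (x - y)) has_derivative (\<lambda>h. - frechet_derivative \<kappa> (at (x - y)) h)) (at y)"
proof -
  have k: "(\<kappa> has_derivative frechet_derivative \<kappa> (at (x - y))) (at (x - y))"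
    using assms frechet_derivative_works by blast
  have "((\<lambda>y. x - y) has_derivative (\<lambda>h. - h)) (at y)"
    by (auto intro!: derivative_eq_intros)
  from has_derivative_compose[OF this k]
  show ?thesis using linear_neg[OF has_derivative_linear[OF k]] by simp
qed

lemma smooth_reflect:
  fixes \<kappa> :: "'a::euclidean_space \<Rightarrow> real"
  assumes "smooth \<kappa>" shows "smooth (\<lambda>y. \<kappa> (x - y))"
proof -
  have "Ck_on k UNIV (\<lambda>y. \<kappa> (x - y))" if "Ck_on k UNIV \<kappa>" for k
    using that
  proof (induction k arbitrary: \<kappa>)
    case 0 then show ?case by (auto intro!: continuous_on_compose2[of UNIV \<kappa>] continuous_intros)
  next
    case (Suc k)
    then have d: "((\<lambda>y. \<kappa> (x - y)) has_derivative (\<lambda>h. - frechet_derivative \<kappa> (at (x - y)) h)) (at y)" for y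
      by (intro has_derivative_reflect) simp
    have "Ck_on k UNIV (\<lambda>y. (-1) * pderiv_dir i \<kappa> (x - y))" if "i \<in> Basis" for i
      using Suc.prems that by (intro Ck_on_mult Ck_on_const Suc.IH) simp
    moreover have "pderiv_dir i (\<lambda>y. \<kappa> (x - y)) = (\<lambda>y. (-1) * pderiv_dir i \<kappa> (x - y))" for i
      using pderiv_dir_eqI[OF d] by auto
    moreover have "(\<lambda>y. \<kappa> (x - y)) differentiable (at y)" for y
      using d unfolding differentiable_def by blast
    ultimately show ?case by simp
  qed
  then show ?thesis using assms unfolding smooth_def by blast
qed

text \<open>At a point whose closed \<open>\<epsilon>\<close>-ball lies in \<open>\<Omega>\<close>, convolution with the mollifier commutes with
  the weak derivatives.\<close>

lemma mollifier_weak_derivatives: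
  fixes \<Omega> :: "'a::euclidean_space set"
  assumes w: "weak_grad_lap \<Omega> u G L" and \<epsilon>: "\<epsilon> > 0" and x: "cball x \<epsilon> \<subseteq> \<Omega>"
  shows "i \<in> Basis \<Longrightarrow> (\<integral>y. u y * pderiv_dir i (mollifier \<epsilon>) (x - y) \<partial>lborel)
           = (\<integral>y. (G y \<bullet> i) * mollifier \<epsilon> (x - y) \<partial>lborel)"
    and "(\<integral>y. u y * (\<Sum>i\<in>Basis. pderiv_dir i (pderiv_dir i (mollifier \<epsilon>)) (x - y)) \<partial>lborel)
           = (\<integral>y. L y * mollifier \<epsilon> (x - y) \<partial>lborel)"
proof -
  let ?\<rho> = "mollifier \<epsilon> :: 'a \<Rightarrow> real" and ?\<eta> = "\<lambda>y. mollifier \<epsilon> (x - y)"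
  have s: "smooth ?\<rho>" using test_function_smooth[OF test_function_mollifier[OF \<epsilon>]] .
  have \<eta>: "test_function \<Omega> ?\<eta>"
  proof (rule test_functionI[OF smooth_reflect[OF s] compact_cball x])
    show "?\<eta> y = 0" if "y \<notin> cball x \<epsilon>" for y
      using that by (intro mollifier_zero[OF \<epsilon>]) (simp add: dist_norm)
  qed
  have d1: "pderiv_dir i ?\<eta> y = - pderiv_dir i ?\<rho> (x - y)" for i y
    using pderiv_dir_eqI[OF has_derivative_reflect[OF smooth_differentiable[OF s]]] .
  have d2: "pderiv_dir i (pderiv_dir i ?\<eta>) y = pderiv_dir i (pderiv_dir i ?\<rho>) (x - y)"
    if "i \<in> Basis" for i y
  proof -
    have "((\<lambda>y. - pderiv_dir i ?\<rho> (x - y)) has_derivative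
       (\<lambda>h. - (- frechet_derivative (pderiv_dir i ?\<rho>) (at (x - y)) h))) (at y)"
      by (intro has_derivative_minus has_derivative_reflect smooth_differentiable smooth_pderiv[OF s that])
    from pderiv_dir_eqI[OF this] show ?thesis unfolding d1[abs_def] by simp
  qed
  show "(\<integral>y. u y * pderiv_dir i ?\<rho> (x - y) \<partial>lborel) = (\<integral>y. (G y \<bullet> i) * ?\<rho> (x - y) \<partial>lborel)"
    if "i \<in> Basis"
  proof -
    have "(\<integral>y. u y * pderiv_dir i ?\<eta> y \<partial>lborel) = - (\<integral>y. (G y \<bullet> i) * ?\<eta> y \<partial>lborel)"
      using w \<eta> that unfolding weak_grad_lap_def by blast
    then show ?thesis unfolding d1 by simp
  qed
  have "(\<integral>y. u y * (\<Sum>i\<in>Basis. pderiv_dir i (pderiv_dir i ?\<eta>) y) \<partial>lborel) = (\<integral>y. L y * ?\<eta> y \<partial>lborel)"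
    using w \<eta> unfolding weak_grad_lap_def by blast
  then show "(\<integral>y. u y * (\<Sum>i\<in>Basis. pderiv_dir i (pderiv_dir i ?\<rho>) (x - y)) \<partial>lborel)
           = (\<integral>y. L y * ?\<rho> (x - y) \<partial>lborel)"
    by (simp add: d2 cong: sum.cong)
qed

lemma convolution_test_function_has_dir_deriv:
  fixes f \<kappa> :: "'a::euclidean_space \<Rightarrow> real"
  assumes "integrable lborel f" "test_function UNIV \<kappa>" "i \<in> Basis"
  shows "has_dir_deriv (\<lambda>x. \<integral>y. f y * \<kappa> (x - y) \<partial>lborel) i
           (\<integral>y. f y * pderiv_dir i \<kappa> (x - y) \<partial>lborel) x"
proof -
  note d = test_function_pderiv[OF assms(2,3)]
  obtain C B where "\<And>x. \<bar>\<kappa> x\<bar> \<le> C" "\<And>x. \<bar>pderiv_dir i \<kappa> x\<bar> \<le> B"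
    using test_function_bounded[OF assms(2)] test_function_bounded[OF d] by metis
  then show ?thesis
    using assms(1) test_function_borel[OF assms(2)] test_function_borel[OF d]
      differentiable_imp_dir_deriv[OF smooth_differentiable[OF test_function_smooth[OF assms(2)]]]
    by (intro convolution_has_dir_deriv[where C=C and B=B])
qed

lemma convolution_test_function_bounded:
  fixes f \<kappa> :: "'a::euclidean_space \<Rightarrow> real"
  assumes f: "integrable lborel f" and \<kappa>: "test_function UNIV \<kappa>"
  obtains B where "\<And>x. \<bar>\<integral>y. f y * \<kappa> (x - y) \<partial>lborel\<bar> \<le> B"
proof -
  obtain C where C: "\<And>x. \<bar>\<kappa> x\<bar> \<le> C" using test_function_bounded[OF \<kappa>] by blast
  have [measurable]: "\<kappa> \<in> borel_measurable borel" "f \<in> borel_measurable borel"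
    using test_function_borel[OF \<kappa>] f by auto
  have le: "norm (f y * \<kappa> (x - y)) \<le> norm (\<bar>f y\<bar> * C)" for x y
    unfolding real_norm_def abs_mult abs_abs
    by (intro mult_left_mono order.trans[OF C abs_ge_self]) simp
  have iC: "integrable lborel (\<lambda>y. \<bar>f y\<bar> * C)" using f by simp
  have "C \<ge> 0" using C[of undefined] by linarith
  have "\<bar>\<integral>y. f y * \<kappa> (x - y) \<partial>lborel\<bar> \<le> (\<integral>y. \<bar>f y\<bar> * C \<partial>lborel)" for x
  proof (rule integral_abs_bound_integral)
    show "integrable lborel (\<lambda>y. f y * \<kappa> (x - y))"
      by (rule Bochner_Integration.integrable_bound[OF iC]) (use le in auto)
    show "\<bar>f y * \<kappa> (x - y)\<bar> \<le> \<bar>f y\<bar> * C" for y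
      using le[of y x] \<open>C \<ge> 0\<close> by (simp add: abs_mult)
  qed (rule iC)
  then show thesis using that by blast
qed

lemma convolution_test_function_borel:
  fixes f \<kappa> :: "'a::euclidean_space \<Rightarrow> real"
  assumes f: "integrable lborel f" and \<kappa>: "test_function UNIV \<kappa>"
  shows "(\<lambda>x. \<integral>y. f y * \<kappa> (x - y) \<partial>lborel) \<in> borel_measurable borel"
proof -
  have [measurable]: "\<kappa> \<in> borel_measurable borel" "f \<in> borel_measurable borel"
    using test_function_borel[OF \<kappa>] f by auto
  have "(\<lambda>x. \<integral>y. f y * \<kappa> (x - y) \<partial>lborel) \<in> borel_measurable lborel"
    by (rule lborel.borel_measurable_lebesgue_integral) simp
  then show ?thesis by simp
qed

text \<open>The mean oscillation of \<open>G\<close> around \<open>x\<close> at scale \<open>\<epsilon>\<close>. It bounds the errors made when the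
  norm is interchanged with the mollification, and its integral is small by continuity of
  translations.\<close>

definition mean_osc :: "real \<Rightarrow> ('a::euclidean_space \<Rightarrow> 'a) \<Rightarrow> 'a \<Rightarrow> real" where
  "mean_osc \<epsilon> G x = (\<integral>y. mollifier \<epsilon> (x - y) * norm (G y - G x) \<partial>lborel)"

lemma integrable_mollifier_scaleR:
  fixes G :: "'a::euclidean_space \<Rightarrow> 'b::{banach, second_countable_topology}"
  assumes \<epsilon>: "\<epsilon> > 0" and G: "integrable lborel G"
  shows "integrable lborel (\<lambda>y. mollifier \<epsilon> (x - y) *\<^sub>R (G y - a))"
proof -
  obtain C where C: "\<And>x. \<bar>mollifier \<epsilon> (x::'a)\<bar> \<le> C" using test_function_bounded[OF test_function_mollifier[OF \<epsilon>]] by blast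
  have [measurable]: "(mollifier \<epsilon> :: 'a \<Rightarrow> real) \<in> borel_measurable borel" "G \<in> borel_measurable borel"
    using test_function_borel[OF test_function_mollifier[OF \<epsilon>]] G by auto
  have "integrable lborel (\<lambda>y. mollifier \<epsilon> (x - y) *\<^sub>R G y)"
  proof (rule Bochner_Integration.integrable_bound[where f="\<lambda>y. C *\<^sub>R G y"])
    show "integrable lborel (\<lambda>y. C *\<^sub>R G y)" using G by simp
    have "norm (mollifier \<epsilon> (x - y) *\<^sub>R G y) \<le> norm (C *\<^sub>R G y)" for y
      unfolding norm_scaleR by (intro mult_right_mono order.trans[OF C abs_ge_self]) simp
    then show "AE y in lborel. norm (mollifier \<epsilon> (x - y) *\<^sub>R G y) \<le> norm (C *\<^sub>R G y)" by simp
  qed simp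
  moreover have "integrable lborel (\<lambda>y. mollifier \<epsilon> (x - y) *\<^sub>R a)"
    using mollifier_shift(1)[OF \<epsilon>] by (rule integrable_scaleR_left)
  ultimately show ?thesis unfolding scaleR_diff_right by (rule Bochner_Integration.integrable_diff)
qed

lemma mean_osc_bounds:
  fixes G :: "'a::euclidean_space \<Rightarrow> 'a"
  assumes \<epsilon>: "\<epsilon> > 0" and G: "integrable lborel G"
  shows "norm ((\<integral>y. mollifier \<epsilon> (x - y) *\<^sub>R G y \<partial>lborel) - G x) \<le> mean_osc \<epsilon> G x"
    and "(\<integral>y. norm (G y) * mollifier \<epsilon> (x - y) \<partial>lborel) \<le> norm (G x) + mean_osc \<epsilon> G x"
    and "mean_osc \<epsilon> G x \<ge> 0"
proof -
  note i0 = integrable_mollifier_scaleR[OF \<epsilon> G, of x 0, simplified]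
  note iG = integrable_mollifier_scaleR[OF \<epsilon> G, of x "G x"]
  have iN: "integrable lborel (\<lambda>y. mollifier \<epsilon> (x - y) * norm (G y))"
    using integrable_mollifier_scaleR[OF \<epsilon> integrable_norm[OF G], of x 0] by simp
  have i1: "integrable lborel (\<lambda>y. mollifier \<epsilon> (x - y) *\<^sub>R G x)" for x
    using mollifier_shift(1)[OF \<epsilon>] by (rule integrable_scaleR_left)
  have n: "norm (mollifier \<epsilon> (x - y) *\<^sub>R (G y - G x)) = mollifier \<epsilon> (x - y) * norm (G y - G x)" for y
    using mollifier_nonneg[OF \<epsilon>, of "x - y"] by simp
  have iO: "integrable lborel (\<lambda>y. mollifier \<epsilon> (x - y) * norm (G y - G x))"
    using integrable_norm[OF iG] unfolding n .
  have "(\<integral>y. mollifier \<epsilon> (x - y) *\<^sub>R (G y - G x) \<partial>lborel)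
      = (\<integral>y. mollifier \<epsilon> (x - y) *\<^sub>R G y \<partial>lborel) - (\<integral>y. mollifier \<epsilon> (x - y) *\<^sub>R G x \<partial>lborel)"
    unfolding scaleR_diff_right by (rule Bochner_Integration.integral_diff[OF i0 i1])
  also have "(\<integral>y. mollifier \<epsilon> (x - y) *\<^sub>R G x \<partial>lborel) = G x"
    using mollifier_shift[OF \<epsilon>, of x] by simp
  finally have eq: "(\<integral>y. mollifier \<epsilon> (x - y) *\<^sub>R G y \<partial>lborel) - G x
      = (\<integral>y. mollifier \<epsilon> (x - y) *\<^sub>R (G y - G x) \<partial>lborel)" by simp
  show "norm ((\<integral>y. mollifier \<epsilon> (x - y) *\<^sub>R G y \<partial>lborel) - G x) \<le> mean_osc \<epsilon> G x"
    unfolding eq mean_osc_def n[symmetric] by (rule integral_norm_bound)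
  have "(\<integral>y. mollifier \<epsilon> (x - y) * norm (G y) \<partial>lborel)
     \<le> (\<integral>y. mollifier \<epsilon> (x - y) * norm (G x) + mollifier \<epsilon> (x - y) * norm (G y - G x) \<partial>lborel)"
  proof (rule integral_mono[OF iN])
    show "integrable lborel (\<lambda>y. mollifier \<epsilon> (x - y) * norm (G x) + mollifier \<epsilon> (x - y) * norm (G y - G x))"
      by (rule Bochner_Integration.integrable_add[OF integrable_mult_left[OF mollifier_shift(1)[OF \<epsilon>]] iO])
    fix y
    have "norm (G y) \<le> norm (G x) + norm (G y - G x)" using norm_triangle_sub by blast
    then show "mollifier \<epsilon> (x - y) * norm (G y)
       \<le> mollifier \<epsilon> (x - y) * norm (G x) + mollifier \<epsilon> (x - y) * norm (G y - G x)"
      using mult_left_mono[OF _ mollifier_nonneg[OF \<epsilon>, of "x - y"]] by (simp flip: distrib_left)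
  qed
  also have "\<dots> = norm (G x) + mean_osc \<epsilon> G x"
    unfolding mean_osc_def
    using integrable_mult_left[OF mollifier_shift(1)[OF \<epsilon>]] iO mollifier_shift(2)[OF \<epsilon>]
    by (subst Bochner_Integration.integral_add) auto
  finally show "(\<integral>y. norm (G y) * mollifier \<epsilon> (x - y) \<partial>lborel) \<le> norm (G x) + mean_osc \<epsilon> G x"
    by (simp add: mult.commute)
  show "mean_osc \<epsilon> G x \<ge> 0" unfolding mean_osc_def
    by (intro Bochner_Integration.integral_nonneg mult_nonneg_nonneg mollifier_nonneg[OF \<epsilon>] norm_ge_zero)
qed

lemma integral_mean_osc:
  fixes G :: "'a::euclidean_space \<Rightarrow> 'a"
  assumes \<epsilon>: "\<epsilon> > 0" and G: "integrable lborel G" and "e \<ge> 0"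
    and small: "\<And>h. norm h \<le> \<epsilon> \<Longrightarrow> (\<integral>x. norm (G (x + h) - G x) \<partial>lborel) \<le> e"
  shows "integrable lborel (mean_osc \<epsilon> G)" "(\<integral>x. mean_osc \<epsilon> G x \<partial>lborel) \<le> e"
proof -
  have [measurable]: "(mollifier \<epsilon> :: 'a \<Rightarrow> real) \<in> borel_measurable borel" "G \<in> borel_measurable borel"
    using test_function_borel[OF test_function_mollifier[OF \<epsilon>]] G by auto
  have nn: "ennreal (mean_osc \<epsilon> G x) = (\<integral>\<^sup>+h. ennreal (mollifier \<epsilon> h * norm (G (x + h) - G x)) \<partial>lborel)" for x
  proof -
    have "integrable lborel (\<lambda>y. norm (mollifier \<epsilon> (x - y) *\<^sub>R (G y - G x)))"
      by (rule integrable_norm[OF integrable_mollifier_scaleR[OF \<epsilon> G]])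
    then have "integrable lborel (\<lambda>y. mollifier \<epsilon> (x - y) * norm (G y - G x))"
      by (simp add: abs_of_nonneg[OF mollifier_nonneg[OF \<epsilon>]])
    then have "ennreal (mean_osc \<epsilon> G x) = (\<integral>\<^sup>+y. ennreal (mollifier \<epsilon> (x - y) * norm (G y - G x)) \<partial>lborel)"
      unfolding mean_osc_def
      by (intro nn_integral_eq_integral[symmetric] AE_I2 mult_nonneg_nonneg mollifier_nonneg[OF \<epsilon>] norm_ge_zero)
    also have "\<dots> = (\<integral>\<^sup>+h. ennreal (mollifier \<epsilon> (x - (h + x)) * norm (G (h + x) - G x)) \<partial>lborel)"
      by (rule nn_integral_lborel_shift[symmetric]) simp
    finally show ?thesis by (simp add: mollifier_minus add.commute)
  qed
  have "(\<integral>\<^sup>+x. ennreal (mean_osc \<epsilon> G x) \<partial>lborel)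
     = (\<integral>\<^sup>+h. (\<integral>\<^sup>+x. ennreal (mollifier \<epsilon> h * norm (G (x + h) - G x)) \<partial>lborel) \<partial>lborel)"
    unfolding nn by (rule lborel_pair.Fubini') measurable
  also have "\<dots> \<le> (\<integral>\<^sup>+h. ennreal (mollifier \<epsilon> (h::'a) * e) \<partial>lborel)"
  proof (rule nn_integral_mono)
    fix h :: 'a
    have i: "integrable lborel (\<lambda>x. norm (G (x + h) - G x))"
      by (intro integrable_norm Bochner_Integration.integrable_diff integrable_lborel_shift G)
    have "(\<integral>\<^sup>+x. ennreal (mollifier \<epsilon> h * norm (G (x + h) - G x)) \<partial>lborel)
        = ennreal (mollifier \<epsilon> h * (\<integral>x. norm (G (x + h) - G x) \<partial>lborel))"
      using integrable_mult_right[OF i, of "mollifier \<epsilon> h"]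
      by (subst nn_integral_eq_integral) (auto simp: mollifier_nonneg[OF \<epsilon>])
    also have "\<dots> \<le> ennreal (mollifier \<epsilon> h * e)"
    proof (cases "norm h \<le> \<epsilon>")
      case True
      then show ?thesis using small by (intro ennreal_leI mult_left_mono mollifier_nonneg[OF \<epsilon>])
    qed (simp add: mollifier_zero[OF \<epsilon>])
    finally show "(\<integral>\<^sup>+x. ennreal (mollifier \<epsilon> h * norm (G (x + h) - G x)) \<partial>lborel)
        \<le> ennreal (mollifier \<epsilon> h * e)" .
  qed
  also have "\<dots> = ennreal e"
  proof -
    have "integrable lborel (\<lambda>h::'a. mollifier \<epsilon> h * e)"
      by (rule integrable_mult_left[OF integrable_mollifier[OF \<epsilon>]])
    then have "(\<integral>\<^sup>+h. ennreal (mollifier \<epsilon> (h::'a) * e) \<partial>lborel) = ennreal (\<integral>h. mollifier \<epsilon> (h::'a) * e \<partial>lborel)"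
      by (rule nn_integral_eq_integral) (simp add: \<open>e \<ge> 0\<close> mollifier_nonneg[OF \<epsilon>])
    then show ?thesis by (simp add: integral_mollifier[OF \<epsilon>])
  qed
  finally have le: "(\<integral>\<^sup>+x. ennreal (mean_osc \<epsilon> G x) \<partial>lborel) \<le> ennreal e" .
  have m: "mean_osc \<epsilon> G \<in> borel_measurable lborel"
    unfolding mean_osc_def[abs_def] by (rule lborel.borel_measurable_lebesgue_integral) simp
  show int: "integrable lborel (mean_osc \<epsilon> G)"
  proof (rule integrableI_nonneg[OF m])
    show "AE x in lborel. 0 \<le> mean_osc \<epsilon> G x" using mean_osc_bounds(3)[OF \<epsilon> G] by simp
    show "(\<integral>\<^sup>+x. ennreal (mean_osc \<epsilon> G x) \<partial>lborel) < \<infinity>"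
      using order.strict_trans1[OF le ennreal_less_top] by simp
  qed
  have "ennreal (\<integral>x. mean_osc \<epsilon> G x \<partial>lborel) \<le> ennreal e"
    using le mean_osc_bounds(3)[OF \<epsilon> G] by (subst (asm) nn_integral_eq_integral[OF int]) auto
  then show "(\<integral>x. mean_osc \<epsilon> G x \<partial>lborel) \<le> e"
    using \<open>e \<ge> 0\<close> by (simp add: ennreal_le_iff)
qed

section \<open>A maximum principle for strong solutions\<close>

text \<open>The convolution of \<open>u\<close> with the mollifier.\<close>

definition mollify :: "real \<Rightarrow> ('a::euclidean_space \<Rightarrow> real) \<Rightarrow> 'a \<Rightarrow> real" where
  "mollify \<epsilon> u x = (\<integral>y. u y * mollifier \<epsilon> (x - y) \<partial>lborel)"

lemma has_dir_deriv_transform: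
  assumes "has_dir_deriv f i d x" "open S" "x \<in> S" "\<And>y. y \<in> S \<Longrightarrow> f y = f' y"
  shows "has_dir_deriv f' i d x"
  unfolding has_dir_deriv_def
proof (rule has_field_derivative_transform_within_open[where S="(\<lambda>t. x + t *\<^sub>R i) -` S"])
  show "((\<lambda>t. f (x + t *\<^sub>R i)) has_real_derivative d) (at 0)" using assms(1) unfolding has_dir_deriv_def .
  show "open ((\<lambda>t. x + t *\<^sub>R i) -` S)"
    by (rule continuous_open_vimage[OF assms(2)]) (auto intro!: continuous_intros)
qed (use assms in auto)

lemma has_dir_deriv_add:
  "has_dir_deriv f i d x \<Longrightarrow> has_dir_deriv f' i d' x \<Longrightarrow> has_dir_deriv (\<lambda>x. f x + f' x) i (d + d') x"
  unfolding has_dir_deriv_def by (rule DERIV_add)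

lemma has_dir_deriv_mult:
  assumes "has_dir_deriv f i d x" "has_dir_deriv f' i d' x"
  shows "has_dir_deriv (\<lambda>x. f x * f' x) i (d * f' x + d' * f x) x"
  using DERIV_mult[OF assms[unfolded has_dir_deriv_def]] unfolding has_dir_deriv_def by simp

lemma has_dir_deriv_flat:
  assumes "has_dir_deriv f i d x"
  shows "has_dir_deriv (\<lambda>x. flat (f x)) i (flat (f x) / (f x)\<^sup>2 * d) x"
proof -
  have "(flat has_real_derivative flat (f x) / (f x)\<^sup>2) (at (f (x + 0 *\<^sub>R i)))"
    using flat_has_derivative[of "f x"] by simp
  from DERIV_chain2[OF this assms[unfolded has_dir_deriv_def]]
  show ?thesis unfolding has_dir_deriv_def .
qed

lemma flat_deriv_bound: "0 \<le> flat t / t\<^sup>2" "flat t / t\<^sup>2 \<le> 2"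
proof -
  show "0 \<le> flat t / t\<^sup>2" using flat_bounds(1) by simp
  show "flat t / t\<^sup>2 \<le> 2"
  proof (cases "t \<le> 0")
    case False
    have "1 + 1 / t + (1 / t)\<^sup>2 / 2 \<le> exp (1 / t)"
      using False by (intro exp_lower_Taylor_quadratic) simp
    moreover have "1 + 1 / t > 0" using False by (simp add: add_pos_pos)
    ultimately have "(1 / t)\<^sup>2 / 2 \<le> exp (1 / t)" by linarith
    then have "(1 / t)\<^sup>2 / 2 * exp (- (1 / t)) \<le> exp (1 / t) * exp (- (1 / t))"
      by (intro mult_right_mono) auto
    also have "\<dots> = 1" by (simp flip: exp_add)
    finally show ?thesis using False by (simp add: flat_def power_divide divide_le_eq mult.commute)
  qed (simp add: flat_bounds(4))
qed

lemma integrable_convolution_integrand: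
  fixes f \<kappa> :: "'a::euclidean_space \<Rightarrow> real"
  assumes "integrable lborel f" "test_function UNIV \<kappa>"
  shows "integrable lborel (\<lambda>y. f y * \<kappa> (x - y))"
proof (rule integrable_mult_test_function[OF _ assms(1)])
  let ?K = "closure {x. \<kappa> x \<noteq> 0}"
  show "test_function UNIV (\<lambda>y. \<kappa> (x - y))"
  proof (rule test_functionI[OF smooth_reflect[OF test_function_smooth[OF assms(2)]]])
    show "compact ((\<lambda>z. x - z) ` ?K)"
      by (intro compact_continuous_image continuous_intros test_function_support(1)[OF assms(2)])
    fix y assume "y \<notin> (\<lambda>z. x - z) ` ?K"
    then have "x - y \<notin> ?K" by (metis diff_diff_eq2 add_diff_cancel_left' image_eqI)
    then show "\<kappa> (x - y) = 0" using closure_subset[of "{x. \<kappa> x \<noteq> 0}"] by auto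
  qed auto
qed

text \<open>The core computation. With \<open>w\<close> the mollification of \<open>u\<close> plus \<open>\<psi>\<close> minus \<open>s\<^sub>1\<close>, the divergence
  theorem for the field \<open>flat(w) \<nabla>w\<close> gives
  \<open>\<integral> flat(w) \<Delta>w + flat'(w) |\<nabla>w|\<^sup>2 = 0\<close>. In the first term \<open>\<Delta>w \<ge> - \<tau> |\<nabla>w| + 3c/4\<close> up to an
  error that is a multiple of \<open>mean_osc\<close>; since \<open>flat'(w) = flat(w) / w\<^sup>2\<close> and \<open>w\<close> is small on its
  positivity set, the second term absorbs \<open>- \<tau> |\<nabla>w| flat(w)\<close>.\<close>

lemma energy_estimate:
  fixes \<Omega> U K :: "'a::euclidean_space set" and u \<psi> :: "'a \<Rightarrow> real"
    and g :: "'a \<Rightarrow> 'a" and q :: "'a \<Rightarrow> 'a \<Rightarrow> real"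
  assumes w: "weak_grad_lap \<Omega> u G L" and u: "integrable lborel u"
    and ineq: "AE x in lborel. x \<in> \<Omega> \<longrightarrow> L x \<ge> - \<tau> * norm (G x) - l * u x" and \<tau>: "\<tau> \<ge> 0"
    and U: "open U" "K \<subseteq> U" "compact K"
    and cont: "continuous_on U \<psi>" "continuous_on U g" "\<And>i. i \<in> Basis \<Longrightarrow> continuous_on U (q i)"
    and d\<psi>: "\<And>x i. x \<in> U \<Longrightarrow> i \<in> Basis \<Longrightarrow> has_dir_deriv \<psi> i (g x \<bullet> i) x"
    and dg: "\<And>x i. x \<in> U \<Longrightarrow> i \<in> Basis \<Longrightarrow> has_dir_deriv (\<lambda>x. g x \<bullet> i) i (q i x) x"
    and super: "\<And>x. x \<in> K \<Longrightarrow> l * u x + \<tau> * norm (g x) - (\<Sum>i\<in>Basis. q i x) \<le> - c"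
    and \<epsilon>: "\<epsilon> > 0" "\<And>x. x \<in> K \<Longrightarrow> cball x \<epsilon> \<subseteq> \<Omega>"
    and \<theta>: "\<And>x. x \<in> K \<Longrightarrow> \<bar>mollify \<epsilon> u x - u x\<bar> \<le> \<theta>" "\<bar>l\<bar> * \<theta> \<le> c / 4"
    and off: "\<And>x. x \<in> U \<Longrightarrow> x \<notin> K \<Longrightarrow> mollify \<epsilon> u x + \<psi> x - s1 \<le> 0"
    and top: "\<And>x. x \<in> K \<Longrightarrow> mollify \<epsilon> u x + \<psi> x - s1 \<le> \<delta>" "\<tau>\<^sup>2 * \<delta>\<^sup>2 \<le> c"
    and e: "e \<ge> 0" "\<And>h. norm h \<le> \<epsilon> \<Longrightarrow> (\<integral>x. norm (G (x + h) - G x) \<partial>lborel) \<le> e"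
  shows "integrable lborel (\<lambda>x. indicator K x * flat (mollify \<epsilon> u x + \<psi> x - s1))"
    and "c / 2 * (\<integral>x. indicator K x * flat (mollify \<epsilon> u x + \<psi> x - s1) \<partial>lborel) \<le> 2 * \<tau> * e"
proof -
  let ?\<rho> = "mollifier \<epsilon> :: 'a \<Rightarrow> real"
  note tf = test_function_mollifier[OF \<epsilon>(1), where 'a='a]
  have iG: "integrable lborel G" and iL: "integrable lborel L"
    using w unfolding weak_grad_lap_def by auto
  define a where "a i x = (\<integral>y. u y * pderiv_dir i ?\<rho> (x - y) \<partial>lborel)" for i x
  define A where "A i x = (\<integral>y. u y * pderiv_dir i (pderiv_dir i ?\<rho>) (x - y) \<partial>lborel)" for i x
  define b where "b i x = a i x + g x \<bullet> i" for i x
  define W where "W x = mollify \<epsilon> u x + \<psi> x - s1" for x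
  define F where "F i x = indicator K x * (b i x * flat (W x))" for i x
  define F' where "F' i x = indicator K x * ((A i x + q i x) * flat (W x)
                     + (b i x)\<^sup>2 * (flat (W x) / (W x)\<^sup>2))" for i x
  have dm: "has_dir_deriv (mollify \<epsilon> u) i (a i x) x" if "i \<in> Basis" for i x
    unfolding a_def mollify_def[abs_def] by (rule convolution_test_function_has_dir_deriv[OF u tf that])
  have da: "has_dir_deriv (a i) i (A i x) x" if "i \<in> Basis" for i x
    unfolding a_def[abs_def] A_def
    by (rule convolution_test_function_has_dir_deriv[OF u test_function_pderiv[OF tf that] that])
  have db: "has_dir_deriv (b i) i (A i x + q i x) x" if "i \<in> Basis" "x \<in> U" for i x
    unfolding b_def[abs_def] by (rule has_dir_deriv_add[OF da[OF that(1)] dg[OF that(2,1)]])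
  have dW: "has_dir_deriv W i (b i x) x" if "i \<in> Basis" "x \<in> U" for i x
  proof -
    have "has_dir_deriv (\<lambda>x. - s1) i 0 x" unfolding has_dir_deriv_def by simp
    from has_dir_deriv_add[OF has_dir_deriv_add[OF dm[OF that(1)] d\<psi>[OF that(2,1)]] this]
    show ?thesis unfolding b_def W_def[abs_def] by simp
  qed
  have flat0: "flat (W x) = 0" if "x \<in> U" "x \<notin> K" for x
    using off[OF that] unfolding W_def by (rule flat_bounds(4))
  have dF: "has_dir_deriv (F i) i (F' i x) x" if i: "i \<in> Basis" for i x
  proof (cases "x \<in> U")
    case True
    have "has_dir_deriv (\<lambda>x. b i x * flat (W x)) i
        ((A i x + q i x) * flat (W x) + flat (W x) / (W x)\<^sup>2 * b i x * b i x) x"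
      by (rule has_dir_deriv_mult[OF db[OF i True] has_dir_deriv_flat[OF dW[OF i True]]])
    moreover have "(A i x + q i x) * flat (W x) + flat (W x) / (W x)\<^sup>2 * b i x * b i x = F' i x"
      using flat0[OF True] by (cases "x \<in> K") (auto simp: F'_def power2_eq_square)
    ultimately have "has_dir_deriv (\<lambda>x. b i x * flat (W x)) i (F' i x) x" by simp
    then show ?thesis
    proof (rule has_dir_deriv_transform[OF _ U(1) True])
      show "b i y * flat (W y) = F i y" if "y \<in> U" for y
        using flat0[OF that] by (cases "y \<in> K") (auto simp: F_def)
    qed
  next
    case False
    then have x: "x \<in> - K" using U(2) by blast
    have "has_dir_deriv (\<lambda>x. 0) i 0 x" unfolding has_dir_deriv_def by simp
    then have "has_dir_deriv (F i) i 0 x"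
      by (rule has_dir_deriv_transform[OF _ _ x]) (use compact_imp_closed[OF U(3)] in \<open>auto simp: F_def\<close>)
    then show ?thesis using x by (simp add: F'_def)
  qed
  obtain R where R: "K \<subseteq> cball 0 R"
    using compact_imp_bounded[OF U(3)] unfolding bounded_iff by (auto simp: subset_iff)
  have [measurable]: "K \<in> sets borel" using compact_imp_closed[OF U(3)] by simp
  have [measurable]: "flat \<in> borel_measurable borel"
    using continuous_flat by (rule borel_measurable_continuous_onI)
  have mres: "(\<lambda>x. indicator K x * f x) \<in> borel_measurable borel" if "continuous_on U f" for f :: "'a \<Rightarrow> real"
    using borel_measurable_continuous_on_indicator[of K f] continuous_on_subset[OF that U(2)] by simp
  have bres: "\<exists>B. \<forall>x\<in>K. \<bar>f x\<bar> \<le> B" if "continuous_on U f" for f :: "'a \<Rightarrow> real"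
    using compact_imp_bounded[OF compact_continuous_image[OF continuous_on_subset[OF that U(2)] U(3)]]
    unfolding bounded_iff by (metis imageI real_norm_def)
  have cgi: "continuous_on U (\<lambda>x. g x \<bullet> i)" for i by (intro continuous_intros cont(2))
  \<comment> \<open>\<open>\<psi>\<close>, \<open>g\<close> and \<open>q\<close> are only known to be continuous on \<open>U\<close>; measurability is obtained after
      multiplication by the indicator of \<open>K\<close>.\<close>
  have mm: "mollify \<epsilon> u \<in> borel_measurable borel"
    unfolding mollify_def[abs_def] by (rule convolution_test_function_borel[OF u tf])
  have mW: "(\<lambda>x. flat (mollify \<epsilon> u x + indicator K x * \<psi> x - s1)) \<in> borel_measurable borel"
    using mm mres[OF cont(1)] by measurable
  have Zeq: "indicator K x * flat (W x) = indicator K x * flat (mollify \<epsilon> u x + indicator K x * \<psi> x - s1)" for x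
    by (cases "x \<in> K") (auto simp: W_def)
  have iZ: "integrable lborel (\<lambda>x. indicator K x * flat (W x))"
  proof (rule integrable_bounded_support[where B=1 and a=0 and R=R])
    show "(\<lambda>x. indicator K x * flat (W x)) \<in> borel_measurable borel"
      unfolding Zeq using mW by measurable
    show "\<bar>indicator K x * flat (W x)\<bar> \<le> 1" for x
      using flat_bounds(1,2)[of "W x"] by (cases "x \<in> K") auto
    show "indicator K x * flat (W x) = 0" if "x \<notin> cball 0 R" for x
      using that R by (auto simp: indicator_def)
  qed
  then show "integrable lborel (\<lambda>x. indicator K x * flat (mollify \<epsilon> u x + \<psi> x - s1))"
    unfolding W_def .
  have F'_int: "integrable lborel (F' i) \<and> (\<integral>x. F' i x \<partial>lborel) = 0" if i: "i \<in> Basis" for i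
  proof -
    note ti = test_function_pderiv[OF tf i]
    have ma: "a i \<in> borel_measurable borel" "A i \<in> borel_measurable borel"
      unfolding a_def[abs_def] A_def[abs_def]
      by (rule convolution_test_function_borel[OF u ti]
               convolution_test_function_borel[OF u test_function_pderiv[OF ti i]])+
    obtain Ba where Ba: "\<And>x. \<bar>a i x\<bar> \<le> Ba"
      by (rule convolution_test_function_bounded[OF u ti, folded a_def]) blast
    obtain BA where BA: "\<And>x. \<bar>A i x\<bar> \<le> BA"
      by (rule convolution_test_function_bounded[OF u test_function_pderiv[OF ti i], folded A_def]) blast
    note B1 = Ba BA
    obtain Bg where Bg: "\<forall>x\<in>K. \<bar>g x \<bullet> i\<bar> \<le> Bg" using bres[OF cgi] by (rule exE)
    obtain Bq where Bq: "\<forall>x\<in>K. \<bar>q i x\<bar> \<le> Bq" using bres[OF cont(3)[OF i]] by (rule exE)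
    note B2 = bspec[OF Bg] bspec[OF Bq]
    define gK qK \<psi>K where "gK x = indicator K x * (g x \<bullet> i)" and "qK x = indicator K x * q i x"
      and "\<psi>K x = indicator K x * \<psi> x" for x
    have [measurable]: "gK \<in> borel_measurable borel" "qK \<in> borel_measurable borel"
      "\<psi>K \<in> borel_measurable borel" "a i \<in> borel_measurable borel" "A i \<in> borel_measurable borel"
      "mollify \<epsilon> u \<in> borel_measurable borel"
      using ma mm mres[OF cgi] mres[OF cont(3)[OF i]] mres[OF cont(1)]
      unfolding gK_def[abs_def] qK_def[abs_def] \<psi>K_def[abs_def] by auto
    have "F i = (\<lambda>x. indicator K x * ((a i x + gK x) * flat (mollify \<epsilon> u x + \<psi>K x - s1)))"
    proof
      fix x show "F i x = indicator K x * ((a i x + gK x) * flat (mollify \<epsilon> u x + \<psi>K x - s1))"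
        by (cases "x \<in> K") (auto simp: F_def b_def W_def gK_def \<psi>K_def)
    qed
    also have "\<dots> \<in> borel_measurable borel" by measurable
    finally have mF: "F i \<in> borel_measurable borel" .
    have "F' i = (\<lambda>x. indicator K x * ((A i x + qK x) * flat (mollify \<epsilon> u x + \<psi>K x - s1)
         + (a i x + gK x)\<^sup>2 * (flat (mollify \<epsilon> u x + \<psi>K x - s1) / (mollify \<epsilon> u x + \<psi>K x - s1)\<^sup>2)))"
    proof
      fix x show "F' i x = indicator K x * ((A i x + qK x) * flat (mollify \<epsilon> u x + \<psi>K x - s1)
         + (a i x + gK x)\<^sup>2 * (flat (mollify \<epsilon> u x + \<psi>K x - s1) / (mollify \<epsilon> u x + \<psi>K x - s1)\<^sup>2))"
        by (cases "x \<in> K") (auto simp: F'_def b_def W_def gK_def qK_def \<psi>K_def)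
    qed
    also have "\<dots> \<in> borel_measurable borel" by measurable
    finally have mF': "F' i \<in> borel_measurable borel" .
    have b: "\<bar>b i x\<bar> \<le> Ba + Bg" if "x \<in> K" for x
      using B1(1)[of x] B2(1)[OF that] unfolding b_def by linarith
    have bF: "\<bar>F i x\<bar> \<le> \<bar>Ba + Bg\<bar>" for x
    proof (cases "x \<in> K")
      case True
      have "\<bar>b i x\<bar> * \<bar>flat (W x)\<bar> \<le> \<bar>Ba + Bg\<bar> * 1"
        using b[OF True] flat_bounds(1,2)[of "W x"] by (intro mult_mono) auto
      then show ?thesis using True by (simp add: F_def abs_mult)
    qed (simp add: F_def)
    have bF': "\<bar>F' i x\<bar> \<le> \<bar>BA + Bq\<bar> + (Ba + Bg)\<^sup>2 * 2" for x
    proof (cases "x \<in> K")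
      case True
      have "\<bar>A i x + q i x\<bar> * \<bar>flat (W x)\<bar> \<le> \<bar>BA + Bq\<bar> * 1"
        using B1(2)[of x] B2(2)[OF True] flat_bounds(1,2)[of "W x"] by (intro mult_mono) auto
      moreover have "(b i x)\<^sup>2 * (flat (W x) / (W x)\<^sup>2) \<le> (Ba + Bg)\<^sup>2 * 2"
        using b[OF True] flat_deriv_bound[of "W x"] by (intro mult_mono) (auto simp: abs_le_square_iff[symmetric])
      moreover have "0 \<le> (b i x)\<^sup>2 * (flat (W x) / (W x)\<^sup>2)"
        using flat_deriv_bound(1) by (intro mult_nonneg_nonneg) auto
      ultimately show ?thesis using True unfolding F'_def abs_mult[symmetric] by simp
    qed (simp add: F'_def)
    have z: "F i x = 0" "F' i x = 0" if "x \<notin> cball 0 R" for x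
      using that R by (auto simp: F_def F'_def indicator_def)
    have "norm i \<le> 1" using i by simp
    then show ?thesis
      using integral_dir_deriv_eq_0[OF mF mF' dF[OF i] bF bF' z(1)]
        integrable_bounded_support[OF mF' bF' z(2)] by blast
  qed
  have main: "c / 2 * (indicator K x * flat (W x)) \<le> (\<Sum>i\<in>Basis. F' i x) + 2 * \<tau> * mean_osc \<epsilon> G x" for x
  proof (cases "x \<in> K \<and> W x > 0")
    case False
    then have "indicator K x * flat (W x) = 0" using flat_bounds(4)[of "W x"] by (auto simp: indicator_def)
    moreover have "F' i x = 0" for i
      using False flat_bounds(4)[of "W x"] by (auto simp: indicator_def F'_def)
    moreover have "0 \<le> 2 * \<tau> * mean_osc \<epsilon> G x" using mean_osc_bounds(3)[OF \<epsilon>(1) iG, of x] \<tau> by simp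
    ultimately show ?thesis by (simp only: mult_zero_right sum.neutral_const)
  next
    case True
    then have K: "x \<in> K" and pos: "W x > 0" by auto
    let ?T = "mean_osc \<epsilon> G x"
    define av where "av = (\<integral>y. ?\<rho> (x - y) *\<^sub>R G y \<partial>lborel)"
    have iav: "integrable lborel (\<lambda>y. ?\<rho> (x - y) *\<^sub>R G y)"
      using integrable_mollifier_scaleR[OF \<epsilon>(1) iG, of x 0] by simp
    have a_eq: "a i x = av \<bullet> i" if "i \<in> Basis" for i
    proof -
      have "a i x = (\<integral>y. (G y \<bullet> i) * ?\<rho> (x - y) \<partial>lborel)"
        unfolding a_def by (rule mollifier_weak_derivatives(1)[OF w \<epsilon>(1) \<epsilon>(2)[OF K] that])
      also have "\<dots> = (\<integral>y. (?\<rho> (x - y) *\<^sub>R G y) \<bullet> i \<partial>lborel)" by (simp add: mult.commute)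
      also have "\<dots> = av \<bullet> i" unfolding av_def using iav by (intro integral_inner_left) auto
      finally show ?thesis .
    qed
    define n where "n = norm (av + g x)"
    have b_eq: "b i x = (av + g x) \<bullet> i" if "i \<in> Basis" for i
      unfolding b_def a_eq[OF that] by (simp add: inner_add_left)
    have n2: "(\<Sum>i\<in>Basis. (b i x)\<^sup>2) = n\<^sup>2"
      unfolding n_def power2_norm_eq_inner
      by (subst euclidean_inner) (simp add: b_eq power2_eq_square)
    have n_ge: "norm (G x) \<le> n + norm (g x) + ?T"
    proof -
      have "norm (G x) \<le> norm av + norm (av - G x)"
        using norm_triangle_sub[of "G x" av] by (simp add: norm_minus_commute)
      moreover have "norm av \<le> n + norm (g x)"
        unfolding n_def using norm_triangle_ineq4[of "av + g x" "g x"] by simp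
      ultimately show ?thesis using mean_osc_bounds(1)[OF \<epsilon>(1) iG, of x] unfolding av_def by linarith
    qed
    have A_ge: "(\<Sum>i\<in>Basis. A i x) \<ge> - \<tau> * (norm (G x) + ?T) - l * mollify \<epsilon> u x"
    proof -
      note t2 = test_function_pderiv[OF test_function_pderiv[OF tf]]
      have "(\<Sum>i\<in>Basis. A i x) = (\<integral>y. u y * (\<Sum>i\<in>Basis. pderiv_dir i (pderiv_dir i ?\<rho>) (x - y)) \<partial>lborel)"
        unfolding A_def sum_distrib_left
        by (rule Bochner_Integration.integral_sum[symmetric]) (rule integrable_convolution_integrand[OF u t2])
      also have "\<dots> = (\<integral>y. L y * ?\<rho> (x - y) \<partial>lborel)"
        by (rule mollifier_weak_derivatives(2)[OF w \<epsilon>(1) \<epsilon>(2)[OF K]])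
      also have "\<dots> \<ge> (\<integral>y. - \<tau> * (norm (G y) * ?\<rho> (x - y)) - l * (u y * ?\<rho> (x - y)) \<partial>lborel)"
      proof (rule integral_mono_AE)
        show "integrable lborel (\<lambda>y. - \<tau> * (norm (G y) * ?\<rho> (x - y)) - l * (u y * ?\<rho> (x - y)))"
          by (intro Bochner_Integration.integrable_diff integrable_mult_right
              integrable_convolution_integrand[OF u tf] integrable_convolution_integrand[OF integrable_norm[OF iG] tf])
        show "integrable lborel (\<lambda>y. L y * ?\<rho> (x - y))"
          by (rule integrable_convolution_integrand[OF iL tf])
        show "AE y in lborel. - \<tau> * (norm (G y) * ?\<rho> (x - y)) - l * (u y * ?\<rho> (x - y)) \<le> L y * ?\<rho> (x - y)"
          using ineq
        proof eventually_elim
          case (elim y)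
          show ?case
          proof (cases "y \<in> \<Omega>")
            case True
            then have "(- \<tau> * norm (G y) - l * u y) * ?\<rho> (x - y) \<le> L y * ?\<rho> (x - y)"
              using elim by (intro mult_right_mono mollifier_nonneg[OF \<epsilon>(1)]) auto
            then show ?thesis by (simp add: algebra_simps)
          next
            case False
            then have "y \<notin> cball x \<epsilon>" using \<epsilon>(2)[OF K] by blast
            then have "?\<rho> (x - y) = 0" by (intro mollifier_zero[OF \<epsilon>(1)]) (simp add: dist_norm)
            then show ?thesis by simp
          qed
        qed
      qed
      also have "(\<integral>y. - \<tau> * (norm (G y) * ?\<rho> (x - y)) - l * (u y * ?\<rho> (x - y)) \<partial>lborel)
          = - \<tau> * (\<integral>y. norm (G y) * ?\<rho> (x - y) \<partial>lborel) - l * mollify \<epsilon> u x"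
        unfolding mollify_def
        using integrable_convolution_integrand[OF u tf, of x]
          integrable_convolution_integrand[OF integrable_norm[OF iG] tf, of x]
        by (subst Bochner_Integration.integral_diff) auto
      finally have "(\<Sum>i\<in>Basis. A i x) \<ge> - \<tau> * (\<integral>y. norm (G y) * ?\<rho> (x - y) \<partial>lborel) - l * mollify \<epsilon> u x" .
      moreover have "\<tau> * (\<integral>y. norm (G y) * ?\<rho> (x - y) \<partial>lborel) \<le> \<tau> * (norm (G x) + ?T)"
        using mean_osc_bounds(2)[OF \<epsilon>(1) iG, of x] \<tau> by (intro mult_left_mono) auto
      ultimately show ?thesis by linarith
    qed
    have lm: "l * mollify \<epsilon> u x \<le> l * u x + c / 4"
    proof -
      have "l * (mollify \<epsilon> u x - u x) \<le> \<bar>l\<bar> * \<bar>mollify \<epsilon> u x - u x\<bar>"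
        by (metis abs_ge_self abs_mult)
      also have "\<dots> \<le> \<bar>l\<bar> * \<theta>" using \<theta>(1)[OF K] by (intro mult_left_mono) auto
      finally show ?thesis using \<theta>(2) by (simp add: algebra_simps)
    qed
    have "\<tau> * norm (G x) \<le> \<tau> * (n + norm (g x) + ?T)" using n_ge \<tau> by (rule mult_left_mono)
    then have S: "(\<Sum>i\<in>Basis. A i x) + (\<Sum>i\<in>Basis. q i x) \<ge> - \<tau> * n - 2 * \<tau> * ?T + 3 * c / 4"
      using A_ge lm super[OF K] by (simp add: algebra_simps)
    \<comment> \<open>Young's inequality with the weight \<open>W x\<close>, because \<open>flat' = flat / t\<^sup>2\<close>.\<close>
    have young: "\<tau> * n \<le> n\<^sup>2 / (W x)\<^sup>2 + c / 4"
    proof -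
      have "0 \<le> (n / W x - \<tau> * W x / 2)\<^sup>2" by simp
      also have "\<dots> = n\<^sup>2 / (W x)\<^sup>2 - \<tau> * n + \<tau>\<^sup>2 * (W x)\<^sup>2 / 4"
        using pos by (simp add: power2_eq_square field_simps)
      finally have "\<tau> * n \<le> n\<^sup>2 / (W x)\<^sup>2 + \<tau>\<^sup>2 * (W x)\<^sup>2 / 4" by simp
      moreover have "\<tau>\<^sup>2 * (W x)\<^sup>2 \<le> \<tau>\<^sup>2 * \<delta>\<^sup>2"
        using pos top(1)[OF K] unfolding W_def by (intro mult_left_mono power_mono) auto
      ultimately show ?thesis using top(2) by linarith
    qed
    have "(\<Sum>i\<in>Basis. F' i x) = flat (W x) * ((\<Sum>i\<in>Basis. A i x) + (\<Sum>i\<in>Basis. q i x) + n\<^sup>2 / (W x)\<^sup>2)"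
      using K unfolding F'_def n2[symmetric]
      by (simp add: sum.distrib sum_distrib_left sum_divide_distrib algebra_simps)
    also have "\<dots> \<ge> flat (W x) * (c / 2 - 2 * \<tau> * ?T)"
      using S young by (intro mult_left_mono flat_bounds(1)) linarith
    finally have "flat (W x) * (c / 2 - 2 * \<tau> * ?T) \<le> (\<Sum>i\<in>Basis. F' i x)" .
    moreover have "flat (W x) * (2 * \<tau> * ?T) \<le> 1 * (2 * \<tau> * ?T)"
      using flat_bounds(2) \<tau> mean_osc_bounds(3)[OF \<epsilon>(1) iG, of x] by (intro mult_right_mono) auto
    ultimately show ?thesis using K by (simp add: algebra_simps)
  qed
  \<comment> \<open>Integrate \<open>main\<close>; the integrals of the \<open>F' i\<close> vanish.\<close>
  note iT = integral_mean_osc[OF \<epsilon>(1) iG e]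
  have "c / 2 * (\<integral>x. indicator K x * flat (W x) \<partial>lborel) = (\<integral>x. c / 2 * (indicator K x * flat (W x)) \<partial>lborel)"
    by simp
  also have "\<dots> \<le> (\<integral>x. (\<Sum>i\<in>Basis. F' i x) + 2 * \<tau> * mean_osc \<epsilon> G x \<partial>lborel)"
  proof (rule integral_mono)
    show "integrable lborel (\<lambda>x. c / 2 * (indicator K x * flat (W x)))" using iZ by (rule integrable_mult_right)
    show "integrable lborel (\<lambda>x. (\<Sum>i\<in>Basis. F' i x) + 2 * \<tau> * mean_osc \<epsilon> G x)"
      using F'_int iT(1)
      by (intro Bochner_Integration.integrable_add Bochner_Integration.integrable_sum integrable_mult_right) auto
  qed (rule main)
  also have "\<dots> = (\<Sum>i\<in>Basis. \<integral>x. F' i x \<partial>lborel) + 2 * \<tau> * (\<integral>x. mean_osc \<epsilon> G x \<partial>lborel)"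
    using F'_int iT(1)
    by (subst Bochner_Integration.integral_add) (auto simp: Bochner_Integration.integral_sum)
  also have "\<dots> \<le> 2 * \<tau> * e"
    using F'_int iT(2) \<tau> by (simp add: mult_left_mono)
  finally show "c / 2 * (\<integral>x. indicator K x * flat (mollify \<epsilon> u x + \<psi> x - s1) \<partial>lborel) \<le> 2 * \<tau> * e"
    unfolding W_def .
qed

lemma integrable_continuous_support:
  fixes u :: "'a::euclidean_space \<Rightarrow> real"
  assumes u: "continuous_on UNIV u" and supp: "\<And>x. x \<notin> cball a R \<Longrightarrow> u x = 0"
  shows "integrable lborel u"
proof -
  have eq: "indicator (cball a R) x *\<^sub>R u x = u x" for x
    using supp[of x] by (cases "x \<in> cball a R") auto
  have "continuous_on (cball a R) u" using continuous_on_subset[OF u] by blast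
  from borel_integrable_compact[OF compact_cball this] show ?thesis unfolding eq .
qed

lemma uniform_limit_mollify:
  fixes u :: "'a::euclidean_space \<Rightarrow> real"
  assumes u: "continuous_on UNIV u" and supp: "\<And>x. x \<notin> cball a R \<Longrightarrow> u x = 0" and "\<theta> > 0"
  obtains \<epsilon>0 where "\<epsilon>0 > 0" "\<And>\<epsilon> x. 0 < \<epsilon> \<Longrightarrow> \<epsilon> < \<epsilon>0 \<Longrightarrow> \<bar>mollify \<epsilon> u x - u x\<bar> \<le> \<theta>"
proof -
  have "uniformly_continuous_on (cball a (R + 1)) u"
    by (rule compact_uniformly_continuous[OF continuous_on_subset[OF u]]) auto
  then obtain d where d: "d > 0" "\<And>x y. x \<in> cball a (R + 1) \<Longrightarrow> y \<in> cball a (R + 1) \<Longrightarrow> dist y x < d \<Longrightarrow> \<bar>u y - u x\<bar> < \<theta>"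
    using \<open>\<theta> > 0\<close> unfolding uniformly_continuous_on_def dist_real_def by metis
  have iu: "integrable lborel u" by (rule integrable_continuous_support[OF u supp])
  show thesis
  proof
    show "min d 1 > 0" using d(1) by simp
    fix \<epsilon> x assume \<epsilon>: "0 < \<epsilon>" "\<epsilon> < min d 1"
    have close: "\<bar>u y - u x\<bar> \<le> \<theta>" if "norm (x - y) \<le> \<epsilon>" for y
    proof (cases "x \<in> cball a R \<or> y \<in> cball a R")
      case True
      have xy: "dist x y \<le> \<epsilon>" using that by (simp add: dist_norm)
      have "dist a x \<le> dist a y + dist x y" "dist a y \<le> dist a x + dist x y"
        by (metis dist_triangle dist_commute)+
      then have "x \<in> cball a (R + 1)" "y \<in> cball a (R + 1)" using True xy \<epsilon> by auto
      from d(2)[OF this] show ?thesis using xy \<epsilon> by (simp add: dist_commute)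
    next
      case False
      then show ?thesis using supp \<open>\<theta> > 0\<close> by simp
    qed
    note i1 = integrable_convolution_integrand[OF iu test_function_mollifier[OF \<epsilon>(1)], of x]
    note i2 = mollifier_shift(1)[OF \<epsilon>(1), of x]
    have "(\<integral>y. u y * mollifier \<epsilon> (x - y) - u x * mollifier \<epsilon> (x - y) \<partial>lborel)
        = (\<integral>y. u y * mollifier \<epsilon> (x - y) \<partial>lborel) - (\<integral>y. u x * mollifier \<epsilon> (x - y) \<partial>lborel)"
      by (rule Bochner_Integration.integral_diff[OF i1 integrable_mult_right[OF i2]])
    then have "mollify \<epsilon> u x - u x = (\<integral>y. u y * mollifier \<epsilon> (x - y) - u x * mollifier \<epsilon> (x - y) \<partial>lborel)"
      unfolding mollify_def by (simp add: mollifier_shift(2)[OF \<epsilon>(1)])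
    also have "\<bar>\<dots>\<bar> \<le> (\<integral>y. \<theta> * mollifier \<epsilon> (x - y) \<partial>lborel)"
    proof (rule integral_abs_bound_integral)
      show "integrable lborel (\<lambda>y. u y * mollifier \<epsilon> (x - y) - u x * mollifier \<epsilon> (x - y))"
        by (rule Bochner_Integration.integrable_diff[OF i1 integrable_mult_right[OF i2]])
      show "integrable lborel (\<lambda>y. \<theta> * mollifier \<epsilon> (x - y))" by (rule integrable_mult_right[OF i2])
      fix y
      show "\<bar>u y * mollifier \<epsilon> (x - y) - u x * mollifier \<epsilon> (x - y)\<bar> \<le> \<theta> * mollifier \<epsilon> (x - y)"
      proof (cases "norm (x - y) \<le> \<epsilon>")
        case True
        have "\<bar>u y * mollifier \<epsilon> (x - y) - u x * mollifier \<epsilon> (x - y)\<bar> = \<bar>u y - u x\<bar> * mollifier \<epsilon> (x - y)"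
          by (simp add: abs_mult mollifier_nonneg[OF \<epsilon>(1)] flip: left_diff_distrib)
        then show ?thesis using close[OF True] by (simp add: mult_right_mono mollifier_nonneg[OF \<epsilon>(1)])
      qed (simp add: mollifier_zero[OF \<epsilon>(1)])
    qed
    also have "\<dots> = \<theta>" by (simp add: mollifier_shift(2)[OF \<epsilon>(1)])
    finally show "\<bar>mollify \<epsilon> u x - u x\<bar> \<le> \<theta>" .
  qed
qed

text \<open>Let \<open>\<Delta>u \<ge> - \<tau> |\<nabla>u| - l u\<close>, and let \<open>- \<psi>\<close> be a strict supersolution on \<open>U\<close> in the sense
  of \<open>super\<close>. Then \<open>u + \<psi>\<close> cannot exceed a level whose superlevel set is compact in \<open>U\<close>.
  Of \<open>u\<close> only continuity, bounded support and an integrable weak gradient and Laplacian are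
  needed.\<close>

lemma maximum_principle:
  fixes \<Omega> U :: "'a::euclidean_space set" and u \<psi> :: "'a \<Rightarrow> real"
    and g :: "'a \<Rightarrow> 'a" and q :: "'a \<Rightarrow> 'a \<Rightarrow> real"
  assumes w: "weak_grad_lap \<Omega> u G L"
    and u: "continuous_on UNIV u" "\<And>x. x \<notin> cball a R \<Longrightarrow> u x = 0"
    and ineq: "AE x in lborel. x \<in> \<Omega> \<longrightarrow> L x \<ge> - \<tau> * norm (G x) - l * u x" and \<tau>: "\<tau> \<ge> 0"
    and U: "open \<Omega>" "open U" "U \<subseteq> \<Omega>"
    and cont: "continuous_on U \<psi>" "continuous_on U g" "\<And>i. i \<in> Basis \<Longrightarrow> continuous_on U (q i)"
    and d\<psi>: "\<And>x i. x \<in> U \<Longrightarrow> i \<in> Basis \<Longrightarrow> has_dir_deriv \<psi> i (g x \<bullet> i) x"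
    and dg: "\<And>x i. x \<in> U \<Longrightarrow> i \<in> Basis \<Longrightarrow> has_dir_deriv (\<lambda>x. g x \<bullet> i) i (q i x) x"
    and super: "\<And>x. x \<in> U \<Longrightarrow> l * u x + \<tau> * norm (g x) - (\<Sum>i\<in>Basis. q i x) \<le> - c" and c: "c > 0"
    and K: "compact {x \<in> U. s0 \<le> u x + \<psi> x}"
    and "x \<in> U"
  shows "u x + \<psi> x \<le> s0"
proof (rule ccontr)
  assume "\<not> u x + \<psi> x \<le> s0"
  let ?K = "{x \<in> U. s0 \<le> u x + \<psi> x}"
  have contw: "continuous_on U (\<lambda>x. u x + \<psi> x)"
    by (intro continuous_on_add continuous_on_subset[OF u(1)] cont(1)) auto
  have "x \<in> ?K" using \<open>x \<in> U\<close> \<open>\<not> u x + \<psi> x \<le> s0\<close> by simp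
  then obtain x0 where x0: "x0 \<in> ?K" "\<And>y. y \<in> ?K \<Longrightarrow> u y + \<psi> y \<le> u x0 + \<psi> x0"
    using continuous_attains_sup[OF K, of "\<lambda>x. u x + \<psi> x"] continuous_on_subset[OF contw, of ?K] by blast
  define M where "M = u x0 + \<psi> x0"
  have M: "M > s0" using x0(2)[OF \<open>x \<in> ?K\<close>] \<open>\<not> u x + \<psi> x \<le> s0\<close> unfolding M_def by linarith
  \<comment> \<open>The truncation level \<open>s1\<close> is \<open>\<delta>\<close> below the maximum: above \<open>s0\<close>, and so close that
      \<open>\<delta>2\<close> holds. The mollification error \<open>\<theta>\<close> is small compared to \<open>\<delta>\<close>.\<close>
  define \<delta> where "\<delta> = min ((M - s0) / 2) (sqrt c / (2 * (\<tau> + 1)))"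
  have \<delta>: "\<delta> > 0" "2 * \<delta> \<le> M - s0"
    using M c \<tau> min.cobounded1[of "(M - s0) / 2" "sqrt c / (2 * (\<tau> + 1))"] unfolding \<delta>_def by auto
  have \<delta>2: "\<tau>\<^sup>2 * (2 * \<delta>)\<^sup>2 \<le> c"
  proof -
    have "2 * \<delta> * (\<tau> + 1) \<le> sqrt c"
      using \<tau> min.cobounded2[of "(M - s0) / 2" "sqrt c / (2 * (\<tau> + 1))"] unfolding \<delta>_def[symmetric]
      by (simp add: field_simps)
    then have "\<tau> * (2 * \<delta>) \<le> sqrt c" using \<delta>(1) by (simp add: algebra_simps)
    then have "(\<tau> * (2 * \<delta>))\<^sup>2 \<le> (sqrt c)\<^sup>2" using \<tau> \<delta>(1) by (intro power_mono) auto
    then show ?thesis using c by (simp add: power_mult_distrib)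
  qed
  define s1 where "s1 = M - \<delta>"
  define \<theta> where "\<theta> = min (\<delta> / 4) (c / (4 * (\<bar>l\<bar> + 1)))"
  have \<theta>: "\<theta> > 0" "\<theta> \<le> \<delta> / 4" using \<delta> c unfolding \<theta>_def by (simp, intro min.cobounded1)
  have \<theta>l: "\<bar>l\<bar> * \<theta> \<le> c / 4"
  proof -
    have "(\<bar>l\<bar> + 1) * \<theta> \<le> c / 4"
      using min.cobounded2[of "\<delta> / 4" "c / (4 * (\<bar>l\<bar> + 1))"] unfolding \<theta>_def[symmetric]
      by (simp add: field_simps)
    then show ?thesis using \<theta>(1) by (simp add: algebra_simps)
  qed
  have KU: "?K \<subseteq> U" "?K \<subseteq> \<Omega>" using U(3) by auto
  obtain \<epsilon>1 where \<epsilon>1: "\<epsilon>1 > 0" "(\<Union>x\<in>?K. cball x \<epsilon>1) \<subseteq> \<Omega>"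
    by (rule compact_subset_open_imp_cball_epsilon_subset[OF K U(1) KU(2)])
  obtain \<epsilon>2 where \<epsilon>2: "\<epsilon>2 > 0" "\<And>\<epsilon> x. 0 < \<epsilon> \<Longrightarrow> \<epsilon> < \<epsilon>2 \<Longrightarrow> \<bar>mollify \<epsilon> u x - u x\<bar> \<le> \<theta>"
    using uniform_limit_mollify[OF u \<theta>(1)] by blast
  have "open {x \<in> U. M - \<delta> / 4 < u x + \<psi> x}"
    using continuous_openin_preimage[OF contw, of UNIV "{M - \<delta> / 4<..}"]
      continuous_open_preimage[OF contw U(2) open_greaterThan[of "M - \<delta> / 4"]]
    by (simp add: vimage_def Int_def)
  moreover have "x0 \<in> {x \<in> U. M - \<delta> / 4 < u x + \<psi> x}" using x0(1) \<delta> by (simp add: M_def)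
  ultimately obtain r where r: "r > 0" "cball x0 r \<subseteq> {x \<in> U. M - \<delta> / 4 < u x + \<psi> x}"
    by (meson open_contains_cball)
  \<comment> \<open>\<open>X\<close> is a lower bound, independent of \<open>\<epsilon>\<close>, for the left-hand side of the energy estimate.\<close>
  define X where "X = c / 2 * (flat (\<delta> / 2) * measure lborel (cball x0 r))"
  have X: "X > 0" unfolding X_def using c \<delta> flat_bounds(3)[of "\<delta> / 2"] content_cball_pos[OF r(1)] by simp
  define e where "e = X / (4 * (\<tau> + 1))"
  have e: "e > 0" unfolding e_def using X \<tau> by simp
  have "integrable lborel G" using w unfolding weak_grad_lap_def by blast
  from tendstoD[OF tendsto_translation_L1[OF this] e]
  obtain d where d: "d > 0" "\<And>h. h \<noteq> 0 \<Longrightarrow> dist h 0 < d \<Longrightarrow> dist (\<integral>x. norm (G (x + h) - G x) \<partial>lborel) 0 < e"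
    unfolding eventually_at by blast
  define \<epsilon> where "\<epsilon> = min \<epsilon>1 (min \<epsilon>2 d) / 2"
  have \<epsilon>: "\<epsilon> > 0" "\<epsilon> < \<epsilon>1" "\<epsilon> < \<epsilon>2" "\<epsilon> < d" using \<epsilon>1(1) \<epsilon>2(1) d(1) unfolding \<epsilon>_def by auto
  have osc: "(\<integral>x. norm (G (x + h) - G x) \<partial>lborel) \<le> e" if "norm h \<le> \<epsilon>" for h
  proof (cases "h = 0")
    case False
    then show ?thesis using d(2)[OF False] that \<epsilon> by (simp add: dist_real_def)
  qed (use e in simp)
  have iu: "integrable lborel u" by (rule integrable_continuous_support[OF u])
  have m: "\<bar>mollify \<epsilon> u y - u y\<bar> \<le> \<theta>" for y using \<epsilon>2(2)[OF \<epsilon>(1,3)] .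
  have off: "mollify \<epsilon> u y + \<psi> y - s1 \<le> 0" if "y \<in> U" "y \<notin> ?K" for y
    using that m[of y] \<theta>(2) \<delta> unfolding s1_def by auto
  have top: "mollify \<epsilon> u y + \<psi> y - s1 \<le> 2 * \<delta>" if "y \<in> ?K" for y
    using x0(2)[OF that] m[of y] \<theta>(2) \<delta> unfolding s1_def M_def by linarith
  have inside: "cball y \<epsilon> \<subseteq> \<Omega>" if "y \<in> ?K" for y
  proof -
    have "cball y \<epsilon> \<subseteq> cball y \<epsilon>1" using \<epsilon>(2) by (intro subset_cball) simp
    then show ?thesis using \<epsilon>1(2) that by blast
  qed
  have super': "l * u y + \<tau> * norm (g y) - (\<Sum>i\<in>Basis. q i y) \<le> - c" if "y \<in> ?K" for y
    using super that by blast
  note est = energy_estimate[OF w iu ineq \<tau> U(2) KU(1) K cont d\<psi> dg super' \<epsilon>(1) inside m \<theta>l off top \<delta>2 less_imp_le[OF e] osc]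
  have "flat (\<delta> / 2) * measure lborel (cball x0 r) = (\<integral>x. flat (\<delta> / 2) * indicator (cball x0 r) x \<partial>lborel)"
    by simp
  also have "\<dots> \<le> (\<integral>x. indicator ?K x * flat (mollify \<epsilon> u x + \<psi> x - s1) \<partial>lborel)"
  proof (rule integral_mono)
    show "integrable lborel (\<lambda>x. flat (\<delta> / 2) * indicator (cball x0 r) x)"
      using integrable_indicator_cball by (rule integrable_mult_right)
    show "integrable lborel (\<lambda>x. indicator ?K x * flat (mollify \<epsilon> u x + \<psi> x - s1))" by (rule est(1))
    fix y
    show "flat (\<delta> / 2) * indicator (cball x0 r) y \<le> indicator ?K y * flat (mollify \<epsilon> u y + \<psi> y - s1)"
    proof (cases "y \<in> cball x0 r")
      case True
      then have y: "y \<in> U" "M - \<delta> / 4 < u y + \<psi> y" using r(2) by auto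
      then have "y \<in> ?K" using \<delta> by simp
      moreover have "\<delta> / 2 \<le> mollify \<epsilon> u y + \<psi> y - s1"
        using y(2) m[of y] \<theta>(2) unfolding s1_def by linarith
      ultimately show ?thesis using True flat_mono[of "\<delta> / 2"] by simp
    qed (simp add: flat_bounds(1))
  qed
  finally have "X \<le> c / 2 * (\<integral>x. indicator ?K x * flat (mollify \<epsilon> u x + \<psi> x - s1) \<partial>lborel)"
    unfolding X_def using c by (intro mult_left_mono) auto
  also have "\<dots> \<le> 2 * \<tau> * e" by (rule est(2))
  also have "\<dots> < X"
    unfolding e_def using X \<tau> by (simp add: field_simps add_pos_nonneg)
  finally show False by simp
qed

section \<open>Radial functions\<close>

text \<open>The regularized distance to \<open>c\<close>; it is smooth for \<open>\<delta> > 0\<close>, and the distance itself for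
  \<open>\<delta> = 0\<close>.\<close>

definition rdist :: "real \<Rightarrow> 'a::euclidean_space \<Rightarrow> 'a \<Rightarrow> real" where
  "rdist \<delta> c x = sqrt ((norm (x - c))\<^sup>2 + \<delta>\<^sup>2)"

lemma rdist_0: "rdist 0 c x = norm (x - c)"
  by (simp add: rdist_def)

lemma rdist_ge:
  assumes "\<delta> \<ge> 0" shows "rdist \<delta> c x \<ge> \<delta>" "rdist \<delta> c x \<ge> norm (x - c)"
  using assms unfolding rdist_def by (auto intro!: real_le_rsqrt)

lemma rdist_sq: "(rdist \<delta> c x)\<^sup>2 = (norm (x - c))\<^sup>2 + \<delta>\<^sup>2"
  by (simp add: rdist_def)

lemma has_dir_deriv_compose:
  assumes "has_dir_deriv f i d x" "(F has_real_derivative D) (at (f x))"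
  shows "has_dir_deriv (\<lambda>x. F (f x)) i (D * d) x"
proof -
  have "(F has_real_derivative D) (at (f (x + 0 *\<^sub>R i)))" using assms(2) by simp
  from DERIV_chain2[OF this assms(1)[unfolded has_dir_deriv_def]]
  show ?thesis unfolding has_dir_deriv_def .
qed

lemma has_dir_deriv_rdist:
  assumes "rdist \<delta> c x > 0" "i \<in> Basis"
  shows "has_dir_deriv (rdist \<delta> c) i ((x - c) \<bullet> i / rdist \<delta> c x) x"
proof -
  have pos: "(norm (x - c))\<^sup>2 + \<delta>\<^sup>2 > 0" using assms(1) unfolding rdist_def by simp
  have n: "(norm (x + t *\<^sub>R i - c))\<^sup>2 = (norm (x - c))\<^sup>2 + 2 * t * ((x - c) \<bullet> i) + t\<^sup>2" for t
  proof -
    have "(norm (y + t *\<^sub>R i))\<^sup>2 = (norm y)\<^sup>2 + 2 * t * (y \<bullet> i) + t\<^sup>2" for y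
      using assms(2) unfolding power2_norm_eq_inner
      by (simp add: inner_add_left inner_add_right inner_commute[of i y] power2_eq_square distrib_left)
    moreover have "x + t *\<^sub>R i - c = (x - c) + t *\<^sub>R i" by simp
    ultimately show ?thesis by (simp only:)
  qed
  let ?f = "\<lambda>t. (norm (x - c))\<^sup>2 + 2 * t * ((x - c) \<bullet> i) + t\<^sup>2 + \<delta>\<^sup>2"
  have f: "(?f has_real_derivative 2 * ((x - c) \<bullet> i)) (at 0)"
    by (auto intro!: derivative_eq_intros)
  have "?f 0 > 0" using pos by simp
  note d = DERIV_chain2[OF DERIV_real_sqrt[OF this] f]
  have "inverse (sqrt (?f 0)) / 2 * (2 * ((x - c) \<bullet> i)) = (x - c) \<bullet> i / rdist \<delta> c x"
    by (simp add: rdist_def inverse_eq_divide)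
  from DERIV_cong[OF d this]
  have "((\<lambda>t. sqrt (?f t)) has_real_derivative (x - c) \<bullet> i / rdist \<delta> c x) (at 0)" .
  then show ?thesis unfolding has_dir_deriv_def rdist_def n .
qed

lemma has_dir_deriv_rdist_grad:
  assumes "rdist \<delta> c x > 0" "i \<in> Basis"
  shows "has_dir_deriv (\<lambda>x. (x - c) \<bullet> i / rdist \<delta> c x) i
           (1 / rdist \<delta> c x - ((x - c) \<bullet> i)\<^sup>2 / (rdist \<delta> c x) ^ 3) x"
proof -
  have 1: "has_dir_deriv (\<lambda>x. (x - c) \<bullet> i) i 1 x"
    unfolding has_dir_deriv_def using assms(2)
    by (auto intro!: derivative_eq_intros simp: inner_add_left inner_diff_left)
  have "((\<lambda>s. 1 / s) has_real_derivative - 1 / (rdist \<delta> c x)\<^sup>2) (at (rdist \<delta> c x))"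
    using assms(1) by (auto intro!: derivative_eq_intros simp: power2_eq_square)
  from has_dir_deriv_mult[OF 1 has_dir_deriv_compose[OF has_dir_deriv_rdist[OF assms] this]]
  show ?thesis using assms(1) by (simp add: power2_eq_square power3_eq_cube field_simps)
qed

lemma sum_rdist_grad_sq:
  assumes "rdist \<delta> c x > 0"
  shows "(\<Sum>i\<in>Basis. ((x - c) \<bullet> i / rdist \<delta> c x)\<^sup>2) = (norm (x - c))\<^sup>2 / (rdist \<delta> c x)\<^sup>2"
proof -
  have "(\<Sum>i\<in>Basis. ((x - c) \<bullet> i)\<^sup>2) = (norm (x - c))\<^sup>2"
    unfolding power2_norm_eq_inner by (subst euclidean_inner) (simp add: power2_eq_square)
  then show ?thesis by (simp add: power_divide flip: sum_divide_distrib)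
qed

lemma laplacian_rdist:
  fixes c x :: "'a::euclidean_space"
  assumes "rdist \<delta> c x > 0"
  shows "(\<Sum>i\<in>Basis. 1 / rdist \<delta> c x - ((x - c) \<bullet> i)\<^sup>2 / (rdist \<delta> c x) ^ 3)
           = DIM('a) / rdist \<delta> c x - (norm (x - c))\<^sup>2 / (rdist \<delta> c x) ^ 3"
proof -
  have "(\<Sum>i\<in>Basis. ((x - c) \<bullet> i)\<^sup>2) = (norm (x - c))\<^sup>2"
    unfolding power2_norm_eq_inner by (subst euclidean_inner) (simp add: power2_eq_square)
  then show ?thesis by (simp add: sum_subtractf flip: sum_divide_distrib)
qed

lemma continuous_rdist: "continuous_on S (rdist \<delta> c)"
  unfolding rdist_def[abs_def] by (intro continuous_intros)

lemma smooth_rdist: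
  assumes "\<delta> > 0"
  shows "smooth (rdist \<delta> c)" "smooth (\<lambda>x. (x - c) \<bullet> a / rdist \<delta> c x)"
proof -
  have pos: "(norm (x - c))\<^sup>2 + \<delta>\<^sup>2 > 0" for x using assms by (intro add_nonneg_pos) auto
  have s: "smooth (\<lambda>x. (norm (x - c))\<^sup>2 + \<delta>\<^sup>2)" by (intro smooth_add smooth_norm2 smooth_const)
  show "smooth (rdist \<delta> c)"
    using smooth_powr[OF s pos, of "1/2"] by (simp add: rdist_def[abs_def] powr_half_sqrt less_imp_le[OF pos])
  have eq: "(x - c) \<bullet> a / rdist \<delta> c x = ((x - c) \<bullet> a) * ((norm (x - c))\<^sup>2 + \<delta>\<^sup>2) powr (- (1/2))" for x
    by (subst divide_inverse) (simp only: rdist_def powr_minus powr_half_sqrt[OF less_imp_le[OF pos]])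
  show "smooth (\<lambda>x. (x - c) \<bullet> a / rdist \<delta> c x)"
    unfolding eq by (rule smooth_mult[OF smooth_inner smooth_powr[OF s pos]])
qed

section \<open>Upper bound for the minimal eigenvalue\<close>

text \<open>The derivative of \<open>flat t / t\<^sup>2\<close>, that is, the second derivative of \<open>flat\<close>.\<close>

definition flat2 :: "real \<Rightarrow> real" where
  "flat2 t = flat t * (1 / t ^ 4 - 2 / t ^ 3)"

lemma flat2_deriv: "((\<lambda>t. flat t / t\<^sup>2) has_real_derivative flat2 t) (at t)"
proof -
  have "(\<lambda>t. flat t / t\<^sup>2) = flat_poly [:0, 0, 1:]"
    by (auto simp: fun_eq_iff flat_def flat_poly_def power2_eq_square)
  moreover have "flat_poly (([:0, 0, 1:] - pderiv [:0, 0, 1:]) * [:0, 0, 1:]) t = flat2 t"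
    by (auto simp: flat2_def flat_def flat_poly_def pderiv_pCons field_simps power4_eq_xxxx power3_eq_cube)
  ultimately show ?thesis using flat_poly_has_derivative[of "[:0, 0, 1:]" t] by simp
qed

text \<open>\<open>flat\<close> is convex on \<open>{..1/2}\<close>.\<close>

lemma flat2_nonneg: "t \<le> 1/2 \<Longrightarrow> flat2 t \<ge> 0"
proof (cases "t \<le> 0")
  case False
  assume "t \<le> 1/2"
  have "1 / t ^ 4 - 2 / t ^ 3 = (1 - 2 * t) / t ^ 4"
    using False by (simp add: field_simps power4_eq_xxxx power3_eq_cube)
  then show ?thesis using \<open>t \<le> 1/2\<close> False unfolding flat2_def
    by (intro mult_nonneg_nonneg flat_bounds(1)) auto
qed (simp add: flat2_def flat_bounds(4))

text \<open>The radial profile of the test function is \<open>m F(w)\<close>. Here \<open>m = exp(- \<tau> s)\<close> is the weight,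
  \<open>w = 1 - exp(k (s - P))\<close> solves \<open>w'' = k w'\<close> and is positive for \<open>s < P\<close>, and \<open>F(w) = flat (w / 2)\<close>
  is convex in the relevant range \<open>w < 1\<close>; composing with \<open>F\<close> makes the extension by zero beyond
  \<open>s = P\<close> smooth and keeps \<open>w\<close> a subsolution.\<close>

definition profile :: "real \<Rightarrow> real \<Rightarrow> real \<Rightarrow> real \<Rightarrow> real" where
  "profile \<tau> k P s = exp (- \<tau> * s) * flat ((1 - exp (k * (s - P))) / 2)"

text \<open>The flux \<open>m (F(w))'\<close>; it appears in the weighted operator, in divergence form.\<close>

definition flux :: "real \<Rightarrow> real \<Rightarrow> real \<Rightarrow> real \<Rightarrow> real" where
  "flux \<tau> k P s = - (k / 2) * (exp (- \<tau> * s) * exp (k * (s - P))) *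
     (flat ((1 - exp (k * (s - P))) / 2) / ((1 - exp (k * (s - P))) / 2)\<^sup>2)"

lemma profile_deriv:
  "(profile \<tau> k P has_real_derivative (flux \<tau> k P s - \<tau> * profile \<tau> k P s)) (at s)"
proof -
  let ?u = "\<lambda>s. (1 - exp (k * (s - P))) / 2"
  have u: "(?u has_real_derivative - (k / 2) * exp (k * (s - P))) (at s)"
    by (auto intro!: derivative_eq_intros)
  have f: "((\<lambda>s. flat (?u s)) has_real_derivative
      flat (?u s) / (?u s)\<^sup>2 * (- (k / 2) * exp (k * (s - P)))) (at s)"
    by (rule DERIV_chain2[OF flat_has_derivative u])
  have e: "((\<lambda>s. exp (- \<tau> * s)) has_real_derivative - \<tau> * exp (- \<tau> * s)) (at s)"
    by (auto intro!: derivative_eq_intros)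
  have eq: "- \<tau> * a * b + Q * (- (k / 2) * X) * a = - (k / 2) * (a * X) * Q - \<tau> * (a * b)" for a b Q X :: real
    by (simp add: algebra_simps)
  show ?thesis
    unfolding profile_def[abs_def] flux_def by (rule DERIV_cong[OF DERIV_mult[OF e f] eq])
qed

lemma flux_deriv:
  "(flux \<tau> k P has_real_derivative ((k - \<tau>) * flux \<tau> k P s + (k / 2)\<^sup>2 *
     (exp (- \<tau> * s) * exp (k * (s - P)) * exp (k * (s - P)) * flat2 ((1 - exp (k * (s - P))) / 2)))) (at s)"
proof -
  define E where "E s = exp (- \<tau> * s) * exp (k * (s - P))" for s
  define u where "u s = (1 - exp (k * (s - P))) / 2" for s
  have u: "(u has_real_derivative - (k / 2) * exp (k * (s - P))) (at s)"
    unfolding u_def[abs_def] by (auto intro!: derivative_eq_intros)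
  have f: "((\<lambda>s. flat (u s) / (u s)\<^sup>2) has_real_derivative flat2 (u s) * (- (k / 2) * exp (k * (s - P)))) (at s)"
    by (rule DERIV_chain2[OF flat2_deriv u])
  have e: "(E has_real_derivative (k - \<tau>) * E s) (at s)"
    unfolding E_def[abs_def] by (auto intro!: derivative_eq_intros simp: algebra_simps)
  have fl: "flux \<tau> k P = (\<lambda>s. - (k / 2) * (E s * (flat (u s) / (u s)\<^sup>2)))"
    unfolding flux_def[abs_def] E_def u_def by (simp add: mult.assoc)
  have eq: "- (k / 2) * ((k - \<tau>) * a * Q + f2 * (- (k / 2) * X) * a)
      = (k - \<tau>) * (- (k / 2) * (a * Q)) + (k / 2)\<^sup>2 * (a * X * f2)" for a Q f2 X :: real
    by (simp add: field_simps power2_eq_square)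
  have "(flux \<tau> k P has_real_derivative
     ((k - \<tau>) * flux \<tau> k P s + (k / 2)\<^sup>2 * (E s * exp (k * (s - P)) * flat2 (u s)))) (at s)"
    unfolding fl by (rule DERIV_cong[OF DERIV_cmult[OF DERIV_mult[OF e f], of "- (k / 2)"] eq])
  then show ?thesis unfolding E_def u_def .
qed

lemma integral_pos_of_continuous:
  fixes f :: "'a::euclidean_space \<Rightarrow> real"
  assumes "continuous_on UNIV f" "integrable lborel f" "\<And>x. f x \<ge> 0" "f c > 0"
  shows "(\<integral>x. f x \<partial>lborel) > 0"
proof -
  have "open (f -` {f c / 2<..})"
    by (rule open_vimage[OF open_greaterThan assms(1)])
  moreover have "c \<in> f -` {f c / 2<..}" using assms(4) by simp
  ultimately obtain r where r: "r > 0" "cball c r \<subseteq> f -` {f c / 2<..}"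
    by (meson open_contains_cball)
  have "0 < f c / 2 * measure lborel (cball c r)"
    using assms(4) content_cball_pos[OF r(1)] by simp
  also have "\<dots> = (\<integral>x. f c / 2 * indicator (cball c r) x \<partial>lborel)" by simp
  also have "\<dots> \<le> (\<integral>x. f x \<partial>lborel)"
  proof (rule integral_mono)
    show "integrable lborel (\<lambda>x. f c / 2 * indicator (cball c r) x)"
      using integrable_indicator_cball by (rule integrable_mult_right)
    fix x show "f c / 2 * indicator (cball c r) x \<le> f x"
      using r(2) assms(3)[of x] by (cases "x \<in> cball c r") (auto simp: subset_iff less_imp_le simp del: mem_cball)
  qed (rule assms(2))
  finally show ?thesis .
qed

text \<open>The drift pushing radially towards \<open>c\<close> with strength at most \<open>\<tau>\<close> keeps the diffusion near
  \<open>c\<close> for a long time, so its principal eigenvalue is exponentially small. The operator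
  is symmetric with respect to the weight \<open>exp (- \<tau> rdist)\<close>; testing the equation with weight times
  subsolution gives the bound.\<close>

lemma eigenvalue_upper_bound:
  fixes \<Omega> :: "'a::euclidean_space set"
  assumes "open \<Omega>" and pe: "principal_eigenfunction \<Omega> (\<lambda>x. (\<tau> / rdist \<delta> c x) *\<^sub>R (x - c)) l \<phi>"
    and c: "cball c P \<subseteq> \<Omega>" "\<delta> > 0" "\<delta> < P"
    and k: "k > 0" "k + DIM('a) / \<delta> \<le> \<tau>" "exp (k * (2 * \<delta> - P)) \<le> 1 / 2"
  shows "l \<le> 8 * k * (DIM('a) / \<delta>) * exp (k * (2 * \<delta> - P))"
proof -
  let ?p = "rdist \<delta> c" and ?n = "real DIM('a)"
  let ?dp = "\<lambda>i x. (x - c) \<bullet> i / ?p x"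
  let ?ddp = "\<lambda>i x. 1 / ?p x - ((x - c) \<bullet> i)\<^sup>2 / (?p x) ^ 3"
  let ?H = "flux \<tau> k P"
  define H' where "H' s = (k - \<tau>) * ?H s + (k / 2)\<^sup>2 *
      (exp (- \<tau> * s) * exp (k * (s - P)) * exp (k * (s - P)) * flat2 ((1 - exp (k * (s - P))) / 2))" for s
  define \<xi> where "\<xi> x = profile \<tau> k P (?p x)" for x
  define \<eta> where "\<eta> i x = \<tau> * ?dp i x * \<xi> x" for i x
  define \<mu> where "\<mu> = 8 * k * (?n / \<delta>) * exp (k * (2 * \<delta> - P))"
  let ?u = "zero_ext \<Omega> \<phi>"
  obtain G L where w: "weak_grad_lap \<Omega> ?u G L"
    and ae: "AE x in lborel. x \<in> \<Omega> \<longrightarrow> L x = ((\<tau> / ?p x) *\<^sub>R (x - c)) \<bullet> G x - l * \<phi> x"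
    by (rule principal_eigenfunction_weak_grad_lap[OF \<open>open \<Omega>\<close> pe])
  have iG: "integrable lborel G" using w unfolding weak_grad_lap_def by blast
  have ucont: "continuous_on UNIV ?u"
    using continuous_zero_ext[OF \<open>open \<Omega>\<close>] pe unfolding principal_eigenfunction_def by blast
  have ppos: "?p x > 0" and pge: "?p x \<ge> \<delta>" for x
    using rdist_ge(1)[of \<delta> c x] c(2) by auto
  have sm: "smooth \<xi>"
  proof -
    have "smooth (\<lambda>x. exp ((- \<tau>) * ?p x) * flat ((1/2) * (1 - exp (k * (?p x - P)))))"
      by (intro smooth_mult smooth_exp smooth_flat smooth_diff smooth_const smooth_rdist(1)[OF c(2)])
    then show ?thesis unfolding \<xi>_def[abs_def] profile_def by simp
  qed
  have tx: "test_function \<Omega> \<xi>"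
  proof (rule test_functionI[OF sm compact_cball c(1)])
    fix x assume "x \<notin> cball c P"
    then have "norm (x - c) > P" by (simp add: dist_norm norm_minus_commute)
    then have "?p x > P" using rdist_ge(2)[OF less_imp_le[OF c(2)], of x c] by linarith
    then have "1 \<le> exp (k * (?p x - P))" using k(1) by simp
    then show "\<xi> x = 0" unfolding \<xi>_def profile_def by (simp add: flat_bounds(4))
  qed
  have te: "test_function \<Omega> (\<eta> i)" for i
  proof -
    have "smooth (\<lambda>x. \<tau> * ?dp i x)" by (intro smooth_mult smooth_const smooth_rdist(2)[OF c(2)])
    from test_function_mult[OF tx this] show ?thesis unfolding \<eta>_def[abs_def] .
  qed
  have d1: "pderiv_dir i \<xi> x = ?H (?p x) * ?dp i x - \<eta> i x" if i: "i \<in> Basis" for i x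
  proof -
    have "has_dir_deriv \<xi> i ((?H (?p x) - \<tau> * profile \<tau> k P (?p x)) * ?dp i x) x"
      unfolding \<xi>_def[abs_def]
      by (rule has_dir_deriv_compose[OF has_dir_deriv_rdist[OF ppos i] profile_deriv])
    from has_dir_deriv_unique[OF differentiable_imp_dir_deriv[OF smooth_differentiable[OF sm]] this]
    show ?thesis by (simp add: \<eta>_def \<xi>_def algebra_simps)
  qed
  have d2: "pderiv_dir i (pderiv_dir i \<xi>) x + pderiv_dir i (\<eta> i) x
      = H' (?p x) * (?dp i x)\<^sup>2 + ?H (?p x) * ?ddp i x" if i: "i \<in> Basis" for i x
  proof -
    have "has_dir_deriv (\<lambda>x. pderiv_dir i \<xi> x + \<eta> i x) i
        (pderiv_dir i (pderiv_dir i \<xi>) x + pderiv_dir i (\<eta> i) x) x"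
      using test_function_smooth[OF test_function_pderiv[OF tx i]] test_function_smooth[OF te[of i]]
      by (intro has_dir_deriv_add differentiable_imp_dir_deriv smooth_differentiable)
    then have "has_dir_deriv (\<lambda>x. ?H (?p x) * ?dp i x) i
        (pderiv_dir i (pderiv_dir i \<xi>) x + pderiv_dir i (\<eta> i) x) x"
      by (simp add: d1[OF i])
    from has_dir_deriv_unique[OF this has_dir_deriv_mult[OF has_dir_deriv_compose[OF
          has_dir_deriv_rdist[OF ppos i] flux_deriv] has_dir_deriv_rdist_grad[OF ppos i]]]
    show ?thesis unfolding H'_def power2_eq_square by (simp only: mult_ac)
  qed
  define S where "S x = (\<Sum>i\<in>Basis. pderiv_dir i (pderiv_dir i \<xi>) x + pderiv_dir i (\<eta> i) x)" for x
  \<comment> \<open>The subsolution property. For \<open>rdist \<ge> 2 \<delta>\<close> the slack \<open>\<tau> - k\<close> dominates the Laplacian of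
      \<open>rdist\<close> and \<open>- S \<le> 0\<close>; near the centre the factor \<open>exp (k (s - P))\<close> is small.\<close>
  have S_ge: "- S x \<le> \<mu> * \<xi> x" for x
  proof -
    define s where "s = ?p x"
    define X where "X = exp (k * (s - P))"
    define t where "t = (1 - X) / 2"
    define \<beta> where "\<beta> = (norm (x - c))\<^sup>2 / s\<^sup>2"
    define \<Lambda> where "\<Lambda> = ?n / s - (norm (x - c))\<^sup>2 / s ^ 3"
    have s: "s \<ge> \<delta>" "s > 0" using pge ppos unfolding s_def by auto
    have \<beta>: "\<beta> \<ge> 0" unfolding \<beta>_def by simp
    have X: "X > 0" unfolding X_def by simp
    have Sx: "S x = H' s * \<beta> + ?H s * \<Lambda>"
      unfolding S_def s_def \<beta>_def \<Lambda>_def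
      by (simp add: d2 sum.distrib laplacian_rdist[OF ppos] sum_rdist_grad_sq[OF ppos]
          flip: sum_distrib_left)
    have fl: "?H s = - (k / 2) * (exp (- \<tau> * s) * X) * (flat t / t\<^sup>2)"
      unfolding flux_def X_def t_def ..
    have H': "H' s \<ge> (k - \<tau>) * ?H s"
    proof -
      have "0 \<le> (k / 2)\<^sup>2 * (exp (- \<tau> * s) * X * X * flat2 t)"
        using X flat2_nonneg[of t] by (intro mult_nonneg_nonneg) (auto simp: t_def)
      then show ?thesis unfolding H'_def X_def[symmetric] t_def[symmetric] by simp
    qed
    have "S x \<ge> (k - \<tau>) * ?H s * \<beta> + ?H s * \<Lambda>"
      unfolding Sx using mult_right_mono[OF H' \<beta>] by simp
    then have 1: "- S x \<le> (k / 2) * (exp (- \<tau> * s) * X) * (flat t / t\<^sup>2) * (\<Lambda> - (\<tau> - k) * \<beta>)"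
    proof -
      have eq: "- ((k - \<tau>) * (- (k / 2) * A * Q) * \<beta> + (- (k / 2) * A * Q) * \<Lambda>)
          = (k / 2) * A * Q * (\<Lambda> - (\<tau> - k) * \<beta>)" for A Q
        by (simp add: field_simps)
      have "- S x \<le> - ((k - \<tau>) * ?H s * \<beta> + ?H s * \<Lambda>)"
        using \<open>S x \<ge> (k - \<tau>) * ?H s * \<beta> + ?H s * \<Lambda>\<close> by linarith
      then show ?thesis unfolding fl eq .
    qed
    have \<Lambda>: "\<Lambda> \<le> ?n / s" unfolding \<Lambda>_def using s by simp
    have pre: "(k / 2) * (exp (- \<tau> * s) * X) * (flat t / t\<^sup>2) \<ge> 0"
      using k(1) X flat_deriv_bound(1)[of t] by (intro mult_nonneg_nonneg) auto
    have xi: "\<xi> x = exp (- \<tau> * s) * flat t" unfolding \<xi>_def profile_def s_def[symmetric] t_def X_def ..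
    have xi0: "\<xi> x \<ge> 0" unfolding xi using flat_bounds(1) by simp
    have \<mu>: "\<mu> \<ge> 0" unfolding \<mu>_def using k c by simp
    have a: "\<tau> - k \<ge> ?n / \<delta>" "?n / \<delta> \<ge> 0" using k(2) c(2) by auto
    show ?thesis
    proof (cases "s \<ge> 2 * \<delta>")
      case True
      have "\<beta> = 1 - \<delta>\<^sup>2 / s\<^sup>2"
      proof -
        have "(norm (x - c))\<^sup>2 = s\<^sup>2 - \<delta>\<^sup>2" using rdist_sq[of \<delta> c x] unfolding s_def by simp
        then show ?thesis using s unfolding \<beta>_def by (simp add: diff_divide_distrib)
      qed
      moreover have "\<delta>\<^sup>2 / s\<^sup>2 \<le> 1 / 4"
      proof -
        have "(2 * \<delta>)\<^sup>2 \<le> s\<^sup>2" using True c(2) by (intro power_mono) auto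
        then show ?thesis using s by (simp add: divide_le_eq power_mult_distrib)
      qed
      ultimately have "\<beta> \<ge> 1 / 2" by linarith
      then have "?n / \<delta> * (1 / 2) \<le> (\<tau> - k) * \<beta>" using a by (intro mult_mono) auto
      moreover have "?n / s \<le> ?n / (2 * \<delta>)" using True c(2) by (intro divide_left_mono) auto
      ultimately have "\<Lambda> - (\<tau> - k) * \<beta> \<le> 0" using \<Lambda> by simp
      from mult_nonneg_nonpos[OF pre this] show ?thesis
        using 1 mult_nonneg_nonneg[OF \<mu> xi0] by linarith
    next
      case False
      have "\<Lambda> - (\<tau> - k) * \<beta> \<le> ?n / \<delta>"
      proof -
        have "?n / s \<le> ?n / \<delta>" using s c(2) by (intro divide_left_mono) auto
        moreover have "(\<tau> - k) * \<beta> \<ge> 0" using a \<beta> by (intro mult_nonneg_nonneg) auto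
        ultimately show ?thesis using \<Lambda> by linarith
      qed
      from order.trans[OF 1 mult_left_mono[OF this pre]]
      have 2: "- S x \<le> (k / 2) * (exp (- \<tau> * s) * X) * (flat t / t\<^sup>2) * (?n / \<delta>)" .
      have Xle: "X \<le> exp (k * (2 * \<delta> - P))" unfolding X_def using False k(1) by simp
      then have "t \<ge> 1 / 4" unfolding t_def using k(3) by simp
      then have "(1 / 4)\<^sup>2 \<le> t\<^sup>2" by (intro power_mono) auto
      then have "flat t / t\<^sup>2 \<le> flat t / (1 / 4)\<^sup>2"
        using flat_bounds(1) \<open>t \<ge> 1 / 4\<close> by (intro divide_left_mono mult_pos_pos zero_less_power) auto
      then have "flat t / t\<^sup>2 \<le> 16 * flat t" by (simp add: power2_eq_square)
      then have "X * (flat t / t\<^sup>2) \<le> exp (k * (2 * \<delta> - P)) * (16 * flat t)"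
        using Xle X flat_deriv_bound(1)[of t] by (intro mult_mono) auto
      then have "((k / 2) * (?n / \<delta>) * exp (- \<tau> * s)) * (X * (flat t / t\<^sup>2))
          \<le> ((k / 2) * (?n / \<delta>) * exp (- \<tau> * s)) * (exp (k * (2 * \<delta> - P)) * (16 * flat t))"
        using k(1) c(2) by (intro mult_left_mono) auto
      then show ?thesis using 2 unfolding \<mu>_def xi by (simp add: algebra_simps)
    qed
  qed
  have u0: "?u x \<ge> 0" for x
    using pe unfolding principal_eigenfunction_def zero_ext_def by (auto intro: less_imp_le)
  have xi_nonneg: "\<xi> x \<ge> 0" for x unfolding \<xi>_def profile_def using flat_bounds(1) by simp
  have iux: "integrable lborel (\<lambda>x. ?u x * \<xi> x)" by (rule test_function_integrable_mult[OF tx ucont])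
  have i2: "integrable lborel (\<lambda>x. ?u x * pderiv_dir i (pderiv_dir i \<xi>) x)"
    "integrable lborel (\<lambda>x. ?u x * pderiv_dir i (\<eta> i) x)" if "i \<in> Basis" for i
    by (rule test_function_integrable_mult[OF test_function_pderiv[OF test_function_pderiv[OF tx that] that] ucont]
             test_function_integrable_mult[OF test_function_pderiv[OF te that] ucont])+
  have iS: "integrable lborel (\<lambda>x. ?u x * S x)"
    unfolding S_def sum_distrib_left distrib_left
    by (intro Bochner_Integration.integrable_sum Bochner_Integration.integrable_add i2)
  have iGe: "integrable lborel (\<lambda>x. (G x \<bullet> i) * \<eta> i x)" for i
    by (rule integrable_mult_test_function[OF te]) (intro integrable_inner_left iG)
  have "(\<integral>x. L x * \<xi> x \<partial>lborel) = (\<integral>x. (\<Sum>i\<in>Basis. (G x \<bullet> i) * \<eta> i x) - l * (?u x * \<xi> x) \<partial>lborel)"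
  proof (rule integral_cong_AE)
    have "integrable lborel (\<lambda>x. L x * \<xi> x)"
      using w unfolding weak_grad_lap_def by (intro integrable_mult_test_function[OF tx]) blast
    then show "(\<lambda>x. L x * \<xi> x) \<in> borel_measurable lborel" by (rule borel_measurable_integrable)
    have "integrable lborel (\<lambda>x. (\<Sum>i\<in>Basis. (G x \<bullet> i) * \<eta> i x) - l * (?u x * \<xi> x))"
      by (intro Bochner_Integration.integrable_diff Bochner_Integration.integrable_sum iGe integrable_mult_right iux)
    then show "(\<lambda>x. (\<Sum>i\<in>Basis. (G x \<bullet> i) * \<eta> i x) - l * (?u x * \<xi> x)) \<in> borel_measurable lborel"
      by (rule borel_measurable_integrable)
    show "AE x in lborel. L x * \<xi> x = (\<Sum>i\<in>Basis. (G x \<bullet> i) * \<eta> i x) - l * (?u x * \<xi> x)"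
      using ae
    proof eventually_elim
      case (elim x)
      show ?case
      proof (cases "x \<in> \<Omega>")
        case True
        have "(x - c) \<bullet> G x = (\<Sum>i\<in>Basis. ((x - c) \<bullet> i) * (G x \<bullet> i))" by (rule euclidean_inner)
        then have "((\<tau> / ?p x) *\<^sub>R (x - c)) \<bullet> G x * \<xi> x = (\<Sum>i\<in>Basis. (G x \<bullet> i) * \<eta> i x)"
          by (simp add: \<eta>_def sum_distrib_left sum_distrib_right mult_ac)
        then show ?thesis using True elim by (simp add: zero_ext_def left_diff_distrib)
      next
        case False
        then show ?thesis using test_function_zero[OF tx False] test_function_zero[OF te False] by simp
      qed
    qed
  qed
  also have "\<dots> = (\<Sum>i\<in>Basis. \<integral>x. (G x \<bullet> i) * \<eta> i x \<partial>lborel) - l * (\<integral>x. ?u x * \<xi> x \<partial>lborel)"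
    using iGe iux by (simp add: Bochner_Integration.integral_sum)
  finally have Lxi: "(\<integral>x. L x * \<xi> x \<partial>lborel)
      = (\<Sum>i\<in>Basis. \<integral>x. (G x \<bullet> i) * \<eta> i x \<partial>lborel) - l * (\<integral>x. ?u x * \<xi> x \<partial>lborel)" .
  have "(\<integral>x. ?u x * S x \<partial>lborel)
      = (\<integral>x. ?u x * (\<Sum>i\<in>Basis. pderiv_dir i (pderiv_dir i \<xi>) x) \<partial>lborel)
        + (\<Sum>i\<in>Basis. \<integral>x. ?u x * pderiv_dir i (\<eta> i) x \<partial>lborel)"
    unfolding S_def sum_distrib_left distrib_left sum.distrib using i2
    by (subst Bochner_Integration.integral_add) (auto simp: Bochner_Integration.integral_sum)
  also have "\<dots> = - l * (\<integral>x. ?u x * \<xi> x \<partial>lborel)"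
  proof -
    have "(\<integral>x. ?u x * (\<Sum>i\<in>Basis. pderiv_dir i (pderiv_dir i \<xi>) x) \<partial>lborel) = (\<integral>x. L x * \<xi> x \<partial>lborel)"
      using w tx unfolding weak_grad_lap_def by blast
    moreover have "(\<Sum>i\<in>Basis. \<integral>x. ?u x * pderiv_dir i (\<eta> i) x \<partial>lborel)
        = (\<Sum>i\<in>Basis. - (\<integral>x. (G x \<bullet> i) * \<eta> i x \<partial>lborel))"
      using w te unfolding weak_grad_lap_def by (intro sum.cong) blast+
    ultimately show ?thesis using Lxi by (simp add: sum_negf)
  qed
  finally have "l * (\<integral>x. ?u x * \<xi> x \<partial>lborel) = (\<integral>x. - (?u x * S x) \<partial>lborel)"
    by simp
  also have "\<dots> \<le> (\<integral>x. \<mu> * (?u x * \<xi> x) \<partial>lborel)"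
  proof (rule integral_mono)
    fix x
    have "?u x * (- S x) \<le> ?u x * (\<mu> * \<xi> x)" by (rule mult_left_mono[OF S_ge u0])
    then show "- (?u x * S x) \<le> \<mu> * (?u x * \<xi> x)" by (simp add: algebra_simps)
  qed (use iS iux in auto)
  finally have le: "l * (\<integral>x. ?u x * \<xi> x \<partial>lborel) \<le> \<mu> * (\<integral>x. ?u x * \<xi> x \<partial>lborel)" by simp
  have "(\<integral>x. ?u x * \<xi> x \<partial>lborel) > 0"
  proof (rule integral_pos_of_continuous[OF _ iux, where c=c])
    show "continuous_on UNIV (\<lambda>x. ?u x * \<xi> x)"
      by (intro continuous_on_mult ucont smooth_continuous sm)
    show "?u x * \<xi> x \<ge> 0" for x using u0 xi_nonneg by simp
    have "c \<in> \<Omega>" using c by auto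
    then have "?u c > 0" using pe unfolding principal_eigenfunction_def zero_ext_def by auto
    moreover have "?p c = \<delta>" using c(2) by (simp add: rdist_def)
    then have "\<xi> c > 0"
      unfolding \<xi>_def profile_def using k(1) c(3) by (intro mult_pos_pos flat_bounds(3)) (auto simp: mult_pos_neg)
    ultimately show "?u c * \<xi> c > 0" by simp
  qed
  from mult_right_le_imp_le[OF le this] show ?thesis unfolding \<mu>_def .
qed

section \<open>Consequences of the maximum principle for eigenfunctions\<close>

lemma eigenfunction_differential_inequality:
  fixes \<Omega> :: "'a::euclidean_space set"
  assumes "open \<Omega>" and pe: "principal_eigenfunction \<Omega> v l \<phi>" and v: "Linf_norm \<Omega> v \<le> ereal \<tau>"
  obtains G L where "weak_grad_lap \<Omega> (zero_ext \<Omega> \<phi>) G L"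
    "AE x in lborel. x \<in> \<Omega> \<longrightarrow> L x \<ge> - \<tau> * norm (G x) - l * zero_ext \<Omega> \<phi> x"
proof -
  obtain G L where w: "weak_grad_lap \<Omega> (zero_ext \<Omega> \<phi>) G L"
    and ae: "AE x in lborel. x \<in> \<Omega> \<longrightarrow> L x = v x \<bullet> G x - l * \<phi> x"
    by (rule principal_eigenfunction_weak_grad_lap[OF \<open>open \<Omega>\<close> pe])
  have \<Omega>m: "\<Omega> \<in> sets lebesgue" using \<open>open \<Omega>\<close> by (simp add: borel_open)
  have "AE x in lebesgue_on \<Omega>. ereal (norm (v x)) \<le> Linf_norm \<Omega> v"
    unfolding Linf_norm_def by (rule esssup_AE)
  then have "AE x in lebesgue_on \<Omega>. norm (v x) \<le> \<tau>"
  proof eventually_elim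
    case (elim x)
    from order.trans[OF elim v] show ?case by simp
  qed
  then have vb: "AE x in lborel. x \<in> \<Omega> \<longrightarrow> norm (v x) \<le> \<tau>"
    using \<Omega>m by (subst (asm) AE_restrict_space_iff) (auto simp: AE_completion_iff)
  have "AE x in lborel. x \<in> \<Omega> \<longrightarrow> L x \<ge> - \<tau> * norm (G x) - l * zero_ext \<Omega> \<phi> x"
    using ae vb
  proof eventually_elim
    case (elim x)
    show ?case
    proof
      assume x: "x \<in> \<Omega>"
      have "\<bar>v x \<bullet> G x\<bar> \<le> norm (v x) * norm (G x)" by (rule Cauchy_Schwarz_ineq2)
      also have "\<dots> \<le> \<tau> * norm (G x)" using elim(2) x by (intro mult_right_mono) auto
      finally show "L x \<ge> - \<tau> * norm (G x) - l * zero_ext \<Omega> \<phi> x"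
        using elim(1) x by (simp add: zero_ext_def)
    qed
  qed
  with w show thesis by (rule that)
qed

lemma eigenfunction_zero_ext:
  fixes \<Omega> :: "'a::euclidean_space set"
  assumes "open \<Omega>" "bounded \<Omega>" and pe: "principal_eigenfunction \<Omega> v l \<phi>"
  obtains R where "continuous_on UNIV (zero_ext \<Omega> \<phi>)" "\<And>x. x \<notin> cball 0 R \<Longrightarrow> zero_ext \<Omega> \<phi> x = 0"
proof -
  obtain R where "\<forall>x\<in>\<Omega>. norm x \<le> R" using \<open>bounded \<Omega>\<close> unfolding bounded_iff by blast
  then have "zero_ext \<Omega> \<phi> x = 0" if "x \<notin> cball 0 R" for x
    using that by (auto simp: zero_ext_def)
  moreover have "continuous_on UNIV (zero_ext \<Omega> \<phi>)"
    using continuous_zero_ext[OF \<open>open \<Omega>\<close>] pe unfolding principal_eigenfunction_def by blast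
  ultimately show thesis using that by blast
qed

text \<open>If \<open>l < 0\<close>, then \<open>\<phi>\<close> would satisfy a strict inequality near its maximum.\<close>

lemma principal_eigenvalue_nonneg:
  fixes \<Omega> :: "'a::euclidean_space set"
  assumes \<Omega>: "open \<Omega>" "bounded \<Omega>" "y \<in> \<Omega>" and pe: "principal_eigenfunction \<Omega> v l \<phi>"
    and v: "Linf_norm \<Omega> v \<le> ereal \<tau>" and \<tau>: "\<tau> \<ge> 0"
  shows "l \<ge> 0"
proof (rule ccontr)
  assume "\<not> l \<ge> 0"
  then have l: "l < 0" by simp
  let ?u = "zero_ext \<Omega> \<phi>"
  obtain G L where w: "weak_grad_lap \<Omega> ?u G L"
    and ineq: "AE x in lborel. x \<in> \<Omega> \<longrightarrow> L x \<ge> - \<tau> * norm (G x) - l * ?u x"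
    by (rule eigenfunction_differential_inequality[OF \<Omega>(1) pe v])
  obtain R where u: "continuous_on UNIV ?u" "\<And>x. x \<notin> cball 0 R \<Longrightarrow> ?u x = 0"
    by (rule eigenfunction_zero_ext[OF \<Omega>(1,2) pe]) blast
  define M where "M = \<phi> y"
  have M: "M > 0" "?u y = M" using pe \<Omega>(3) unfolding M_def principal_eigenfunction_def zero_ext_def by auto
  define U where "U = {x. M / 3 < ?u x}"
  have U: "open U" unfolding U_def using open_Collect_less[OF continuous_on_const u(1)] .
  have "U \<subseteq> \<Omega>" using M(1) unfolding U_def zero_ext_def by (auto split: if_splits)
  have K: "compact {x \<in> U. M / 2 \<le> ?u x + 0}"
  proof -
    have "{x \<in> U. M / 2 \<le> ?u x + 0} = {x. M / 2 \<le> ?u x} \<inter> cball 0 R"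
      using M(1) u(2) unfolding U_def by force
    moreover have "closed {x. M / 2 \<le> ?u x}"
      using closed_Collect_le[OF continuous_on_const u(1)] .
    ultimately show ?thesis by (simp add: closed_Int_compact)
  qed
  have super: "l * ?u x + \<tau> * norm (0::'a) - (\<Sum>i\<in>Basis. 0) \<le> - (- l * M / 3)" if "x \<in> U" for x
    using that mult_left_mono_neg[of "M / 3" "?u x" l] l unfolding U_def by auto
  have c: "- l * M / 3 > 0" using l M(1) by (simp add: mult_neg_pos)
  have "y \<in> U" using M unfolding U_def by simp
  from maximum_principle[where a=0 and R=R, OF w u ineq \<tau> \<Omega>(1) U \<open>U \<subseteq> \<Omega>\<close> _ _ _ _ _ super c K this]
  have "?u y + 0 \<le> M / 2" by (simp add: has_dir_deriv_def)
  then show False using M by simp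
qed

text \<open>If the eigenvalue is small, the maximum point cannot lie within distance \<open>r\<close> of the centre
  \<open>z\<close> of a ball outside \<open>\<Omega>\<close>: the function \<open>1 - exp (- k |x - z|)\<close> is a strict supersolution in
  \<open>\<Omega> \<inter> ball z r\<close>. The radius \<open>\<rho>\<close> of the ball enters through the bound \<open>n / \<rho>\<close> for the Laplacian
  of the distance to \<open>z\<close>.\<close>

lemma max_point_far_from_exterior_ball:
  fixes \<Omega> :: "'a::euclidean_space set"
  assumes \<Omega>: "open \<Omega>" "bounded \<Omega>" and pe: "principal_eigenfunction \<Omega> v l \<phi>"
    and v: "Linf_norm \<Omega> v \<le> ereal \<tau>" and \<tau>: "\<tau> \<ge> 0"
    and l: "l \<ge> 0" "l < k * exp (- k * r)" and k: "k = \<tau> + DIM('a) / \<rho> + 1"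
    and \<rho>: "\<rho> > 0" "ball z \<rho> \<inter> \<Omega> = {}"
    and \<phi>: "\<And>y. y \<in> \<Omega> \<Longrightarrow> \<phi> y \<le> 1" and x: "x \<in> \<Omega>" "\<phi> x = 1"
  shows "r \<le> dist x z"
proof (rule ccontr)
  assume "\<not> r \<le> dist x z"
  let ?u = "zero_ext \<Omega> \<phi>" and ?p = "rdist 0 z" and ?n = "real DIM('a)"
  obtain G L where w: "weak_grad_lap \<Omega> ?u G L"
    and ineq: "AE x in lborel. x \<in> \<Omega> \<longrightarrow> L x \<ge> - \<tau> * norm (G x) - l * ?u x"
    by (rule eigenfunction_differential_inequality[OF \<Omega>(1) pe v])
  obtain R where u: "continuous_on UNIV ?u" "\<And>x. x \<notin> cball 0 R \<Longrightarrow> ?u x = 0"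
    by (rule eigenfunction_zero_ext[OF \<Omega> pe]) blast
  have u1: "?u y \<le> 1" for y using \<phi> unfolding zero_ext_def by simp
  have kpos: "k > 0" "k \<ge> 0" using \<tau> \<rho>(1) unfolding k by (auto intro!: add_nonneg_pos)
  define U where "U = \<Omega> \<inter> ball z r"
  define \<psi> where "\<psi> y = exp (- k * ?p y)" for y
  define g where "g y = (- k * \<psi> y / ?p y) *\<^sub>R (y - z)" for y
  define q where "q i y = k\<^sup>2 * \<psi> y * ((y - z) \<bullet> i / ?p y)\<^sup>2
      - k * \<psi> y * (1 / ?p y - ((y - z) \<bullet> i)\<^sup>2 / (?p y) ^ 3)" for i y
  have U: "open U" "U \<subseteq> \<Omega>" unfolding U_def using \<Omega>(1) by auto
  have p: "?p y \<ge> \<rho>" "?p y > 0" "?p y < r" if "y \<in> U" for y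
  proof -
    have "y \<notin> ball z \<rho>" "y \<in> ball z r" using that \<rho>(2) unfolding U_def by auto
    then show "?p y \<ge> \<rho>" "?p y < r" by (auto simp: rdist_0 dist_norm norm_minus_commute)
    then show "?p y > 0" using \<rho>(1) by linarith
  qed
  have \<psi>pos: "\<psi> y > 0" for y unfolding \<psi>_def by simp
  have cont\<psi>: "continuous_on S \<psi>" for S
    unfolding \<psi>_def[abs_def] by (intro continuous_intros continuous_rdist)
  have contg: "continuous_on U g"
    unfolding g_def[abs_def]
    by (intro continuous_intros cont\<psi> continuous_rdist) (use p(2) in force)
  have contq: "continuous_on U (q i)" for i
    unfolding q_def[abs_def]
    by (intro continuous_intros cont\<psi> continuous_rdist) (use p(2) in force)+
  have d\<psi>': "has_dir_deriv \<psi> i (- k * \<psi> y * ((y - z) \<bullet> i / ?p y)) y" if "y \<in> U" "i \<in> Basis" for y i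
  proof -
    have "((\<lambda>s. exp (- k * s)) has_real_derivative - k * \<psi> y) (at (?p y))"
      unfolding \<psi>_def by (auto intro!: derivative_eq_intros)
    from has_dir_deriv_compose[OF has_dir_deriv_rdist[OF p(2)[OF that(1)] that(2)] this]
    show ?thesis unfolding \<psi>_def[abs_def] .
  qed
  have gi: "g y \<bullet> i = - k * \<psi> y * ((y - z) \<bullet> i / ?p y)" for y i
    unfolding g_def by simp
  have d\<psi>: "has_dir_deriv \<psi> i (g y \<bullet> i) y" if "y \<in> U" "i \<in> Basis" for y i
    unfolding gi by (rule d\<psi>'[OF that])
  have dg: "has_dir_deriv (\<lambda>y. g y \<bullet> i) i (q i y) y" if "y \<in> U" "i \<in> Basis" for y i
  proof -
    have "has_dir_deriv (\<lambda>y. - k) i 0 y" unfolding has_dir_deriv_def by simp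
    from has_dir_deriv_mult[OF has_dir_deriv_mult[OF this d\<psi>'[OF that]]
        has_dir_deriv_rdist_grad[OF p(2)[OF that(1)] that(2)]]
    moreover have "(0 * \<psi> y + - k * \<psi> y * A * - k) * A + B * (- k * \<psi> y) = k\<^sup>2 * \<psi> y * A\<^sup>2 - k * \<psi> y * B" for A B
      by (simp add: power2_eq_square algebra_simps)
    ultimately show ?thesis unfolding gi q_def by (simp only:)
  qed
  have norm_g: "norm (g y) = k * \<psi> y" if "y \<in> U" for y
    using p(2)[OF that] \<psi>pos[of y] kpos unfolding g_def by (simp add: rdist_0 abs_mult)
  have sum_q: "(\<Sum>i\<in>Basis. q i y) \<ge> k * \<psi> y * (k - ?n / \<rho>)" if "y \<in> U" for y
  proof -
    have "(\<Sum>i\<in>Basis. q i y) = k\<^sup>2 * \<psi> y * (\<Sum>i\<in>Basis. ((y - z) \<bullet> i / ?p y)\<^sup>2)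
        - k * \<psi> y * (\<Sum>i\<in>Basis. 1 / ?p y - ((y - z) \<bullet> i)\<^sup>2 / (?p y) ^ 3)"
      unfolding q_def by (subst sum_subtractf) (simp only: sum_distrib_left)
    also have "\<dots> = k\<^sup>2 * \<psi> y - k * \<psi> y * (?n / ?p y - (norm (y - z))\<^sup>2 / (?p y) ^ 3)"
      unfolding sum_rdist_grad_sq[OF p(2)[OF that]] laplacian_rdist[OF p(2)[OF that]]
      using p(2)[OF that] by (simp add: rdist_0)
    also have "\<dots> = k * \<psi> y * (k - (?n / ?p y - (norm (y - z))\<^sup>2 / (?p y) ^ 3))"
      by (simp add: power2_eq_square algebra_simps)
    also have "\<dots> \<ge> k * \<psi> y * (k - ?n / \<rho>)"
    proof (rule mult_left_mono)
      have "?n / ?p y \<le> ?n / \<rho>" using p(1,2)[OF that] \<rho>(1) by (intro divide_left_mono) auto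
      moreover have "(norm (y - z))\<^sup>2 / (?p y) ^ 3 \<ge> 0" using p(2)[OF that] by simp
      ultimately show "k - ?n / \<rho> \<le> k - (?n / ?p y - (norm (y - z))\<^sup>2 / (?p y) ^ 3)" by linarith
      show "0 \<le> k * \<psi> y" using kpos \<psi>pos[of y] by simp
    qed
    finally show ?thesis .
  qed
  define c where "c = k * exp (- k * r) - l"
  have super: "l * ?u y + \<tau> * norm (g y) - (\<Sum>i\<in>Basis. q i y) \<le> - c" if "y \<in> U" for y
  proof -
    have "l * ?u y \<le> l" using mult_left_mono[OF u1 l(1), of y] by simp
    moreover have "\<tau> * (k * \<psi> y) - k * \<psi> y * (k - ?n / \<rho>) = - (k * \<psi> y)"
    proof -
      have kk: "k - ?n / \<rho> = \<tau> + 1" unfolding k by simp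
      show ?thesis unfolding kk by (simp add: algebra_simps)
    qed
    moreover have "k * exp (- k * r) \<le> k * \<psi> y"
      unfolding \<psi>_def using p(3)[OF that] kpos by (intro mult_left_mono) auto
    ultimately show ?thesis using sum_q[OF that] unfolding norm_g[OF that] c_def by linarith
  qed
  have xU: "x \<in> U" using x(1) \<open>\<not> r \<le> dist x z\<close> unfolding U_def by (simp add: dist_commute)
  have \<psi>x: "\<psi> x > exp (- k * r)" unfolding \<psi>_def using p(3)[OF xU] kpos by simp
  define s0 where "s0 = 1 + (\<psi> x + exp (- k * r)) / 2"
  have s0: "s0 > 1 + exp (- k * r)" "s0 < 1 + \<psi> x" unfolding s0_def using \<psi>x by auto
  have "compact {y \<in> U. s0 \<le> ?u y + \<psi> y}"
  proof -
    have "y \<in> U" if "y \<in> cball z r" "s0 \<le> ?u y + \<psi> y" for y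
    proof -
      have "\<psi> y \<le> 1" unfolding \<psi>_def using kpos by (simp add: rdist_0)
      moreover have "s0 > 1" using s0(1) exp_gt_zero[of "- k * r"] by linarith
      ultimately have "y \<in> \<Omega>" using that(2) unfolding zero_ext_def by (simp split: if_splits)
      moreover have "dist z y \<noteq> r"
      proof
        assume "dist z y = r"
        then have "\<psi> y = exp (- k * r)" unfolding \<psi>_def by (simp add: rdist_0 dist_norm norm_minus_commute)
        then show False using that(2) s0(1) u1[of y] by linarith
      qed
      ultimately show ?thesis using that(1) unfolding U_def by simp
    qed
    then have "{y \<in> U. s0 \<le> ?u y + \<psi> y} = {y. s0 \<le> ?u y + \<psi> y} \<inter> cball z r"
      unfolding U_def by auto
    moreover have "closed {y. s0 \<le> ?u y + \<psi> y}"
      by (intro closed_Collect_le continuous_on_const continuous_on_add u(1) cont\<psi>)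
    ultimately show ?thesis by (simp add: closed_Int_compact)
  qed
  moreover have "c > 0" unfolding c_def using l(2) by simp
  ultimately have "?u x + \<psi> x \<le> s0"
    by (intro maximum_principle[where a=0 and R=R, OF w u ineq \<tau> \<Omega>(1) U cont\<psi> contg contq d\<psi> dg super _ _ xU])
  then show False using x s0(2) by (simp add: zero_ext_def)
qed

section \<open>Exterior balls\<close>

text \<open>A consequence of the local epigraph representation: near every boundary point there are
  balls outside \<open>\<Omega>\<close>, and by compactness their radius can be chosen uniformly. Tangency is not
  needed.\<close>

lemma uniform_exterior_balls:
  fixes \<Omega> :: "'a::euclidean_space set"
  assumes \<Omega>: "open \<Omega>" "bounded \<Omega>" "C2_boundary \<Omega>" and "e > 0"
  obtains \<rho> where "\<rho> > 0" "\<And>y. y \<in> frontier \<Omega> \<Longrightarrow> \<exists>z. dist y z < e \<and> ball z \<rho> \<inter> \<Omega> = {}"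
proof -
  have near: "\<exists>z \<rho>. dist y z < e / 2 \<and> \<rho> > 0 \<and> ball z \<rho> \<inter> \<Omega> = {}" if y: "y \<in> frontier \<Omega>" for y
  proof -
    obtain r a \<gamma> where r: "r > 0" "norm a = 1" "Ck_on 2 UNIV \<gamma>"
      and eq: "\<Omega> \<inter> ball y r = {x \<in> ball y r. \<gamma> (x - (x \<bullet> a) *\<^sub>R a) < x \<bullet> a}"
      using \<Omega>(3) y unfolding C2_boundary_def by blast
    have "Ck_on (Suc (Suc 0)) UNIV \<gamma>" using r(3) by (simp only: numeral_2_eq_2)
    then have cont: "continuous_on UNIV \<gamma>" using Ck_on_SucD[of 0] Ck_on_SucD[of "Suc 0"] by (metis Ck_on.simps(1))
    \<comment> \<open>Moving from \<open>y\<close> in the direction \<open>- a\<close> leaves the component orthogonal to \<open>a\<close> unchanged and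
        leads strictly below the graph.\<close>
    define s where "s = min r e / 4"
    have s: "s > 0" "s < r" "s < e / 2" unfolding s_def using r(1) \<open>e > 0\<close> by auto
    define z where "z = y - s *\<^sub>R a"
    have dz: "dist y z = s" unfolding z_def using s r(2) by (simp add: dist_norm)
    have aa: "a \<bullet> a = 1" using r(2) by (simp add: dot_square_norm)
    have "y \<notin> \<Omega>" using y \<Omega>(1) by (simp add: frontier_def interior_open)
    then have "y \<bullet> a \<le> \<gamma> (y - (y \<bullet> a) *\<^sub>R a)" using eq r(1) by force
    moreover have za: "z \<bullet> a = y \<bullet> a - s" "z - (z \<bullet> a) *\<^sub>R a = y - (y \<bullet> a) *\<^sub>R a"
      unfolding z_def using aa by (auto simp: inner_diff_left algebra_simps)
    ultimately have zin: "z \<in> {x. x \<bullet> a < \<gamma> (x - (x \<bullet> a) *\<^sub>R a)} \<inter> ball y r"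
      using s dz by simp
    have "open ({x. x \<bullet> a < \<gamma> (x - (x \<bullet> a) *\<^sub>R a)} \<inter> ball y r)"
      by (intro open_Int open_ball open_Collect_less continuous_on_compose2[OF cont] continuous_intros) auto
    from open_contains_ball[THEN iffD1, OF this, rule_format, OF zin]
    obtain \<rho> where "\<rho> > 0" and \<rho>: "ball z \<rho> \<subseteq> {x. x \<bullet> a < \<gamma> (x - (x \<bullet> a) *\<^sub>R a)} \<inter> ball y r" by blast
    have "ball z \<rho> \<inter> \<Omega> = {}"
    proof (rule equals0I)
      fix x assume x: "x \<in> ball z \<rho> \<inter> \<Omega>"
      then have "x \<in> \<Omega> \<inter> ball y r" "x \<bullet> a < \<gamma> (x - (x \<bullet> a) *\<^sub>R a)" using \<rho> by auto
      then show False unfolding eq by simp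
    qed
    then show ?thesis using \<open>\<rho> > 0\<close> dz s by blast
  qed
  then obtain Z P where ZP: "\<And>y. y \<in> frontier \<Omega> \<Longrightarrow> dist y (Z y) < e / 2 \<and> P y > 0 \<and> ball (Z y) (P y) \<inter> \<Omega> = {}"
    by metis
  have "compact (frontier \<Omega>)" using \<Omega>(2) by (simp add: compact_frontier_bounded)
  then obtain F where F: "F \<subseteq> frontier \<Omega>" "finite F" "frontier \<Omega> \<subseteq> (\<Union>y\<in>F. ball y (e / 2))"
    by (rule compactE_image[of _ "frontier \<Omega>" "\<lambda>y. ball y (e / 2)"]) (use \<open>e > 0\<close> in auto)
  define \<rho> where "\<rho> = Min (insert 1 (P ` F))"
  have fin: "finite (insert 1 (P ` F))" using F(2) by simp
  have "\<rho> > 0" unfolding \<rho>_def using fin ZP F(1) by (subst Min_gr_iff) auto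
  moreover have "\<exists>z. dist y z < e \<and> ball z \<rho> \<inter> \<Omega> = {}" if yf: "y \<in> frontier \<Omega>" for y
  proof -
    obtain y' where y': "y' \<in> F" "y \<in> ball y' (e / 2)" using F(3) yf by blast
    have zp: "dist y' (Z y') < e / 2" "ball (Z y') (P y') \<inter> \<Omega> = {}" using ZP F(1) y'(1) by blast+
    have "\<rho> \<le> P y'" unfolding \<rho>_def using fin y'(1) by (intro Min_le) auto
    then have "ball (Z y') \<rho> \<inter> \<Omega> = {}" using zp(2) subset_ball[of \<rho> "P y'" "Z y'"] by blast
    moreover have "dist y (Z y') < e"
      using dist_triangle[of y "Z y'" y'] zp(1) y'(2) by (simp add: dist_commute)
    ultimately show ?thesis by blast
  qed
  ultimately show thesis using that by blast
qed

lemma ball_infdist_frontier_subset: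
  fixes \<Omega> :: "'a::euclidean_space set"
  assumes "open \<Omega>" "c \<in> \<Omega>" "frontier \<Omega> \<noteq> {}"
  shows "ball c (infdist c (frontier \<Omega>)) \<subseteq> \<Omega>"
proof (rule ccontr)
  let ?B = "ball c (infdist c (frontier \<Omega>))"
  assume "\<not> ?B \<subseteq> \<Omega>"
  then obtain x where x: "x \<in> ?B" "x \<notin> \<Omega>" by blast
  then have "0 < infdist c (frontier \<Omega>)" using zero_le_dist[of c x] unfolding mem_ball by linarith
  then have "c \<in> ?B \<inter> \<Omega>" using assms(2) by simp
  then have "?B \<inter> frontier \<Omega> \<noteq> {}"
    using connected_Int_frontier[OF connected_ball, of c "infdist c (frontier \<Omega>)" \<Omega>] x by blast
  then obtain y where "y \<in> frontier \<Omega>" "dist c y < infdist c (frontier \<Omega>)" by auto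
  then show False using infdist_le[of y "frontier \<Omega>" c] by linarith
qed

section \<open>Convergence of the maximum points\<close>

lemma radial_drift_Linf:
  fixes \<Omega> :: "'a::euclidean_space set" and c :: 'a
  assumes "\<delta> > 0" "\<tau> \<ge> 0"
  defines "w \<equiv> \<lambda>x. (\<tau> / rdist \<delta> c x) *\<^sub>R (x - c)"
  shows "w \<in> Linf \<Omega>" "Linf_norm \<Omega> w \<le> ereal \<tau>"
proof -
  have pos: "rdist \<delta> c x > 0" "norm (x - c) \<le> rdist \<delta> c x" for x
    using rdist_ge[of \<delta>] assms(1) by (auto intro: less_le_trans)
  have "continuous_on UNIV w"
    unfolding w_def by (intro continuous_intros continuous_rdist) (use pos(1) in \<open>auto simp: less_imp_neq[symmetric]\<close>)
  then have "w \<in> borel_measurable lborel" by (simp add: borel_measurable_continuous_onI)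
  then have "w \<in> borel_measurable lebesgue" using measurable_completion by blast
  then have m: "w \<in> borel_measurable (lebesgue_on \<Omega>)" by (rule measurable_restrict_space1)
  have n: "norm (w x) \<le> \<tau>" for x
  proof -
    have "norm (w x) = \<tau> * (norm (x - c) / rdist \<delta> c x)"
      unfolding w_def using assms(2) pos(1)[of x] by simp
    also have "\<dots> \<le> \<tau> * 1" using assms(2) pos[of x] by (intro mult_left_mono) auto
    finally show ?thesis by simp
  qed
  show le: "Linf_norm \<Omega> w \<le> ereal \<tau>"
    unfolding Linf_norm_def
  proof (rule esssup_I)
    show "(\<lambda>x. ereal (norm (w x))) \<in> borel_measurable (lebesgue_on \<Omega>)" using m by measurable
  qed (use n in simp)
  show "w \<in> Linf \<Omega>" unfolding Linf_def using m le by (auto intro: le_less_trans)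
qed

text \<open>The exponential rates \<open>R - e/4\<close> of the upper bound and \<open>R - e/2\<close> of the barrier differ by
  \<open>e/4\<close>, which beats all constants.\<close>

lemma eventually_exponential_gap:
  fixes e R N a C :: real
  assumes "0 < e" "e \<le> R" "N > 0" "a \<ge> 0" "C \<ge> 0"
  shows "\<forall>\<^sub>F \<tau> in at_top. \<tau> > a \<and> exp ((\<tau> - a) * (e / 4 - R)) \<le> 1 / 2 \<and>
    8 * (\<tau> - a) * N * exp ((\<tau> - a) * (e / 4 - R)) < (\<tau> + C) * exp (- (\<tau> + C) * (R - e / 2))"
proof -
  have "\<forall>\<^sub>F \<tau> in at_top. \<tau> > a"
    "\<forall>\<^sub>F \<tau> in at_top. \<tau> > a + ln 2 / (R - e / 4)"
    "\<forall>\<^sub>F \<tau> in at_top. \<tau> > (ln (8 * N) + a * (R - e / 4) + C * (R - e / 2)) * 4 / e"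
    by (rule eventually_gt_at_top)+
  then show ?thesis
  proof eventually_elim
    case (elim \<tau>)
    have Re: "R - e / 4 > 0" using assms by linarith
    have "ln 2 < (\<tau> - a) * (R - e / 4)" using elim(2) Re by (simp add: field_simps)
    then have "(\<tau> - a) * (e / 4 - R) \<le> - ln 2" by (simp add: algebra_simps)
    then have "exp ((\<tau> - a) * (e / 4 - R)) \<le> exp (- ln 2)" by (simp only: exp_le_cancel_iff)
    also have "\<dots> = 1 / 2" by (simp add: exp_minus)
    finally have half: "exp ((\<tau> - a) * (e / 4 - R)) \<le> 1 / 2" .
    have "ln (8 * N) + a * (R - e / 4) + C * (R - e / 2) < \<tau> * (e / 4)"
      using elim(3) assms(1) by (simp add: field_simps)
    then have "ln (8 * N) + (\<tau> - a) * (e / 4 - R) < - (\<tau> + C) * (R - e / 2)"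
      by (simp add: field_simps)
    then have "exp (ln (8 * N) + (\<tau> - a) * (e / 4 - R)) < exp (- (\<tau> + C) * (R - e / 2))"
      by (simp only: exp_less_cancel_iff)
    then have lt: "8 * N * exp ((\<tau> - a) * (e / 4 - R)) < exp (- (\<tau> + C) * (R - e / 2))"
      using assms(3) by (simp add: exp_add)
    have "(\<tau> - a) * (8 * N * exp ((\<tau> - a) * (e / 4 - R))) \<le> (\<tau> + C) * (8 * N * exp ((\<tau> - a) * (e / 4 - R)))"
      using assms by (intro mult_right_mono) auto
    also have "\<dots> < (\<tau> + C) * exp (- (\<tau> + C) * (R - e / 2))"
      using elim(1) assms by (intro mult_strict_left_mono lt) linarith
    also have "(\<tau> - a) * (8 * N * exp ((\<tau> - a) * (e / 4 - R))) = 8 * (\<tau> - a) * N * exp ((\<tau> - a) * (e / 4 - R))"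
      by (simp only: mult_ac)
    finally show ?case using elim(1) half by blast
  qed
qed

theorem theorem1p1:
  fixes \<Omega> :: "(real ^ 'n) set"
    and lam :: "(real ^ 'n \<Rightarrow> real ^ 'n) \<Rightarrow> real"
    and v :: "real \<Rightarrow> real ^ 'n \<Rightarrow> real ^ 'n"
    and \<phi> :: "real \<Rightarrow> real ^ 'n \<Rightarrow> real"
    and x :: "real \<Rightarrow> real ^ 'n"
  assumes domain: "open \<Omega>" "connected \<Omega>" "bounded \<Omega>" "C2_boundary \<Omega>"
    and lam: "\<And>w. w \<in> Linf \<Omega> \<Longrightarrow> principal_eigenvalue \<Omega> w (lam w)"
    and v: "\<And>\<tau>. \<tau> \<ge> 0 \<Longrightarrow> v \<tau> \<in> Linf \<Omega> \<and> Linf_norm \<Omega> (v \<tau>) \<le> ereal \<tau> \<and>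
              lam (v \<tau>) = min_eigenvalue \<Omega> lam \<tau>"
    and phi: "\<And>\<tau>. \<tau> \<ge> 0 \<Longrightarrow> principal_eigenfunction \<Omega> (v \<tau>) (lam (v \<tau>)) (\<phi> \<tau>) \<and>
              (\<forall>y\<in>closure \<Omega>. \<phi> \<tau> y \<le> 1) \<and> (\<exists>y\<in>closure \<Omega>. \<phi> \<tau> y = 1)"
    and x: "\<And>\<tau>. \<tau> \<ge> 0 \<Longrightarrow> x \<tau> \<in> \<Omega> \<and> (\<forall>y\<in>closure \<Omega>. \<phi> \<tau> y \<le> \<phi> \<tau> (x \<tau>))"
  shows "((\<lambda>\<tau>. infdist (x \<tau>) (frontier \<Omega>)) \<longlongrightarrow>
            (SUP y\<in>closure \<Omega>. infdist y (frontier \<Omega>))) at_top"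
proof -
  let ?d = "\<lambda>y. infdist y (frontier \<Omega>)" and ?n = "real DIM(real ^ 'n)"
  define R where "R = (SUP y\<in>closure \<Omega>. ?d y)"
  have x0: "x 0 \<in> \<Omega>" using x[of 0] by simp
  have "\<Omega> \<noteq> UNIV" using domain(3) not_bounded_UNIV by auto
  then have fr: "frontier \<Omega> \<noteq> {}" using frontier_not_empty[of \<Omega>] x0 by blast
  have "compact (closure \<Omega>)" using domain(3) by (simp add: compact_closure)
  moreover have "closure \<Omega> \<noteq> {}" using x0 by auto
  moreover have "continuous_on (closure \<Omega>) ?d" by (intro continuous_intros)
  ultimately obtain c where c: "c \<in> closure \<Omega>" "\<And>y. y \<in> closure \<Omega> \<Longrightarrow> ?d y \<le> ?d c"
    using continuous_attains_sup[of "closure \<Omega>" ?d] by blast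
  have Rc: "R = ?d c" unfolding R_def by (rule cSup_eq_maximum) (use c in auto)
  have cl: "y \<in> closure \<Omega>" if "y \<in> \<Omega>" for y using that closure_subset by blast
  have "x 0 \<notin> frontier \<Omega>" using x0 domain(1) by (simp add: frontier_def interior_open)
  then have "?d (x 0) > 0" using infdist_pos_not_in_closed[OF _ fr] by simp
  then have R: "R > 0" using c(2)[OF cl[OF x0]] Rc by linarith
  then have "c \<notin> frontier \<Omega>" using Rc by auto
  then have c\<Omega>: "c \<in> \<Omega>" using c(1) domain(1) by (simp add: frontier_def interior_open)
  have ball: "ball c R \<subseteq> \<Omega>" unfolding Rc by (rule ball_infdist_frontier_subset[OF domain(1) c\<Omega> fr])
  \<comment> \<open>Nonnegativity makes the infimum in \<open>min_eigenvalue\<close> an actual lower bound.\<close>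
  have nonneg: "lam w \<ge> 0" if "w \<in> Linf \<Omega>" "Linf_norm \<Omega> w \<le> ereal \<tau>" "\<tau> \<ge> 0" for w \<tau>
    using lam[OF that(1)] principal_eigenvalue_nonneg[OF domain(1,3) x0 _ that(2,3)]
    unfolding principal_eigenvalue_def by blast
  have min: "lam (v \<tau>) \<le> lam w" if "w \<in> Linf \<Omega>" "Linf_norm \<Omega> w \<le> ereal \<tau>" "\<tau> \<ge> 0" for w \<tau>
  proof -
    have "min_eigenvalue \<Omega> lam \<tau> \<le> lam w" unfolding min_eigenvalue_def
    proof (rule cINF_lower)
      show "bdd_below (lam ` {w \<in> Linf \<Omega>. Linf_norm \<Omega> w \<le> ereal \<tau>})"
        using nonneg that(3) by (auto intro!: bdd_belowI2[where m=0])
    qed (use that in simp)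
    then show ?thesis using v[OF that(3)] by simp
  qed
  have le: "?d (x \<tau>) \<le> R" if "\<tau> \<ge> 0" for \<tau>
    using c(2)[OF cl] x[OF that] Rc by simp
  have "((\<lambda>\<tau>. ?d (x \<tau>)) \<longlongrightarrow> R) at_top"
  proof (rule tendstoI)
    fix \<epsilon> :: real assume "\<epsilon> > 0"
    define e where "e = min \<epsilon> R"
    have e: "0 < e" "e \<le> R" "e \<le> \<epsilon>" unfolding e_def using \<open>\<epsilon> > 0\<close> R by auto
    \<comment> \<open>Chosen so that \<open>P < R\<close> and \<open>2 * \<delta> - P = e / 4 - R\<close>.\<close>
    define \<delta> where "\<delta> = e / 16"
    define P where "P = R - e / 8"
    have \<delta>P: "\<delta> > 0" "\<delta> < P" "P < R" "2 * \<delta> - P = e / 4 - R" unfolding \<delta>_def P_def using e by auto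
    obtain \<rho> where \<rho>: "\<rho> > 0" "\<And>y. y \<in> frontier \<Omega> \<Longrightarrow> \<exists>z. dist y z < e / 4 \<and> ball z \<rho> \<inter> \<Omega> = {}"
      using uniform_exterior_balls[OF domain(1,3,4), of "e / 4"] e(1) by (metis zero_less_divide_iff zero_less_numeral)
    define a where "a = ?n / \<delta>"
    define C where "C = ?n / \<rho> + 1"
    have aC: "a > 0" "C \<ge> 0" unfolding a_def C_def using \<delta>P(1) \<rho>(1) by auto
    have "\<forall>\<^sub>F \<tau> in at_top. \<tau> > a \<and> exp ((\<tau> - a) * (e / 4 - R)) \<le> 1 / 2 \<and>
      8 * (\<tau> - a) * a * exp ((\<tau> - a) * (e / 4 - R)) < (\<tau> + C) * exp (- (\<tau> + C) * (R - e / 2))"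
      using eventually_exponential_gap[OF e(1,2) aC(1) less_imp_le[OF aC(1)] aC(2)] .
    then show "\<forall>\<^sub>F \<tau> in at_top. dist (?d (x \<tau>)) R < \<epsilon>"
    proof eventually_elim
      case (elim \<tau>)
      then have \<tau>: "\<tau> > a" "\<tau> \<ge> 0" using aC(1) by auto
      let ?w = "\<lambda>y. (\<tau> / rdist \<delta> c y) *\<^sub>R (y - c)"
      have w: "?w \<in> Linf \<Omega>" "Linf_norm \<Omega> ?w \<le> ereal \<tau>"
        by (rule radial_drift_Linf[OF \<delta>P(1) \<tau>(2)])+
      obtain \<phi>' where \<phi>': "principal_eigenfunction \<Omega> ?w (lam ?w) \<phi>'"
        using lam[OF w(1)] unfolding principal_eigenvalue_def by blast
      have "cball c P \<subseteq> \<Omega>" using ball \<delta>P(3) by (auto simp: subset_iff)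
      then have "lam ?w \<le> 8 * (\<tau> - a) * (?n / \<delta>) * exp ((\<tau> - a) * (2 * \<delta> - P))"
        by (rule eigenvalue_upper_bound[OF domain(1) \<phi>' _ \<delta>P(1,2)]) (use \<tau> elim \<delta>P(4) in \<open>auto simp: a_def\<close>)
      then have small: "lam (v \<tau>) < (\<tau> + C) * exp (- (\<tau> + C) * (R - e / 2))"
        using elim min[OF w \<tau>(2)] unfolding \<delta>P(4) a_def[symmetric] by linarith
      have "R - e < ?d (x \<tau>)"
      proof (rule ccontr)
        assume "\<not> R - e < ?d (x \<tau>)"
        then have "?d (x \<tau>) \<le> R - e" by simp
        moreover obtain y where y: "y \<in> frontier \<Omega>" "?d (x \<tau>) = dist (x \<tau>) y"
          using infdist_attains_inf[OF frontier_closed fr] by blast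
        moreover obtain z where z: "dist y z < e / 4" "ball z \<rho> \<inter> \<Omega> = {}" using \<rho>(2)[OF y(1)] by blast
        ultimately have "dist (x \<tau>) z < R - e / 2"
          using dist_triangle[of "x \<tau>" z y] e(1) by linarith
        moreover have "R - e / 2 \<le> dist (x \<tau>) z"
        proof (rule max_point_far_from_exterior_ball[OF domain(1,3)])
          show "principal_eigenfunction \<Omega> (v \<tau>) (lam (v \<tau>)) (\<phi> \<tau>)" using phi[OF \<tau>(2)] by blast
          show "Linf_norm \<Omega> (v \<tau>) \<le> ereal \<tau>" using v[OF \<tau>(2)] by blast
          show "lam (v \<tau>) \<ge> 0" using nonneg v[OF \<tau>(2)] \<tau>(2) by blast
          show "\<tau> + C = \<tau> + ?n / \<rho> + 1" unfolding C_def by simp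
          show "\<phi> \<tau> y \<le> 1" if "y \<in> \<Omega>" for y using phi[OF \<tau>(2)] cl[OF that] by blast
          show "\<phi> \<tau> (x \<tau>) = 1" using phi[OF \<tau>(2)] x[OF \<tau>(2)] cl by (metis antisym)
        qed (use \<tau> small \<rho>(1) z(2) x[OF \<tau>(2)] in auto)
        ultimately show False by linarith
      qed
      then show ?case using le[OF \<tau>(2)] e(3) by (simp add: dist_real_def)
    qed
  qed
  then show ?thesis unfolding R_def .
qed

end
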